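(* Let $q\ge 2$ be an integer and $k$ a positive integer. Assume the Generalized Riemann Hypothesis. Then for every $\varepsilon>0$, \[\sum_{\substack{\chi\bmod q,\ \chi\neq\chi_0\\ \chi(-1)=1}}\frac{1}{|L(1,\chi)|^{2k}}=\frac{C(k)}{2}\,\varphi(q)\prod_{p\mid q}\left(1+\frac{\binom{k}{1}^2}{p^2}+\dots+\frac{\binom{k}{k}^2}{p^{2k}}\right)^{-1}\left(1+O\!\left(q^{-1+\varepsilon}\right)\right),\] where the sum runs over the non-principal even Dirichlet characters modulo $q$ and \[C(k)=\prod_p\left(1+\frac{\binom{k}{1}^2}{p^2}+\dots+\frac{\binom{k}{k}^2}{p^{2k}}\right),\] the products being over primes $p$.
   Context: $\chi_0$ is the principal character modulo $q$, $L(s,\chi)$ the Dirichlet $L$-function, $\varphi$ Euler's totient function. GRH asserts all nontrivial zeros of all Dirichlet $L$-functions have real part $1/2$. The implied constant may depend on $k$ and $\varepsilon$. *)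

theory Defs
  imports "HOL-Complex_Analysis.Complex_Analysis" "HOL-Number_Theory.Number_Theory"
begin

definition dirichlet_char :: "nat \<Rightarrow> (nat \<Rightarrow> complex) \<Rightarrow> bool" where
  "dirichlet_char q chi \<longleftrightarrow> q \<ge> 1 \<and>
     (\<forall>n. chi (n + q) = chi n) \<and>
     (\<forall>m n. chi (m * n) = chi m * chi n) \<and>
     (\<forall>n. chi n \<noteq> 0 \<longleftrightarrow> coprime n q)"

definition principal_char :: "nat \<Rightarrow> nat \<Rightarrow> complex" where
  "principal_char q = (\<lambda>n. if coprime n q then 1 else 0)"

definition dirichlet_L :: "nat \<Rightarrow> (nat \<Rightarrow> complex) \<Rightarrow> complex \<Rightarrow> complex" where
  "dirichlet_L q chi = (SOME f.
     f holomorphic_on (if chi = principal_char q then - {1} else UNIV) \<and>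
     (\<forall>s. Re s > 1 \<longrightarrow>
        (\<lambda>n. chi (Suc n) / of_nat (Suc n) powr s) sums f s))"

definition GRH :: bool where
  "GRH \<longleftrightarrow> (\<forall>q chi s. dirichlet_char q chi \<longrightarrow> 0 < Re s \<longrightarrow> Re s < 1 \<longrightarrow>
      dirichlet_L q chi s = 0 \<longrightarrow> Re s = 1/2)"

definition local_factor :: "nat \<Rightarrow> nat \<Rightarrow> real" where
  "local_factor k p = (\<Sum>j=0..k. real (k choose j) ^ 2 / real p ^ (2 * j))"

definition C_const :: "nat \<Rightarrow> real" where
  "C_const k = (\<Prod>n. if prime n then local_factor k n else 1)"

end

theory Submission
  imports Defs
begin

text \<open>
  For a nonprincipal \<open>\<chi>\<close> let \<open>f(s) = L(s,\<chi>) powr -k = \<Sum> a(n) \<chi>(n) n powr -s\<close>. By GRH and non-vanishing on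
  \<open>Re s = 1\<close>, \<open>f\<close> is holomorphic for \<open>Re s > 1/2\<close>, and Borel--Caratheodory bounds it by a fixed power
  of \<open>q\<close> on the disc of radius 5/4 about 2. Cutting its Taylor series at 2 after about \<open>A log q\<close> terms
  therefore gives \<open>f(1) = \<Sum> a(n) \<chi>(n) w(n) / n + O(1/q)\<close>, where \<open>w(n)\<close> is the probability that a Poisson
  variable of mean \<open>log n\<close> is at most \<open>A log q\<close>: a smooth cutoff at a power of \<open>q\<close>, obtained without
  any contour integral. Orthogonality over the even characters leaves the diagonal
  \<open>\<Sum> a(n)\<^sup>2 / n\<^sup>2\<close> over \<open>n\<close> coprime to \<open>q\<close>, an Euler product, and the terms \<open>m \<equiv> \<plusminus>n\<close> with \<open>m \<noteq> n\<close>, which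
  are sparse enough to contribute a relative error \<open>O(q powr (-1 + \<epsilon>))\<close>.
\<close>

section \<open>Euler products\<close>

text \<open>\<open>dirichlet_L\<close> is a \<open>SOME\<close> choice, so its values are unknown
  until an entire function with the defining series has been exhibited and shown to be unique; hence
  the continuation to the whole plane. \<open>GRH\<close> speaks only of the open strip, so the line
  Re s = 1 needs its own argument: the 3-4-1 inequality leaves out only a real character at s = 1,
  where an elementary Lambert series argument takes over. The centre 2 lies where the Dirichlet
  series converges absolutely, and 5/4 lies between the distance 1 to the target point and the
  distance 3/2 to the critical line. Expanding n powr -s at 2 and evaluating at 1 gives n powr -2
  times a partial sum of exp (ln n): the origin of the Poisson weights. Since 1/L costs q^17, the
  constant A is chosen to outweigh q^(17 k) with one power of q to spare. The price is a factor exp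
  (\<theta> J) in the coefficients, held to a small power of q by a \<theta> proportional to
  \<epsilon> / A. Parseval includes the principal character; its term is a small power of q,
  negligible against the totient.\<close>

lemma bij_betw_prime_power_times:
  fixes p :: nat and P :: "nat set"
  assumes p: "prime p" and pP: "p \<notin> P"
  shows "bij_betw (\<lambda>(j, m). p ^ j * m) (UNIV \<times> {n::nat. n > 0 \<and> prime_factors n \<subseteq> P})
           {n::nat. n > 0 \<and> prime_factors n \<subseteq> insert p P}"
proof (rule bij_betw_byWitness[where f' = "\<lambda>n. (multiplicity p n, n div p ^ multiplicity p n)"])
  have ndvd: "\<not> p dvd m" if "m > 0" "prime_factors m \<subseteq> P" for m
    using that p pP by (auto simp: prime_factors_dvd)
  have "multiplicity p (p ^ j * m) = j" if "m > 0" "prime_factors m \<subseteq> P" for j m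
    using ndvd[OF that] p that(1) by (intro multiplicity_eqI) (auto simp: prime_gt_0_nat)
  then show "\<forall>a\<in>UNIV \<times> {n::nat. n > 0 \<and> prime_factors n \<subseteq> P}.
      (\<lambda>n. (multiplicity p n, n div p ^ multiplicity p n)) ((\<lambda>(j, m). p ^ j * m) a) = a"
    using p by (auto simp: prime_gt_0_nat)
  show "\<forall>a'\<in>{n::nat. n > 0 \<and> prime_factors n \<subseteq> insert p P}.
      (\<lambda>(j, m). p ^ j * m) ((\<lambda>n. (multiplicity p n, n div p ^ multiplicity p n)) a') = a'"
    by (auto simp: multiplicity_dvd)
  show "(\<lambda>(j, m). p ^ j * m) ` (UNIV \<times> {n::nat. n > 0 \<and> prime_factors n \<subseteq> P})
      \<subseteq> {n::nat. n > 0 \<and> prime_factors n \<subseteq> insert p P}"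
  proof clarify
    fix j m :: nat assume m: "m > 0" "prime_factors m \<subseteq> P"
    have "r \<in> insert p P" if "r \<in> prime_factors (p ^ j * m)" for r
    proof -
      have r: "prime r" "r dvd p ^ j * m"
        using that by (auto simp: in_prime_factors_iff)
      then have "r dvd p ^ j \<or> r dvd m" using prime_dvd_multD by blast
      then have "r = p \<or> r dvd m"
        using p r(1) prime_dvd_power primes_dvd_imp_eq by blast
      then show ?thesis using m r(1) by (auto simp: prime_factors_dvd)
    qed
    then show "p ^ j * m > 0 \<and> prime_factors (p ^ j * m) \<subseteq> insert p P"
      using m p by (auto simp: prime_gt_0_nat)
  qed
  show "(\<lambda>n. (multiplicity p n, n div p ^ multiplicity p n)) ` {n::nat. n > 0 \<and> prime_factors n \<subseteq> insert p P}
      \<subseteq> UNIV \<times> {n::nat. n > 0 \<and> prime_factors n \<subseteq> P}"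
  proof (rule image_subsetI)
    fix n :: nat assume "n \<in> {n. n > 0 \<and> prime_factors n \<subseteq> insert p P}"
    then have n: "n > 0" "prime_factors n \<subseteq> insert p P" by auto
    define m where "m = n div p ^ multiplicity p n"
    have nm: "n = p ^ multiplicity p n * m" by (simp add: m_def multiplicity_dvd)
    have "m > 0" using nm n(1) by (metis gr0I mult_0_right)
    moreover have "\<not> p dvd m"
      using multiplicity_decompose[of n p] n(1) p not_prime_unit[of p] unfolding m_def by blast
    moreover have "prime_factors m \<subseteq> prime_factors n"
      using nm n(1) by (metis dvd_prime_factors dvd_triv_right neq0_conv)
    ultimately have "m > 0 \<and> prime_factors m \<subseteq> P"
      using n(2) by (auto simp: prime_factors_dvd)
    then show "(multiplicity p n, n div p ^ multiplicity p n) \<in> UNIV \<times> {n::nat. n > 0 \<and> prime_factors n \<subseteq> P}"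
      by (simp add: m_def)
  qed
qed

text \<open>Induction on \<open>P\<close>: splitting off the exact power of the new prime turns the
  sum into a double sum over exponent and cofactor, and multiplicativity separates the two
  variables. Absolute summability pays for the rearrangement.\<close>

lemma finite_euler_product:
  fixes f :: "nat \<Rightarrow> 'a :: {real_normed_field, banach}"
  assumes f1: "f 1 = 1" and mult: "\<And>m n. coprime m n \<Longrightarrow> f (m * n) = f m * f n"
    and summ: "f abs_summable_on UNIV"
    and P: "finite P" "\<And>p. p \<in> P \<Longrightarrow> prime p"
  shows "(\<Prod>p\<in>P. \<Sum>\<^sub>\<infinity>j. f (p ^ j)) = infsum f {n::nat. n > 0 \<and> prime_factors n \<subseteq> P}"
  using P
proof (induction P rule: finite_induct)
  case empty
  have "{n::nat. n > 0 \<and> prime_factors n \<subseteq> {}} = {1}"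
    by (auto simp: prime_factorization_empty_iff)
  then show ?case using f1 by simp
next
  case (insert p P)
  define S where "S = {n::nat. n > 0 \<and> prime_factors n \<subseteq> P}"
  define S' where "S' = {n::nat. n > 0 \<and> prime_factors n \<subseteq> insert p P}"
  have p: "prime p" using insert by auto
  have bij: "bij_betw (\<lambda>(j, m). p ^ j * m) (UNIV \<times> S) S'"
    using bij_betw_prime_power_times[OF p insert.hyps(2)] by (simp add: S_def S'_def)
  have fm: "f (p ^ j * m) = f (p ^ j) * f m" if "m \<in> S" for j m
  proof -
    have "\<not> p dvd m" using that p insert.hyps by (auto simp: S_def prime_factors_dvd)
    then have "coprime (p ^ j) m" using p by (simp add: prime_imp_coprime)
    then show ?thesis by (rule mult)
  qed
  have fS': "f summable_on S'"
    using summ abs_summable_summable summable_on_subset_banach by blast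
  have sm: "(\<lambda>(j, m). f (p ^ j) * f m) summable_on UNIV \<times> S"
  proof -
    have "(f \<circ> (\<lambda>(j, m). p ^ j * m)) summable_on UNIV \<times> S"
      using fS' bij by (metis bij_betw_imp_inj_on bij_betw_imp_surj_on summable_on_reindex)
    then show ?thesis
      by (rule summable_on_cong[THEN iffD1, rotated]) (auto simp: fm)
  qed
  have "infsum f S' = infsum (\<lambda>(j, m). f (p ^ j) * f m) (UNIV \<times> S)"
    by (subst infsum_reindex_bij_betw[OF bij, symmetric], rule infsum_cong) (auto simp: fm)
  also have "\<dots> = (\<Sum>\<^sub>\<infinity>j. \<Sum>\<^sub>\<infinity>m\<in>S. f (p ^ j) * f m)"
    by (rule infsum_Sigma'_banach[OF sm, symmetric])
  also have "\<dots> = (\<Sum>\<^sub>\<infinity>j. f (p ^ j)) * infsum f S"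
    by (simp add: infsum_cmult_left' infsum_cmult_right')
  finally show ?case
    using insert by (simp add: S_def S'_def)
qed

text \<open>Every number in \<open>{1..N}\<close> has only prime factors up to \<open>N\<close>, so
  the finite product misses the full sum by no more than the tail beyond \<open>N\<close>. Stating a
  limit of partial products makes no claim that the limit is nonzero.\<close>

lemma euler_product:
  fixes f :: "nat \<Rightarrow> 'a :: {real_normed_field, banach}"
  assumes f0: "f 0 = 0" and f1: "f 1 = 1"
    and mult: "\<And>m n. coprime m n \<Longrightarrow> f (m * n) = f m * f n"
    and summ: "summable (\<lambda>n. norm (f n))"
  shows "(\<lambda>N. \<Prod>p | prime p \<and> p \<le> N. \<Sum>j. f (p ^ j)) \<longlonglongrightarrow> (\<Sum>n. f n)"
proof -
  define S where "S = (\<lambda>N::nat. {n::nat. n > 0 \<and> prime_factors n \<subseteq> {p. prime p \<and> p \<le> N}})"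
  have abs: "f abs_summable_on UNIV"
    using summ by (simp add: norm_summable_imp_summable_on)
  have fon: "f summable_on X" for X
    using abs abs_summable_summable summable_on_subset_banach by blast
  have absX: "(\<lambda>n. norm (f n)) summable_on X" for X
    using abs summable_on_subset_banach by blast
  have local: "(\<Sum>\<^sub>\<infinity>j. f (p ^ j)) = (\<Sum>j. f (p ^ j))" if "prime p" for p
  proof -
    have inj: "inj (\<lambda>j. p ^ j)" using prime_gt_1_nat[OF that] by (auto intro!: injI)
    have "(f \<circ> (\<lambda>j. p ^ j)) summable_on UNIV"
      using summable_on_reindex[OF inj, of f] fon by blast
    then have "((\<lambda>j. f (p ^ j)) has_sum (\<Sum>\<^sub>\<infinity>j. f (p ^ j))) UNIV"
      by (simp add: o_def)
    then show ?thesis using has_sum_imp_sums sums_unique by blast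
  qed
  have eq: "(\<Prod>p | prime p \<and> p \<le> N. \<Sum>j. f (p ^ j)) = infsum f (S N)" for N
  proof -
    have "(\<Prod>p | prime p \<and> p \<le> N. \<Sum>j. f (p ^ j)) = (\<Prod>p | prime p \<and> p \<le> N. \<Sum>\<^sub>\<infinity>j. f (p ^ j))"
      by (rule prod.cong) (auto simp only: local mem_Collect_eq)
    also have "\<dots> = infsum f (S N)"
      unfolding S_def by (rule finite_euler_product[OF f1 mult abs]) auto
    finally show ?thesis .
  qed
  have tot: "infsum f UNIV = (\<Sum>n. f n)"
    using norm_summable_imp_has_sum[OF summ] infsumI summ summable_norm_cancel summable_sums by blast
  have bound: "norm (infsum f (S N) - (\<Sum>n. f n)) \<le> (\<Sum>n. norm (f (n + Suc N)))" for N
  proof -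
    have sub: "{1..N} \<subseteq> S N"
      by (auto simp: S_def prime_factors_dvd dest!: dvd_imp_le)
    have "infsum f UNIV = infsum f (S N) + infsum f (- S N)"
      by (subst infsum_Un_disjoint[symmetric]) (auto intro: fon)
    then have "norm (infsum f (S N) - (\<Sum>n. f n)) = norm (infsum f (- S N))"
      using tot by (simp add: norm_minus_commute algebra_simps)
    also have "\<dots> \<le> infsum (\<lambda>n. norm (f n)) (- S N)"
      by (rule norm_infsum_bound[OF absX])
    also have "\<dots> \<le> infsum (\<lambda>n. norm (f n)) {Suc N..}"
    proof (rule infsum_mono_neutral[OF absX absX])
      \<comment> \<open>The only such number is 0, where \<open>f\<close> vanishes.\<close>
      fix x assume "x \<in> - S N - {Suc N..}"
      then have "x \<notin> {1..N}" and "x \<le> N" using sub by (blast, simp)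
      then have "x = 0" by simp
      then show "norm (f x) \<le> 0" by (simp add: f0)
    qed auto
    also have "{Suc N..} = (\<lambda>n. n + Suc N) ` UNIV"
    proof -
      have "x \<in> range (\<lambda>n. n + Suc N)" if "x \<ge> Suc N" for x
        using that by (intro image_eqI[of _ _ "x - Suc N"]) auto
      then show ?thesis by auto
    qed
    also have "infsum (\<lambda>n. norm (f n)) ((\<lambda>n. n + Suc N) ` UNIV) = infsum (\<lambda>n. norm (f (n + Suc N))) UNIV"
      by (subst infsum_reindex) (auto simp: o_def inj_on_def)
    also have "\<dots> = (\<Sum>n. norm (f (n + Suc N)))"
      using summable_ignore_initial_segment[OF summ, of "Suc N"]
      by (intro infsumI norm_summable_imp_has_sum summable_sums) auto
    finally show ?thesis .
  qed
  have "(\<lambda>N. \<Sum>n. norm (f (n + Suc N))) \<longlonglongrightarrow> 0"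
    using suminf_exist_split2[OF summ] by (rule LIMSEQ_Suc)
  then have "(\<lambda>N. infsum f (S N) - (\<Sum>n. f n)) \<longlonglongrightarrow> 0"
    by (rule Lim_null_comparison[rotated]) (use bound in auto)
  then show ?thesis using LIM_zero_iff unfolding eq by blast
qed

lemma euler_product_completely_multiplicative:
  fixes x :: "nat \<Rightarrow> complex"
  assumes x0: "x 0 = 0" and x1: "x 1 = 1" and xm: "\<And>m n. x (m * n) = x m * x n"
    and sx: "summable (\<lambda>n. norm (x n))" and nx: "\<And>p. prime p \<Longrightarrow> norm (x p) < 1"
  shows "(\<lambda>N. \<Prod>p | prime p \<and> p \<le> N. 1 / (1 - x p)) \<longlonglongrightarrow> (\<Sum>n. x n)"
proof -
  have xp: "x (n ^ j) = x n ^ j" for n j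
    using x1 by (induction j) (auto simp: xm)
  have "(\<Sum>j. x (p ^ j)) = 1 / (1 - x p)" if "prime p" for p
    using suminf_geometric[OF nx[OF that]] by (simp only: xp)
  then have "(\<Prod>p | prime p \<and> p \<le> N. \<Sum>j. x (p ^ j)) = (\<Prod>p | prime p \<and> p \<le> N. 1 / (1 - x p))" for N
    by (intro prod.cong) auto
  then show ?thesis using euler_product[OF x0 x1 xm sx] by simp
qed

section \<open>Coefficients of inverse powers of L-functions\<close>

text \<open>The Dirichlet coefficients of \<open>\<zeta>(s)\<close> to the power \<open>-k\<close>.\<close>

definition inv_coeff :: "nat \<Rightarrow> nat \<Rightarrow> real" where
  "inv_coeff k n = (if n = 0 then 0
     else \<Prod>p\<in>prime_factors n. (-1) ^ multiplicity p n * real (k choose multiplicity p n))"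

lemma inv_coeff_0 [simp]: "inv_coeff k 0 = 0"
  by (simp add: inv_coeff_def)

lemma inv_coeff_1 [simp]: "inv_coeff k (Suc 0) = 1"
  by (simp add: inv_coeff_def)

lemma inv_coeff_mult:
  assumes "coprime m n"
  shows "inv_coeff k (m * n) = inv_coeff k m * inv_coeff k n"
proof (cases "m = 0 \<or> n = 0")
  case False
  then have m: "m \<noteq> 0" and n: "n \<noteq> 0" by auto
  define g where "g = (\<lambda>(n::nat) p. (-1) ^ multiplicity p n * real (k choose multiplicity p n))"
  have disj: "prime_factors m \<inter> prime_factors n = {}"
    using assms by (auto simp: in_prime_factors_iff dest: coprime_common_divisor)
  have cong: "g (a * b) p = g a p"
    if "p \<in> prime_factors a" "coprime a b" "a \<noteq> 0" "b \<noteq> 0" for a b p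
  proof -
    have "prime p" "p dvd a" using that(1) by (auto simp: in_prime_factors_iff)
    moreover from this have "\<not> p dvd b" using that(2) by (metis coprime_common_divisor not_prime_unit)
    ultimately have "multiplicity p (a * b) = multiplicity p a"
      using that by (simp add: prime_elem_multiplicity_mult_distrib not_dvd_imp_multiplicity_0)
    then show ?thesis by (simp add: g_def)
  qed
  have "(\<Prod>p\<in>prime_factors (m * n). g (m * n) p)
      = (\<Prod>p\<in>prime_factors m. g (m * n) p) * (\<Prod>p\<in>prime_factors n. g (m * n) p)"
    using m n disj by (simp add: prime_factors_product prod.union_disjoint)
  also have "(\<Prod>p\<in>prime_factors m. g (m * n) p) = (\<Prod>p\<in>prime_factors m. g m p)"
    using cong assms m n by (intro prod.cong) auto
  also have "(\<Prod>p\<in>prime_factors n. g (m * n) p) = (\<Prod>p\<in>prime_factors n. g n p)"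
    using cong[of _ n m] assms m n by (intro prod.cong) (auto simp: coprime_commute mult.commute)
  finally show ?thesis
    using m n by (simp add: inv_coeff_def g_def)
qed auto

lemma inv_coeff_prime_power:
  assumes "prime p"
  shows "inv_coeff k (p ^ j) = (-1) ^ j * real (k choose j)"
proof (cases "j = 0")
  case False
  then have "prime_factors (p ^ j) = {p}"
  proof -
    have "r \<in> prime_factors (p ^ j) \<longleftrightarrow> r = p" for r
    proof
      assume "r \<in> prime_factors (p ^ j)"
      then have "prime r" "r dvd p" by (auto simp: in_prime_factors_iff dest: prime_dvd_power)
      then show "r = p" using assms primes_dvd_imp_eq by blast
    qed (use assms False in \<open>auto simp: in_prime_factors_iff\<close>)
    then show ?thesis by blast
  qed
  moreover have "multiplicity p (p ^ j) = j"
    using assms by (simp add: multiplicity_same_power)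
  ultimately show ?thesis
    using assms by (simp add: inv_coeff_def prime_gt_0_nat)
qed auto

text \<open>All primes above \<open>K powr (1 / \<eta>)\<close> satisfy
  \<open>K \<le> p powr \<eta>\<close>, so only the finitely many numbers in \<open>P\<close> can
  cost a factor \<open>K\<close> each, and the remaining powers multiply to at most
  \<open>n powr \<eta>\<close> because the product of the distinct primes is at most
  \<open>n\<close>. Used with \<open>K = 2 ^ k\<close> for the coefficients and with
  \<open>K = 2\<close> for the totient.\<close>

lemma prod_prime_factors_const_le:
  fixes K \<eta> :: real
  assumes K: "K \<ge> 1" and \<eta>: "\<eta> > 0"
  obtains C where "C > 0" "\<And>n. n > 0 \<Longrightarrow> (\<Prod>p\<in>prime_factors n. K) \<le> C * real n powr \<eta>"
proof
  define P where "P = {p::nat. real p \<le> K powr (1 / \<eta>)}"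
  have "P \<subseteq> {..nat \<lfloor>K powr (1 / \<eta>)\<rfloor>}"
    by (auto simp: P_def le_nat_floor)
  then have fin: "finite P" using finite_subset by blast
  show "K ^ card P > 0" using K by simp
  fix n :: nat assume n: "n > 0"
  have p1: "real p \<ge> 1" if "p \<in> prime_factors n" for p
    using that by (auto simp: in_prime_factors_iff dest: prime_ge_1_nat)
  have "(\<Prod>p\<in>prime_factors n. K) \<le> (\<Prod>p\<in>prime_factors n. (if p \<in> P then K else 1) * real p powr \<eta>)"
  proof (rule prod_mono, intro conjI)
    fix p assume p: "p \<in> prime_factors n"
    have ge1: "real p powr \<eta> \<ge> 1" using p1[OF p] \<eta> by (simp add: ge_one_powr_ge_zero)
    show "K \<le> (if p \<in> P then K else 1) * real p powr \<eta>"
    proof (cases "p \<in> P")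
      case True
      then show ?thesis using mult_left_mono[OF ge1, of K] K by simp
    next
      case False
      then have "K powr (1 / \<eta>) \<le> real p" by (simp add: P_def)
      then have "(K powr (1 / \<eta>)) powr \<eta> \<le> real p powr \<eta>" using \<eta> by (intro powr_mono2) auto
      then show ?thesis using False \<eta> K by (simp add: powr_powr)
    qed
  qed (use K in auto)
  also have "\<dots> = (\<Prod>p\<in>prime_factors n. if p \<in> P then K else 1) * (\<Prod>p\<in>prime_factors n. real p powr \<eta>)"
    by (rule prod.distrib)
  also have "(\<Prod>p\<in>prime_factors n. if p \<in> P then K else 1) = K ^ card (prime_factors n \<inter> P)"
    by (subst prod.inter_restrict[symmetric]) auto
  also have "(\<Prod>p\<in>prime_factors n. real p powr \<eta>) = (\<Prod>p\<in>prime_factors n. real p) powr \<eta>"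
    by (rule prod_powr_distrib[symmetric])
  also have "K ^ card (prime_factors n \<inter> P) * (\<Prod>p\<in>prime_factors n. real p) powr \<eta> \<le> K ^ card P * real n powr \<eta>"
  proof (intro mult_mono powr_mono2 power_increasing)
    show "card (prime_factors n \<inter> P) \<le> card P" using fin by (intro card_mono) auto
    have "(\<Prod>p\<in>prime_factors n. real p) \<le> (\<Prod>p\<in>prime_factors n. real p ^ multiplicity p n)"
    proof (intro prod_mono conjI)
      fix p assume p: "p \<in> prime_factors n"
      then have "multiplicity p n \<ge> 1" by (simp add: prime_factors_multiplicity)
      then show "real p \<le> real p ^ multiplicity p n"
        using power_increasing[of 1 "multiplicity p n" "real p"] p1[OF p] by simp
    qed auto
    also have "\<dots> = real (\<Prod>p\<in>prime_factors n. p ^ multiplicity p n)" by simp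
    also have "\<dots> = real n" using n by (subst prime_factorization_nat[symmetric]) auto
    finally show "(\<Prod>p\<in>prime_factors n. real p) \<le> real n" .
  qed (use K \<eta> in \<open>auto intro: prod_nonneg\<close>)
  finally show "(\<Prod>p\<in>prime_factors n. K) \<le> K ^ card P * real n powr \<eta>" .
qed

text \<open>Each binomial coefficient is at most \<open>2 ^ k\<close> whatever the exponent, so only
  the number of distinct primes matters.\<close>

lemma inv_coeff_bound:
  fixes \<eta> :: real
  assumes "\<eta> > 0"
  obtains C where "C > 0" "\<And>n. \<bar>inv_coeff k n\<bar> \<le> C * real n powr \<eta>"
proof -
  obtain C where C: "C > 0" "\<And>n. n > 0 \<Longrightarrow> (\<Prod>p\<in>prime_factors n. 2 ^ k) \<le> C * real n powr \<eta>"
    using prod_prime_factors_const_le[of "2 ^ k" \<eta>] assms by auto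
  have "\<bar>inv_coeff k n\<bar> \<le> C * real n powr \<eta>" for n
  proof (cases "n = 0")
    case False
    have "\<bar>inv_coeff k n\<bar> = (\<Prod>p\<in>prime_factors n. real (k choose multiplicity p n))"
      using False by (simp add: inv_coeff_def abs_prod abs_mult power_abs)
    also have "\<dots> \<le> (\<Prod>p\<in>prime_factors n. 2 ^ k)"
    proof (intro prod_mono conjI)
      show "real (k choose multiplicity p n) \<le> 2 ^ k" for p
        using of_nat_mono[OF binomial_le_pow2[of k "multiplicity p n"], where 'a = real] by simp
    qed simp
    finally show ?thesis using C(2)[of n] False by auto
  qed auto
  with C(1) show ?thesis using that by blast
qed

section \<open>Elementary properties of Dirichlet characters\<close>

lemma dirichlet_char_1: "dirichlet_char q chi \<Longrightarrow> chi 1 = 1"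
proof -
  assume d: "dirichlet_char q chi"
  then have "chi (1 * 1) = chi 1 * chi 1" "chi 1 \<noteq> 0"
    unfolding dirichlet_char_def by (metis, metis coprime_1_left)
  then show "chi 1 = 1" by (metis mult_cancel_left2 mult_1)
qed

lemma dirichlet_char_mult: "dirichlet_char q chi \<Longrightarrow> chi (m * n) = chi m * chi n"
  by (simp add: dirichlet_char_def)

lemma dirichlet_char_power: "dirichlet_char q chi \<Longrightarrow> chi (n ^ j) = chi n ^ j"
  using dirichlet_char_1[of q chi] by (induction j) (auto simp: dirichlet_char_mult)

lemma dirichlet_char_period: "dirichlet_char q chi \<Longrightarrow> chi (n + j * q) = chi n"
proof (induction j)
  case (Suc j)
  have "chi (n + Suc j * q) = chi ((n + j * q) + q)" by (simp add: algebra_simps)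
  then show ?case using Suc by (simp add: dirichlet_char_def)
qed auto

lemma dirichlet_char_mod: "dirichlet_char q chi \<Longrightarrow> chi (n mod q) = chi n"
  using dirichlet_char_period[of q chi "n mod q" "n div q"] by simp

lemma dirichlet_char_eq_0_iff: "dirichlet_char q chi \<Longrightarrow> chi n = 0 \<longleftrightarrow> \<not> coprime n q"
  by (auto simp: dirichlet_char_def)

lemma dirichlet_char_cong: "dirichlet_char q chi \<Longrightarrow> [m = n] (mod q) \<Longrightarrow> chi m = chi n"
  using dirichlet_char_mod[of q chi] unfolding cong_def by metis

text \<open>By Euler's theorem the value is a root of unity of order dividing
  \<open>totient q\<close>.\<close>

lemma norm_dirichlet_char:
  assumes d: "dirichlet_char q chi" and "coprime n q"
  shows "norm (chi n) = 1"
proof -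
  have q: "q \<ge> 1" using d by (simp add: dirichlet_char_def)
  have "chi n ^ totient q = chi (n ^ totient q)" using d by (simp add: dirichlet_char_power)
  also have "\<dots> = chi 1"
    by (rule dirichlet_char_cong[OF d]) (rule euler_theorem[OF assms(2)])
  finally have "chi n ^ totient q = 1" using dirichlet_char_1[OF d] by simp
  then have "norm (chi n) ^ totient q = 1" by (metis norm_one norm_power)
  then show ?thesis
    using q power_eq_1_iff[of "norm (chi n)" "totient q"] by simp
qed

lemma norm_dirichlet_char_le: "dirichlet_char q chi \<Longrightarrow> norm (chi n) \<le> 1"
  using norm_dirichlet_char[of q chi n] dirichlet_char_eq_0_iff[of q chi n] by (cases "coprime n q") auto

lemma norm_of_nat_powr: "norm (of_nat n powr s :: complex) = (if n = 0 then 0 else real n powr Re s)"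
  by (cases "n = 0") (auto simp: norm_powr_real_powr)

lemma of_nat_mult_powr: "of_nat (m * n) powr s = (of_nat m powr s * of_nat n powr s :: complex)"
  using powr_times_real[of "of_nat m" "of_nat n" s] by (cases "m = 0 \<or> n = 0") auto

lemma summable_dirichlet_terms:
  fixes a :: "nat \<Rightarrow> complex"
  assumes "\<And>n. n > 0 \<Longrightarrow> norm (a n) \<le> C * real n powr \<eta>" "Re s > 1 + \<eta>"
  shows "summable (\<lambda>n. norm (a n / of_nat n powr s))"
proof (rule summable_comparison_test')
  show "summable (\<lambda>n. C * real n powr (\<eta> - Re s))"
    using assms(2) by (intro summable_mult) (simp add: summable_real_powr_iff)
  fix n :: nat
  have "norm (a n) / real n powr Re s \<le> C * real n powr \<eta> / real n powr Re s" if "n > 0"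
    using assms(1)[OF that] by (intro divide_right_mono) auto
  then show "norm (norm (a n / of_nat n powr s)) \<le> C * real n powr (\<eta> - Re s)"
    by (cases "n = 0") (auto simp: norm_divide norm_of_nat_powr powr_diff)
qed

text \<open>Both series have Euler products. The coefficients at powers of \<open>p\<close> are
  signed binomials, so the second local factor is the finite sum \<open>(1 - x p) ^ k\<close>, the
  exact inverse of the k-th power of the first. Every partial product is therefore 1, and so is the
  limit. At \<open>k = 1\<close> this also shows that the first series does not vanish for
  \<open>Re s > 1\<close>.\<close>

lemma dirichlet_series_power_inverse:
  assumes d: "dirichlet_char q chi" and s: "Re s > 1"
  shows "(\<Sum>n. chi n / of_nat n powr s) ^ k * (\<Sum>n. of_real (inv_coeff k n) * chi n / of_nat n powr s) = 1"
proof -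
  \<comment> \<open>Half of the available room goes to the growth of the coefficients.\<close>
  define \<eta> where "\<eta> = (Re s - 1) / 2"
  have \<eta>: "\<eta> > 0" "Re s > 1 + \<eta>" using s by (auto simp: \<eta>_def field_simps)
  obtain C where C: "C > 0" "\<And>n. \<bar>inv_coeff k n\<bar> \<le> C * real n powr \<eta>"
    using inv_coeff_bound[OF \<eta>(1)] by blast
  define x where "x = (\<lambda>n. chi n / of_nat n powr s)"
  have sx: "summable (\<lambda>n. norm (x n))"
    unfolding x_def by (rule summable_dirichlet_terms[of _ 1 0]) (use norm_dirichlet_char_le[OF d] s in auto)
  define y where "y = (\<lambda>n. of_real (inv_coeff k n) * chi n / of_nat n powr s)"
  have bnd: "norm (of_real (inv_coeff k n) * chi n) \<le> C * real n powr \<eta>" for n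
    using mult_mono[OF C(2)[of n] norm_dirichlet_char_le[OF d, of n]] C(1) by (simp add: norm_mult)
  have sy: "summable (\<lambda>n. norm (y n))"
    unfolding y_def by (rule summable_dirichlet_terms[OF bnd \<eta>(2)])
  have x1: "x 1 = 1" and x0: "x 0 = 0" using dirichlet_char_1[OF d] by (auto simp: x_def)
  have xm: "x (m * n) = x m * x n" for m n
    using dirichlet_char_mult[OF d] by (simp add: x_def of_nat_mult_powr del: of_nat_mult)
  have xp: "x (n ^ j) = x n ^ j" for n j
    using x1 by (induction j) (auto simp: xm)
  have yx: "y n = of_real (inv_coeff k n) * x n" for n by (simp add: x_def y_def)
  have nx: "norm (x p) < 1" if "prime p" for p
  proof -
    have "norm (x p) \<le> 1 / real p powr Re s"
      using norm_dirichlet_char_le[OF d, of p] by (simp add: x_def norm_divide norm_of_nat_powr divide_right_mono)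
    also have "real p powr Re s > 1"
      using prime_gt_1_nat[OF that] s by (intro gr_one_powr) auto
    then have "1 / real p powr Re s < 1" by (subst divide_less_eq_1_pos) linarith+
    finally show ?thesis .
  qed
  have Ly: "(\<Sum>j. y (p ^ j)) = (1 - x p) ^ k" if "prime p" for p
  proof -
    have "y (p ^ j) = of_nat (k choose j) * (- x p) ^ j" for j
      unfolding yx xp inv_coeff_prime_power[OF that] by (simp add: power_minus[of "x p" j])
    then have "(\<lambda>j. y (p ^ j)) = (\<lambda>j. of_nat (k choose j) * (- x p) ^ j)" by blast
    moreover have "(\<lambda>j. of_nat (k choose j) * (- x p) ^ j) sums (\<Sum>j\<le>k. of_nat (k choose j) * (- x p) ^ j)"
      by (rule sums_finite) auto
    moreover have "(\<Sum>j\<le>k. of_nat (k choose j) * (- x p) ^ j) = (1 - x p) ^ k"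
      using binomial_ring[of "- x p" 1 k] by simp
    ultimately show ?thesis by (simp add: sums_iff)
  qed
  have lim1: "(\<lambda>N. \<Prod>p | prime p \<and> p \<le> N. 1 / (1 - x p)) \<longlonglongrightarrow> (\<Sum>n. x n)"
    by (rule euler_product_completely_multiplicative[OF x0 x1 xm sx nx])
  have lim2: "(\<lambda>N. \<Prod>p | prime p \<and> p \<le> N. \<Sum>j. y (p ^ j)) \<longlonglongrightarrow> (\<Sum>n. y n)"
    by (rule euler_product[OF _ _ _ sy]) (use x1 in \<open>auto simp: yx xm inv_coeff_mult\<close>)
  have "(\<lambda>N. (\<Prod>p | prime p \<and> p \<le> N. 1 / (1 - x p)) ^ k * (\<Prod>p | prime p \<and> p \<le> N. \<Sum>j. y (p ^ j)))
      \<longlonglongrightarrow> (\<Sum>n. x n) ^ k * (\<Sum>n. y n)"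
    by (intro tendsto_intros lim1 lim2)
  moreover have "(\<Prod>p | prime p \<and> p \<le> N. 1 / (1 - x p)) ^ k * (\<Prod>p | prime p \<and> p \<le> N. \<Sum>j. y (p ^ j)) = 1" for N
  proof -
    have "(1 / (1 - x p)) ^ k * (\<Sum>j. y (p ^ j)) = 1" if "prime p" for p
      using nx[OF that] by (auto simp: Ly[OF that] power_divide)
    then show ?thesis
      unfolding prod_power_distrib prod.distrib[symmetric] by (intro prod.neutral) auto
  qed
  ultimately show ?thesis
    using LIMSEQ_unique[OF _ tendsto_const] by (simp add: x_def y_def)
qed

section \<open>Orthogonality of Dirichlet characters\<close>

lemma (in group) inv_mem_finite_submonoid:
  assumes fin: "finite (carrier G)" and H: "H \<subseteq> carrier G" "\<one> \<in> H"
    "\<And>x y. x \<in> H \<Longrightarrow> y \<in> H \<Longrightarrow> x \<otimes> y \<in> H" and h: "h \<in> H"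
  shows "inv h \<in> H"
proof -
  have pow: "h [^] n \<in> H" for n :: nat
    using H h by (induction n) auto
  have hc: "h \<in> carrier G" using H h by auto
  have "order G > 0" using fin order_gt_0_iff_finite by blast
  then obtain m where m: "order G = Suc m" using gr0_implies_Suc by blast
  have "h [^] m \<otimes> h = h [^] Suc m" by simp
  also have "\<dots> = \<one>" using pow_order_eq_1[OF hc] m by simp
  finally have "inv h = h [^] m"
    using hc by (intro inv_equality) auto
  then show ?thesis using pow by simp
qed

text \<open>A character of \<open>H\<close> as a total function whose values off \<open>H\<close>
  are arbitrary. Containing the unit and closed under products, \<open>H\<close> is a subgroup once
  the group is finite, since inverses are then powers; this is why inverses are absent from the
  conditions.\<close>

definition (in group) partial_character :: "'a set \<Rightarrow> ('a \<Rightarrow> complex) \<Rightarrow> bool" where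
  "partial_character H f \<longleftrightarrow> H \<subseteq> carrier G \<and> \<one> \<in> H \<and>
     (\<forall>x\<in>H. \<forall>y\<in>H. x \<otimes> y \<in> H \<and> f (x \<otimes> y) = f x * f y) \<and> (\<forall>x\<in>H. f x \<noteq> 0)"

text \<open>With \<open>e\<close> the least positive exponent bringing \<open>x\<close> into
  \<open>H\<close>, every relation between \<open>x\<close> and \<open>H\<close> is a consequence of
  the one for \<open>x [^] e\<close>. So any \<open>e\<close>-th root \<open>w\<close> of the
  prescribed value defines an extension \<open>h \<otimes> x [^] i \<mapsto> f h * w ^ i\<close>.
  The freedom in choosing \<open>w\<close> is what later separates points.\<close>

lemma (in comm_group) partial_character_adjoin:
  assumes fin: "finite (carrier G)" and ch: "partial_character H f"
    and x: "x \<in> carrier G" and e: "e > 0" "x [^] e \<in> H" "\<forall>d. 0 < d \<and> d < e \<longrightarrow> x [^] (d::nat) \<notin> H"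
    and w: "w ^ e = f (x [^] e)"
  shows "\<exists>K g. partial_character K g \<and> H \<subseteq> K \<and> x \<in> K \<and> (\<forall>y\<in>H. g y = f y) \<and> g x = w"
proof -
  have H: "H \<subseteq> carrier G" "\<one> \<in> H" "\<And>x y. x \<in> H \<Longrightarrow> y \<in> H \<Longrightarrow> x \<otimes> y \<in> H"
    and f: "\<And>x y. x \<in> H \<Longrightarrow> y \<in> H \<Longrightarrow> f (x \<otimes> y) = f x * f y" "\<And>x. x \<in> H \<Longrightarrow> f x \<noteq> 0"
    using ch unfolding partial_character_def by blast+
  have HG: "h \<in> carrier G" if "h \<in> H" for h using H that by auto
  have invH: "inv h \<in> H" if "h \<in> H" for h
    using inv_mem_finite_submonoid[OF fin H that] by simp
  have f1: "f \<one> = 1" using f(1)[OF H(2) H(2)] f(2)[OF H(2)] H(2) by simp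
  have w0: "w \<noteq> 0" using w e f(2) by (metis power_eq_0_iff)
  have powH: "h [^] n \<in> H \<and> f (h [^] n) = f h ^ n" if "h \<in> H" for h and n :: nat
    using that by (induction n) (auto simp: H f f1)
  \<comment> \<open>The remainder of \<open>n\<close> modulo \<open>e\<close> is again an exponent
    leading into \<open>H\<close>, so it is 0 by minimality.\<close>
  have dvd: "e dvd n" if n: "x [^] n \<in> H" for n :: nat
  proof -
    have "x [^] (n mod e) = inv ((x [^] e) [^] (n div e)) \<otimes> x [^] n"
    proof -
      have "x [^] n = (x [^] e) [^] (n div e) \<otimes> x [^] (n mod e)"
        using x by (simp add: nat_pow_pow nat_pow_mult)
      then show ?thesis using x by (simp add: m_assoc[symmetric])
    qed
    then have "x [^] (n mod e) \<in> H"
      using H n invH powH[OF e(2)] by simp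
    then have "n mod e = 0" using e by (metis gr0I mod_less_divisor)
    then show ?thesis by auto
  qed
  have wd: "f h * w ^ i = f h' * w ^ j"
    if "h \<in> H" "h' \<in> H" "h \<otimes> x [^] i = h' \<otimes> x [^] j" "j \<le> i" for h h' and i j :: nat
  proof -
    have "(h \<otimes> x [^] (i - j)) \<otimes> x [^] j = h' \<otimes> x [^] j"
      using that HG x by (simp add: m_assoc nat_pow_mult)
    then have h': "h' = h \<otimes> x [^] (i - j)"
      using that HG x by (metis m_closed nat_pow_closed right_cancel)
    then have "x [^] (i - j) = inv h \<otimes> h'"
      using that HG x by (simp add: m_assoc[symmetric])
    then have "x [^] (i - j) \<in> H" using H that invH by simp
    then obtain t where t: "i - j = e * t" using dvd by blast
    have "h' = h \<otimes> (x [^] e) [^] t" using h' t x by (simp add: nat_pow_pow)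
    then have "f h' = f h * f (x [^] e) ^ t" using f that powH[OF e(2)] by simp
    then have "f h' = f h * w ^ (i - j)" by (simp add: w[symmetric] t power_mult)
    then show ?thesis using that(4) by (simp add: power_add[symmetric] mult.assoc)
  qed
  define K where "K = {h \<otimes> x [^] i | h i. h \<in> H \<and> (i::nat) \<in> UNIV}"
  \<comment> \<open>An element of \<open>K\<close> may have many representations; \<open>wd\<close>
    says that all of them give the same value.\<close>
  define g where "g = (\<lambda>y. THE v. \<exists>h i. h \<in> H \<and> y = h \<otimes> x [^] (i::nat) \<and> v = f h * w ^ i)"
  have g: "g (h \<otimes> x [^] i) = f h * w ^ i" if h: "h \<in> H" for h and i :: nat
    unfolding g_def
  proof (rule the_equality)
    show "\<exists>h' j. h' \<in> H \<and> h \<otimes> x [^] i = h' \<otimes> x [^] (j::nat) \<and> f h * w ^ i = f h' * w ^ j"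
      using h by blast
    fix v assume "\<exists>h' j. h' \<in> H \<and> h \<otimes> x [^] i = h' \<otimes> x [^] (j::nat) \<and> v = f h' * w ^ j"
    then show "v = f h * w ^ i" using wd h by (metis linear)
  qed
  have mult: "(h \<otimes> x [^] i) \<otimes> (h' \<otimes> x [^] j) = (h \<otimes> h') \<otimes> x [^] (i + j)"
    if "h \<in> H" "h' \<in> H" for h h' and i j :: nat
  proof -
    have "h \<in> carrier G" "h' \<in> carrier G" using that HG by auto
    then show ?thesis using x by (simp add: nat_pow_mult[symmetric] m_ac)
  qed
  have KG: "K \<subseteq> carrier G" using HG x by (auto simp: K_def)
  have HK: "H \<subseteq> K"
  proof
    fix h assume "h \<in> H"
    then show "h \<in> K" using HG unfolding K_def by (intro CollectI exI[of _ h] exI[of _ "0::nat"]) auto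
  qed
  have xK: "x \<in> K" using x H(2) unfolding K_def by (intro CollectI exI[of _ \<one>] exI[of _ "1::nat"]) auto
  have mK: "y \<otimes> z \<in> K \<and> g (y \<otimes> z) = g y * g z" if yz: "y \<in> K" "z \<in> K" for y z
  proof -
    obtain h i where h: "h \<in> H" "y = h \<otimes> x [^] (i::nat)"
      using yz(1) unfolding K_def by blast
    obtain h' j where h': "h' \<in> H" "z = h' \<otimes> x [^] (j::nat)"
      using yz(2) unfolding K_def by blast
    have hh: "h \<otimes> h' \<in> H" using H(3) h(1) h'(1) by blast
    show ?thesis
    proof
      show "y \<otimes> z \<in> K" unfolding h(2) h'(2) mult[OF h(1) h'(1)] K_def using hh by blast
      show "g (y \<otimes> z) = g y * g z"
        unfolding h(2) h'(2) mult[OF h(1) h'(1)] g[OF hh] g[OF h(1)] g[OF h'(1)] f(1)[OF h(1) h'(1)]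
        by (simp add: power_add)
    qed
  qed
  have gK: "g y \<noteq> 0" if yK: "y \<in> K" for y
  proof -
    obtain h i where h: "h \<in> H" "y = h \<otimes> x [^] (i::nat)" using yK unfolding K_def by blast
    show ?thesis unfolding h(2) g[OF h(1)] using f(2)[OF h(1)] w0 by simp
  qed
  have gH: "g y = f y" if "y \<in> H" for y
    using g[OF that, of 0] HG[OF that] by simp
  have gx: "g x = w"
    using g[OF H(2), of 1] x f1 by simp
  have "partial_character K g"
    unfolding partial_character_def using KG HK H(2) mK gK by blast
  then show ?thesis using HK xK gH gx by blast
qed

lemma (in comm_group) pow_mem_least:
  assumes fin: "finite (carrier G)" and H: "\<one> \<in> H" and x: "x \<in> carrier G"
  obtains e :: nat where "e > 0" "x [^] e \<in> H" "\<forall>d. 0 < d \<and> d < e \<longrightarrow> x [^] d \<notin> H"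
proof -
  define P where "P = (\<lambda>e::nat. e > 0 \<and> x [^] e \<in> H)"
  have "P (order G)"
    using fin x H pow_order_eq_1 order_gt_0_iff_finite by (auto simp: P_def)
  define e where "e = (LEAST e. P e)"
  have Pe: "P e" unfolding e_def using \<open>P (order G)\<close> by (rule LeastI)
  have nP: "\<not> P d" if "d < e" for d using that unfolding e_def by (rule not_less_Least)
  show ?thesis by (rule that[of e]) (use Pe nP in \<open>auto simp: P_def\<close>)
qed

text \<open>Adjoining one element strictly enlarges \<open>H\<close>, so the gap in cardinality
  decreases; the required root exists since nonzero complex numbers have roots of every
  order.\<close>

lemma (in comm_group) partial_character_extend:
  assumes fin: "finite (carrier G)" and "partial_character H f"
  shows "\<exists>g. partial_character (carrier G) g \<and> (\<forall>x\<in>H. g x = f x)"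
  using assms(2)
proof (induction "card (carrier G) - card H" arbitrary: H f rule: less_induct)
  case less
  have H: "H \<subseteq> carrier G" "\<one> \<in> H" using less.prems unfolding partial_character_def by blast+
  show ?case
  proof (cases "H = carrier G")
    case True
    show ?thesis by (rule exI[of _ f]) (use less.prems in \<open>simp add: True\<close>)
  next
    case False
    then obtain x where x: "x \<in> carrier G" "x \<notin> H" using H(1) by blast
    obtain e :: nat where e: "e > 0" "x [^] e \<in> H" "\<forall>d. 0 < d \<and> d < e \<longrightarrow> x [^] d \<notin> H"
      using pow_mem_least[OF fin H(2) x(1)] by blast
    have fx: "f (x [^] e) \<noteq> 0" using less.prems e(2) unfolding partial_character_def by blast
    define w where "w = exp (Ln (f (x [^] e)) / of_nat e)"
    have w: "w ^ e = f (x [^] e)"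
      using e(1) fx by (simp add: w_def exp_of_nat_mult[symmetric])
    obtain K g where K: "partial_character K g" "H \<subseteq> K" "x \<in> K" "\<forall>y\<in>H. g y = f y"
      using partial_character_adjoin[OF fin less.prems x(1) e w] by blast
    have KG: "K \<subseteq> carrier G" using K(1) unfolding partial_character_def by blast
    then have finK: "finite K" using fin finite_subset by blast
    have "H \<subset> K" using K x by blast
    then have "card H < card K" using finK psubset_card_mono by blast
    moreover have "card K \<le> card (carrier G)" using KG fin card_mono by blast
    ultimately have "card (carrier G) - card K < card (carrier G) - card H" by linarith
    from less.hyps[OF this K(1)] obtain g' where
      "partial_character (carrier G) g'" "\<forall>x\<in>K. g' x = g x" by blast
    then show ?thesis using K(2,4) by (intro exI[of _ g']) auto
  qed
qed

text \<open>Over the trivial subgroup the least exponent for \<open>a\<close> is its order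
  \<open>e\<close>, so \<open>a\<close> may be sent to a primitive \<open>e\<close>-th root of
  unity; the extension to the whole group keeps that value.\<close>

lemma (in comm_group) character_separates:
  assumes fin: "finite (carrier G)" and a: "a \<in> carrier G" "a \<noteq> \<one>"
  shows "\<exists>g. partial_character (carrier G) g \<and> g a \<noteq> 1"
proof -
  have "\<one> \<in> {\<one>}" by simp
  from pow_mem_least[OF fin this a(1)]
  obtain e :: nat where e: "e > 0" "a [^] e \<in> {\<one>}" "\<forall>d. 0 < d \<and> d < e \<longrightarrow> a [^] d \<notin> {\<one>}"
    by blast
  have "e \<noteq> 1" using e(2) a by auto
  then have e1: "e > 1" using e(1) by simp
  define w where "w = cis (2 * pi / real e)"
  have "w ^ e = cis (real e * (2 * pi / real e))" unfolding w_def by (rule Complex.DeMoivre)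
  also have "real e * (2 * pi / real e) = 2 * pi" using e(1) by simp
  finally have w: "w ^ e = 1" by simp
  have "w \<noteq> 1"
  proof
    assume "w = 1"
    then have "cos (2 * pi / real e) = 1" by (simp add: w_def complex_eq_iff)
    then obtain n :: int where "2 * pi / real e = of_int n * 2 * pi" using cos_one_2pi_int by blast
    then have "(2 * pi) * (1 / real e) = (2 * pi) * of_int n" by (simp add: mult.commute)
    then have n: "1 / real e = of_int n" by (subst (asm) mult_left_cancel) auto
    have "0 < 1 / real e" "1 / real e < 1" using e1 by auto
    then have "0 < n" "n < 1" unfolding n by simp_all
    then show False by simp
  qed
  have "partial_character {\<one>} (\<lambda>_. 1)" by (simp add: partial_character_def)
  from partial_character_adjoin[OF fin this a(1) e, of w] w
  obtain K g where K: "partial_character K g" "a \<in> K" "g a = w" by auto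
  from partial_character_extend[OF fin K(1)] obtain g' where
    "partial_character (carrier G) g'" "\<forall>x\<in>K. g' x = g x" by blast
  then show ?thesis using K(2,3) \<open>w \<noteq> 1\<close> by auto
qed

text \<open>Characters of the unit group modulo \<open>q\<close> are lifted to the naturals by
  reduction, with the value 0 off the units.\<close>

lemma dirichlet_char_separates:
  assumes q: "q \<ge> 2" and a: "coprime a q" "\<not> [a = 1] (mod q)"
  obtains chi where "dirichlet_char q chi" "chi a \<noteq> 1"
proof -
  interpret residues "int q" "residue_ring (int q)" by unfold_locales (use q in auto)
  define G where "G = units_of (residue_ring (int q))"
  interpret U: comm_group G unfolding G_def by (rule units_comm_group)
  have carr: "carrier G = {x. 0 < x \<and> x < int q \<and> coprime x (int q)}"
    unfolding G_def units_of_carrier res_units_eq by auto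
  have mult: "x \<otimes>\<^bsub>G\<^esub> y = x * y mod int q" for x y
    unfolding G_def units_of_mult by (simp add: res_mult_eq)
  have one: "\<one>\<^bsub>G\<^esub> = 1"
    unfolding G_def units_of_one by (simp add: res_one_eq q)
  have fin: "finite (carrier G)" unfolding carr by (rule finite_subset[of _ "{0..int q}"]) auto
  define r where "r = (\<lambda>n::nat. int (n mod q))"
  have r: "r n \<in> carrier G" if "coprime n q" for n
  proof -
    have "coprime (n mod q) q" using that q by (subst coprime_mod_left_iff) auto
    moreover from this have "n mod q \<noteq> 0" using q by (metis coprime_0_left_iff nat_dvd_1_iff_1 numeral_le_one_iff semiring_norm(69))
    ultimately show ?thesis using q unfolding carr r_def by auto
  qed
  have rm: "r (m * n) = r m \<otimes>\<^bsub>G\<^esub> r n" for m n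
    unfolding mult r_def by (simp add: zmod_int mod_mult_eq)
  have ra: "r a \<noteq> \<one>\<^bsub>G\<^esub>"
    using a(2) q unfolding one r_def cong_def by (auto simp: mod_less)
  obtain g where "U.partial_character (carrier G) g" and g3: "g (r a) \<noteq> 1"
    using U.character_separates[OF fin r[OF a(1)] ra] by blast
  then have g: "\<forall>x\<in>carrier G. \<forall>y\<in>carrier G. g (x \<otimes>\<^bsub>G\<^esub> y) = g x * g y" "\<forall>x\<in>carrier G. g x \<noteq> 0"
    unfolding U.partial_character_def by blast+
  define chi where "chi = (\<lambda>n. if coprime n q then g (r n) else 0)"
  have "dirichlet_char q chi"
    unfolding dirichlet_char_def
  proof (intro conjI allI)
    show "chi (n + q) = chi n" for n
    proof -
      have "coprime (n + q) q \<longleftrightarrow> coprime n q" by (metis coprime_mod_left_iff mod_add_self2 q not_numeral_le_zero)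
      then show ?thesis by (simp add: chi_def r_def)
    qed
    show "chi (m * n) = chi m * chi n" for m n
      using g(1) r by (auto simp: chi_def rm)
    show "chi n \<noteq> 0 \<longleftrightarrow> coprime n q" for n
      using g(2) r by (auto simp: chi_def)
  qed (use q in auto)
  then show ?thesis using that g3 a(1) by (auto simp: chi_def)
qed

lemma principal_char_is_char:
  assumes "q \<ge> 1"
  shows "dirichlet_char q (principal_char q)"
proof -
  have "coprime (n + q) q \<longleftrightarrow> coprime n q" for n
    unfolding coprime_iff_gcd_eq_1 gcd_add1 ..
  then show ?thesis
    using assms by (simp add: dirichlet_char_def principal_char_def)
qed

lemma dirichlet_char_times:
  "dirichlet_char q chi \<Longrightarrow> dirichlet_char q psi \<Longrightarrow> dirichlet_char q (\<lambda>n. chi n * psi n)"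
  unfolding dirichlet_char_def by auto

lemma dirichlet_char_cnj: "dirichlet_char q chi \<Longrightarrow> dirichlet_char q (\<lambda>n. cnj (chi n))"
  unfolding dirichlet_char_def by auto

text \<open>A character is determined by its values below \<open>q\<close>, each 0 or a root of
  unity of order dividing \<open>totient q\<close>. Finiteness is what gives the later sums over
  characters a meaning.\<close>

lemma finite_dirichlet_chars: "finite {chi. dirichlet_char q chi}"
proof (cases "q \<ge> 1")
  case True
  define Z where "Z = insert 0 {z::complex. z ^ totient q = 1}"
  have "totient q \<ge> 1" using True by (simp add: Suc_le_eq)
  then have "finite Z" by (auto simp: Z_def intro!: finite_roots_unity)
  then have fin: "finite (PiE {..<q} (\<lambda>_. Z))" by (intro finite_PiE) auto
  have sub: "(\<lambda>chi. restrict chi {..<q}) ` {chi. dirichlet_char q chi} \<subseteq> PiE {..<q} (\<lambda>_. Z)"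
  proof clarify
    fix chi assume d: "dirichlet_char q chi"
    have "chi n \<in> Z" for n
    proof (cases "coprime n q")
      case True
      have "chi n ^ totient q = chi (n ^ totient q)" using d by (simp add: dirichlet_char_power)
      also have "\<dots> = chi 1" by (rule dirichlet_char_cong[OF d]) (rule euler_theorem[OF True])
      finally show ?thesis using dirichlet_char_1[OF d] by (simp add: Z_def)
    qed (use dirichlet_char_eq_0_iff[OF d] in \<open>auto simp: Z_def\<close>)
    then show "restrict chi {..<q} \<in> PiE {..<q} (\<lambda>_. Z)" by auto
  qed
  have inj: "inj_on (\<lambda>chi. restrict chi {..<q}) {chi. dirichlet_char q chi}"
  proof (rule inj_onI, clarify)
    fix chi psi assume d: "dirichlet_char q chi" "dirichlet_char q psi" and eq: "restrict chi {..<q} = restrict psi {..<q}"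
    have "chi (n mod q) = psi (n mod q)" for n
      using fun_cong[OF eq, of "n mod q"] True by simp
    then show "chi = psi" using d by (intro ext) (simp add: dirichlet_char_mod)
  qed
  show ?thesis using finite_imageD[OF finite_subset[OF sub fin] inj] .
qed (auto simp: dirichlet_char_def)

lemma coprime_inverse_exists:
  assumes "coprime b (q::nat)"
  obtains b' where "coprime b' q" "[b * b' = 1] (mod q)"
proof -
  obtain b' where b': "[b * b' = 1] (mod q)" using cong_solve_coprime_nat[OF assms] by auto
  then have "coprime (b * b') q" by (metis cong_imp_coprime coprime_1_left cong_sym)
  then show ?thesis using that b' by auto
qed

text \<open>Multiplication by a unit \<open>b\<close> with \<open>chi b \<noteq> 1\<close> permutes
  the residues, so the sum equals \<open>chi b\<close> times itself. Such a \<open>b\<close> exists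
  because a nonprincipal character differs from 1 at some unit.\<close>

lemma sum_dirichlet_char_period:
  assumes d: "dirichlet_char q chi" and "chi \<noteq> principal_char q"
  shows "(\<Sum>n<q. chi n) = 0"
proof -
  have q: "q \<ge> 1" using d by (simp add: dirichlet_char_def)
  obtain b where b: "chi b \<noteq> principal_char q b" using assms(2) by blast
  then have cb: "coprime b q" and nb: "chi b \<noteq> 1"
    using dirichlet_char_eq_0_iff[OF d, of b] by (auto simp: principal_char_def split: if_splits)
  have "bij_betw (\<lambda>n. b * n mod q) {..<q} {..<q}"
  proof (rule bij_betwI')
    fix x y assume "x \<in> {..<q}" "y \<in> {..<q}"
    then show "(b * x mod q = b * y mod q) = (x = y)"
      using cong_mult_lcancel_nat[OF cb, of x y] by (auto simp: cong_def)
  next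
    fix y assume y: "y \<in> {..<q}"
    obtain b' where b': "[b * b' = 1] (mod q)" using coprime_inverse_exists[OF cb] by blast
    have "[b * (b' * y mod q) = (b * b') * y] (mod q)" by (simp add: cong_def mod_mult_right_eq mult.assoc)
    also have "[(b * b') * y = 1 * y] (mod q)" by (rule cong_scalar_right[OF b'])
    finally have "b * (b' * y mod q) mod q = y" using y by (simp add: cong_def)
    then show "\<exists>x\<in>{..<q}. y = b * x mod q" using q by (intro bexI[of _ "b' * y mod q"]) auto
  qed (use q in auto)
  then have "(\<Sum>n<q. chi n) = (\<Sum>n<q. chi (b * n mod q))"
    by (rule sum.reindex_bij_betw[symmetric])
  also have "\<dots> = chi b * (\<Sum>n<q. chi n)"
    by (simp add: dirichlet_char_mod[OF d] dirichlet_char_mult[OF d] sum_distrib_left)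
  finally show ?thesis using nb by simp
qed

text \<open>The dual argument: multiplication by a character \<open>psi\<close> with
  \<open>psi a \<noteq> 1\<close> permutes the characters, its inverse being multiplication by the
  conjugate.\<close>

lemma sum_dirichlet_chars_ne:
  assumes q: "q \<ge> 2" and a: "coprime a q" "\<not> [a = 1] (mod q)"
  shows "(\<Sum>chi | dirichlet_char q chi. chi a) = 0"
proof -
  obtain psi where psi: "dirichlet_char q psi" "psi a \<noteq> 1"
    using dirichlet_char_separates[OF assms] by blast
  have inv: "(\<lambda>n. cnj (psi n) * (psi n * chi n)) = chi" if d: "dirichlet_char q chi" for chi
  proof
    fix n
    show "cnj (psi n) * (psi n * chi n) = chi n"
    proof (cases "coprime n q")
      case True
      have "cnj (psi n) * psi n = 1"
        using norm_dirichlet_char[OF psi(1) True] by (metis complex_norm_square mult.commute of_real_1 power_one)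
      then show ?thesis by (simp add: mult.assoc[symmetric])
    qed (use dirichlet_char_eq_0_iff[OF d] in auto)
  qed
  have "(\<Sum>chi | dirichlet_char q chi. chi a) = (\<Sum>chi | dirichlet_char q chi. psi a * chi a)"
  proof (rule sum.reindex_bij_witness[of _ "\<lambda>chi n. psi n * chi n" "\<lambda>chi n. cnj (psi n) * chi n"])
    fix chi assume "chi \<in> {chi. dirichlet_char q chi}"
    then have d: "dirichlet_char q chi" by simp
    show "(\<lambda>n. psi n * (cnj (psi n) * chi n)) = chi"
      using inv[OF d] by (simp add: mult.left_commute)
    show "(\<lambda>n. cnj (psi n) * (psi n * chi n)) = chi" by (rule inv[OF d])
    show "psi a * (cnj (psi a) * chi a) = chi a"
      using fun_cong[OF inv[OF d], of a] by (simp add: mult.left_commute)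
  qed (use psi in \<open>auto intro: dirichlet_char_times dirichlet_char_cnj\<close>)
  also have "\<dots> = psi a * (\<Sum>chi | dirichlet_char q chi. chi a)" by (simp add: sum_distrib_left)
  finally show ?thesis using psi(2) by simp
qed

lemma sum_principal_char: "q \<ge> 2 \<Longrightarrow> (\<Sum>n\<in>totatives q. principal_char q n) = of_nat (totient q)"
  by (simp add: principal_char_def totatives_def totient_def)

lemma sum_dirichlet_char_totatives:
  assumes q: "q \<ge> 2" and d: "dirichlet_char q chi"
  shows "(\<Sum>n\<in>totatives q. chi n * c n) = (\<Sum>n<q. chi n * (c n :: complex))"
proof (rule sum.mono_neutral_left)
  show "totatives q \<subseteq> {..<q}" using q totatives_less by auto
  show "\<forall>i\<in>{..<q} - totatives q. chi i * c i = 0"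
  proof
    fix n assume n: "n \<in> {..<q} - totatives q"
    have "\<not> coprime n q"
      using n q by (cases "n = 0") (auto simp: in_totatives_iff)
    then show "chi n * c n = 0" using dirichlet_char_eq_0_iff[OF d] by simp
  qed
qed auto

text \<open>Double counting over residues and characters: summed over the characters, only the
  residue \<open>a = 1\<close> contributes; summed over the residues, only the principal character
  does.\<close>

lemma card_dirichlet_chars:
  assumes q: "q \<ge> 2"
  shows "card {chi. dirichlet_char q chi} = totient q"
proof -
  have "(\<Sum>a\<in>totatives q. \<Sum>chi | dirichlet_char q chi. chi a) = (\<Sum>a\<in>totatives q. if a = 1 then of_nat (card {chi. dirichlet_char q chi}) else 0)"
  proof (rule sum.cong)
    fix a assume a: "a \<in> totatives q"
    show "(\<Sum>chi | dirichlet_char q chi. chi a) = (if a = 1 then of_nat (card {chi. dirichlet_char q chi}) else 0)"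
    proof (cases "a = 1")
      case True
      have "(\<Sum>chi | dirichlet_char q chi. chi a) = (\<Sum>chi | dirichlet_char q chi. 1)"
        by (rule sum.cong) (use True dirichlet_char_1 in auto)
      then show ?thesis using True by simp
    next
      case False
      have "\<not> [a = 1] (mod q)" using False a q totatives_less[OF a] by (auto simp: cong_def)
      then show ?thesis using sum_dirichlet_chars_ne[OF q] a False by (simp add: in_totatives_iff)
    qed
  qed simp
  also have "\<dots> = of_nat (card {chi. dirichlet_char q chi})"
    using q by (simp add: in_totatives_iff)
  finally have "of_nat (card {chi. dirichlet_char q chi}) = (\<Sum>a\<in>totatives q. \<Sum>chi | dirichlet_char q chi. chi a)" by simp
  also have "\<dots> = (\<Sum>chi | dirichlet_char q chi. \<Sum>a\<in>totatives q. chi a)" by (rule sum.swap)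
  also have "\<dots> = (\<Sum>chi | dirichlet_char q chi. if chi = principal_char q then of_nat (totient q) else 0)"
  proof (rule sum.cong)
    fix chi assume "chi \<in> {chi. dirichlet_char q chi}"
    then have d: "dirichlet_char q chi" by simp
    show "(\<Sum>a\<in>totatives q. chi a) = (if chi = principal_char q then of_nat (totient q) else 0)"
      using sum_dirichlet_char_totatives[OF q d, of "\<lambda>_. 1"] sum_dirichlet_char_period[OF d] sum_principal_char[OF q] by auto
  qed simp
  also have "\<dots> = of_nat (totient q)"
    using finite_dirichlet_chars[of q] principal_char_is_char[of q] q by simp
  finally show ?thesis by simp
qed

lemma dirichlet_char_orthogonality:
  assumes q: "q \<ge> 2" and a: "coprime a q" "coprime b q"
  shows "(\<Sum>chi | dirichlet_char q chi. chi a * cnj (chi b)) = (if [a = b] (mod q) then of_nat (totient q) else 0)"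
proof -
  obtain b' where b': "coprime b' q" "[b * b' = 1] (mod q)" using coprime_inverse_exists[OF a(2)] by blast
  have eq: "chi a * cnj (chi b) = chi (a * b')" if d: "dirichlet_char q chi" for chi
  proof -
    have "chi b * chi b' = 1"
      using dirichlet_char_cong[OF d b'(2)] dirichlet_char_1[OF d] dirichlet_char_mult[OF d] by simp
    moreover have "chi b * cnj (chi b) = 1"
      using norm_dirichlet_char[OF d a(2)] by (metis complex_norm_square of_real_1 power_one)
    ultimately have "cnj (chi b) = chi b'" by (metis mult_cancel_left mult_zero_left zero_neq_one)
    then show ?thesis using dirichlet_char_mult[OF d] by simp
  qed
  have "(\<Sum>chi | dirichlet_char q chi. chi a * cnj (chi b)) = (\<Sum>chi | dirichlet_char q chi. chi (a * b'))"
    by (rule sum.cong) (auto simp: eq)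
  also have "\<dots> = (if [a = b] (mod q) then of_nat (totient q) else 0)"
  proof (cases "[a = b] (mod q)")
    case True
    have "[a * b' = 1] (mod q)" using cong_scalar_right[OF True, of b'] b'(2) cong_trans by blast
    then have "chi (a * b') = 1" if "dirichlet_char q chi" for chi
      using dirichlet_char_cong[OF that] dirichlet_char_1[OF that] by simp
    then have "(\<Sum>chi | dirichlet_char q chi. chi (a * b')) = (\<Sum>chi | dirichlet_char q chi. 1)"
      by (intro sum.cong) auto
    then show ?thesis using True card_dirichlet_chars[OF q] by simp
  next
    case False
    have "\<not> [a * b' = 1] (mod q)"
    proof
      assume "[a * b' = 1] (mod q)"
      then have "[a * b' = b * b'] (mod q)" using b'(2) cong_sym cong_trans by blast
      then show False using False b'(1) cong_mult_rcancel_nat by blast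
    qed
    then show ?thesis using sum_dirichlet_chars_ne[OF q, of "a * b'"] a b' False by simp
  qed
  finally show ?thesis .
qed

lemma totatives_diff:
  assumes q: "q \<ge> 2" and a: "a \<in> totatives q"
  shows "q - a \<in> totatives q"
proof -
  have "a > 0" "a < q" using a q totatives_less by (auto simp: in_totatives_iff)
  moreover from this have "gcd (q - a) q = gcd a q" by (intro gcd_diff2_nat) simp
  then have "coprime (q - a) q" using a by (metis coprime_iff_gcd_eq_1 in_totatives_iff)
  ultimately show ?thesis by (simp add: in_totatives_iff)
qed

text \<open>Evenness has the indicator \<open>(1 + chi (q - 1)) / 2\<close>, as \<open>q - 1\<close>
  represents -1 and has square 1. Orthogonality turns the two halves into the pairs
  \<open>b = a\<close> and \<open>b = q - a\<close>; in the moment the first sum yields the diagonal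
  and the second goes into the error.\<close>

lemma even_char_parseval:
  fixes B :: "nat \<Rightarrow> real"
  assumes q: "q \<ge> 2"
  shows "(\<Sum>chi | dirichlet_char q chi \<and> chi (q - 1) = 1. (norm (\<Sum>a\<in>totatives q. chi a * of_real (B a)))\<^sup>2)
     = real (totient q) / 2 * ((\<Sum>a\<in>totatives q. (B a)\<^sup>2) + (\<Sum>a\<in>totatives q. B a * B (q - a)))"
proof -
  define X where "X = {chi. dirichlet_char q chi}"
  define T where "T = (\<lambda>chi::nat \<Rightarrow> complex. \<Sum>a\<in>totatives q. chi a * of_real (B a))"
  have finX: "finite X" unfolding X_def by (rule finite_dirichlet_chars)
  have cop: "coprime (q - 1) q" using q by (intro coprime_diff_one_left_nat) simp
  have sgn: "chi (q - 1) = 1 \<or> chi (q - 1) = -1" if "chi \<in> X" for chi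
  proof -
    have d: "dirichlet_char q chi" using that by (simp add: X_def)
    \<comment> \<open>\<open>r\<close> is \<open>q - 2\<close>, the quotient of
      \<open>(q - 1) * (q - 1) - 1\<close> by \<open>q\<close>.\<close>
    obtain r where r: "q = Suc (Suc r)" using q by (metis add_2_eq_Suc le_Suc_ex)
    have "(q - 1) * (q - 1) = 1 + r * q" by (simp add: r algebra_simps)
    then have "chi (q - 1) * chi (q - 1) = chi (1 + r * q)" using dirichlet_char_mult[OF d] by metis
    also have "\<dots> = 1" unfolding dirichlet_char_period[OF d] by (rule dirichlet_char_1[OF d])
    finally show ?thesis by (simp add: square_eq_1_iff)
  qed
  \<comment> \<open>The factor \<open>chi u\<close> covers both halves of the indicator at once:
    \<open>u = 1\<close> and \<open>u = q - 1\<close>.\<close>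
  have expand: "(\<Sum>chi\<in>X. chi u * (T chi * cnj (T chi)))
      = (\<Sum>a\<in>totatives q. \<Sum>b\<in>totatives q. of_real (B a * B b) * (if [u * a = b] (mod q) then of_nat (totient q) else 0))"
    if u: "coprime u q" for u
  proof -
    have "(\<Sum>chi\<in>X. chi u * (T chi * cnj (T chi)))
        = (\<Sum>chi\<in>X. \<Sum>a\<in>totatives q. \<Sum>b\<in>totatives q. of_real (B a * B b) * (chi (u * a) * cnj (chi b)))"
    proof (rule sum.cong)
      fix chi assume "chi \<in> X"
      then have d: "dirichlet_char q chi" by (simp add: X_def)
      show "chi u * (T chi * cnj (T chi)) = (\<Sum>a\<in>totatives q. \<Sum>b\<in>totatives q. of_real (B a * B b) * (chi (u * a) * cnj (chi b)))"
        unfolding T_def cnj_sum sum_product unfolding sum_distrib_left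
        by (intro sum.cong refl) (simp add: dirichlet_char_mult[OF d])
    qed simp
    also have "\<dots> = (\<Sum>a\<in>totatives q. \<Sum>b\<in>totatives q. \<Sum>chi\<in>X. of_real (B a * B b) * (chi (u * a) * cnj (chi b)))"
      by (subst sum.swap, rule sum.cong[OF refl], rule sum.swap)
    also have "\<dots> = (\<Sum>a\<in>totatives q. \<Sum>b\<in>totatives q. of_real (B a * B b) * (if [u * a = b] (mod q) then of_nat (totient q) else 0))"
    proof (intro sum.cong refl)
      fix a b assume ab: "a \<in> totatives q" "b \<in> totatives q"
      then have "coprime (u * a) q" "coprime b q" using u by (auto simp: in_totatives_iff)
      then show "(\<Sum>chi\<in>X. of_real (B a * B b) * (chi (u * a) * cnj (chi b)))
          = of_real (B a * B b) * (if [u * a = b] (mod q) then of_nat (totient q) else 0)"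
        unfolding sum_distrib_left[symmetric] X_def using dirichlet_char_orthogonality[OF q] by simp
    qed
    finally show ?thesis .
  qed
  have less: "a < q" "a > 0" if "a \<in> totatives q" for a using that q totatives_less by (auto simp: in_totatives_iff)
  have c1: "[1 * a = b] (mod q) \<longleftrightarrow> b = a" if "a \<in> totatives q" "b \<in> totatives q" for a b
    using less that by (auto simp: cong_def)
  have c2: "[(q - 1) * a = b] (mod q) \<longleftrightarrow> b = q - a" if ab: "a \<in> totatives q" "b \<in> totatives q" for a b
  proof -
    obtain a' where a': "a = Suc a'" using less(2)[OF ab(1)] gr0_implies_Suc by blast
    have "(q - 1) * a = (q - a) + a' * q"
      using less[OF ab(1)] unfolding a' by (simp add: algebra_simps diff_mult_distrib)
    then have "((q - 1) * a) mod q = (q - a) mod q" by (simp only: mod_mult_self1)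
    also have "\<dots> = q - a" using less[OF ab(1)] by (intro mod_less) simp
    finally have "((q - 1) * a) mod q = q - a" .
    then show ?thesis using less[OF ab(2)] by (auto simp: cong_def)
  qed
  note qa = totatives_diff[OF q]
  have pick: "(\<Sum>b\<in>totatives q. complex_of_real (B a * B b) * (if b = c then of_nat (totient q) else 0))
      = of_real (real (totient q) * (B a * B c))" if "c \<in> totatives q" for a c
    using that by (simp add: if_distrib[of "\<lambda>x. _ * x"] mult_ac cong: if_cong)
  have e1: "(\<Sum>chi\<in>X. chi 1 * (T chi * cnj (T chi))) = of_real (real (totient q) * (\<Sum>a\<in>totatives q. (B a)\<^sup>2))"
  proof -
    have "(\<Sum>chi\<in>X. chi 1 * (T chi * cnj (T chi))) = (\<Sum>a\<in>totatives q. of_real (real (totient q) * (B a * B a)))"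
      unfolding expand[OF coprime_1_left]
    proof (rule sum.cong[OF refl])
      fix a assume a: "a \<in> totatives q"
      show "(\<Sum>b\<in>totatives q. of_real (B a * B b) * (if [1 * a = b] (mod q) then of_nat (totient q) else 0))
          = complex_of_real (real (totient q) * (B a * B a))"
        unfolding pick[OF a, symmetric] by (intro sum.cong refl) (simp only: c1[OF a])
    qed
    then show ?thesis by (simp add: sum_distrib_left power2_eq_square)
  qed
  have e2: "(\<Sum>chi\<in>X. chi (q - 1) * (T chi * cnj (T chi))) = of_real (real (totient q) * (\<Sum>a\<in>totatives q. B a * B (q - a)))"
  proof -
    have "(\<Sum>chi\<in>X. chi (q - 1) * (T chi * cnj (T chi))) = (\<Sum>a\<in>totatives q. of_real (real (totient q) * (B a * B (q - a))))"
      unfolding expand[OF cop]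
    proof (rule sum.cong[OF refl])
      fix a assume a: "a \<in> totatives q"
      show "(\<Sum>b\<in>totatives q. of_real (B a * B b) * (if [(q - 1) * a = b] (mod q) then of_nat (totient q) else 0))
          = complex_of_real (real (totient q) * (B a * B (q - a)))"
        unfolding pick[OF qa[OF a], symmetric] by (intro sum.cong refl) (simp only: c2[OF a])
    qed
    then show ?thesis by (simp add: sum_distrib_left)
  qed
  have "complex_of_real (\<Sum>chi | dirichlet_char q chi \<and> chi (q - 1) = 1. (norm (T chi))\<^sup>2)
      = (\<Sum>chi\<in>X. if chi (q - 1) = 1 then T chi * cnj (T chi) else 0)"
  proof -
    have set_eq: "{chi. dirichlet_char q chi \<and> chi (q - 1) = 1} = {chi \<in> X. chi (q - 1) = 1}" by (auto simp: X_def)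
    show ?thesis
      unfolding set_eq sum.inter_filter[OF finX] of_real_sum
    proof (intro sum.cong refl)
      fix chi
      show "complex_of_real (if chi (q - 1) = 1 then (norm (T chi))\<^sup>2 else 0)
          = (if chi (q - 1) = 1 then T chi * cnj (T chi) else 0)"
        using complex_norm_square[of "T chi"] by (cases "chi (q - 1) = 1") simp_all
    qed
  qed
  also have "\<dots> = (\<Sum>chi\<in>X. (chi 1 * (T chi * cnj (T chi)) + chi (q - 1) * (T chi * cnj (T chi))) / 2)"
  proof (rule sum.cong[OF refl])
    fix chi assume chi: "chi \<in> X"
    then have "chi 1 = 1" using dirichlet_char_1 by (auto simp: X_def)
    then show "(if chi (q - 1) = 1 then T chi * cnj (T chi) else 0)
        = (chi 1 * (T chi * cnj (T chi)) + chi (q - 1) * (T chi * cnj (T chi))) / 2"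
      using sgn[OF chi] by auto
  qed
  also have "\<dots> = ((\<Sum>chi\<in>X. chi 1 * (T chi * cnj (T chi))) + (\<Sum>chi\<in>X. chi (q - 1) * (T chi * cnj (T chi)))) / 2"
    by (simp only: sum.distrib sum_divide_distrib[symmetric])
  also have "\<dots> = of_real (real (totient q) / 2 * ((\<Sum>a\<in>totatives q. (B a)\<^sup>2) + (\<Sum>a\<in>totatives q. B a * B (q - a))))"
    unfolding e1 e2 by (simp add: field_simps)
  finally show ?thesis unfolding of_real_eq_iff T_def .
qed

section \<open>Analytic continuation\<close>

text \<open>Each summation by parts against a periodic sequence of mean zero replaces \<open>n powr -s\<close> by its
  next difference, which is smaller by a factor \<open>n\<close>; iterating yields the entire continuation.\<close>

fun powr_diff :: "nat \<Rightarrow> complex \<Rightarrow> complex \<Rightarrow> complex" where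
  "powr_diff 0 s z = z powr (-s)"
| "powr_diff (Suc N) s z = powr_diff N s z - powr_diff N s (z + 1)"

text \<open>Differentiation in \<open>z\<close> raises \<open>s\<close> by one and commutes with the
  difference operator, so an induction on \<open>N\<close> can trade one difference for one
  derivative.\<close>

lemma powr_diff_has_field_derivative:
  "Re z > 0 \<Longrightarrow> (powr_diff N s has_field_derivative (- s * powr_diff N (s + 1) z)) (at z)"
proof (induction N arbitrary: z)
  case 0
  have "z \<notin> \<real>\<^sub>\<le>\<^sub>0" using 0 complex_nonpos_Reals_iff by auto
  then have "((\<lambda>z. z powr (-s)) has_field_derivative (- s * z powr (- s - 1))) (at z)"
    by (auto intro!: derivative_eq_intros)
  moreover have "(\<lambda>z. z powr (-s)) = powr_diff 0 s" by auto
  ultimately show ?case by simp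
next
  case (Suc N)
  have "(powr_diff N s has_field_derivative (- s * powr_diff N (s + 1) (z + 1))) (at (z + 1))"
    by (rule Suc.IH) (use Suc.prems in simp)
  then have "((\<lambda>z. powr_diff N s (z + 1)) has_field_derivative (- s * powr_diff N (s + 1) (z + 1))) (at z)"
    using DERIV_shift by blast
  then have "((\<lambda>z. powr_diff N s z - powr_diff N s (z + 1)) has_field_derivative
      (- s * powr_diff N (s + 1) z - (- s * powr_diff N (s + 1) (z + 1)))) (at z)"
    using Suc.IH[OF Suc.prems] by (intro DERIV_diff)
  moreover have "powr_diff (Suc N) s = (\<lambda>z. powr_diff N s z - powr_diff N s (z + 1))" by auto
  ultimately show ?case by (simp add: algebra_simps)
qed

lemma powr_diff_holomorphic: "x > 0 \<Longrightarrow> (\<lambda>s. powr_diff N s (of_real x)) holomorphic_on A"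
proof (induction N arbitrary: x)
  case 0
  then show ?case by (auto intro!: holomorphic_intros)
next
  case (Suc N)
  have "(\<lambda>s. powr_diff N s (of_real x) - powr_diff N s (of_real (x + 1))) holomorphic_on A"
    by (intro holomorphic_intros Suc.IH) (use Suc.prems in auto)
  then show ?case by simp
qed

text \<open>Each difference is a mean value estimate over a segment of length 1, bringing in a
  factor from the derivative and one more power of \<open>1 / x\<close>. The condition on
  \<open>Re s + N\<close> makes the bound nonincreasing in \<open>x\<close>, so that the left
  endpoint dominates the segment.\<close>

lemma norm_powr_diff_le:
  "x > 0 \<Longrightarrow> Re s + N \<ge> 0 \<Longrightarrow>
     norm (powr_diff N s (of_real x)) \<le> (\<Prod>i<N. norm (s + of_nat i)) * x powr (- (Re s + N))"
proof (induction N arbitrary: s x)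
  case 0
  then show ?case by (simp add: norm_powr_real_powr)
next
  case (Suc N)
  define B where "B = (\<Prod>i<Suc N. norm (s + of_nat i)) * x powr (- (Re s + Suc N))"
  have Beq: "norm s * (\<Prod>i<N. norm (s + 1 + of_nat i)) = (\<Prod>i<Suc N. norm (s + of_nat i))"
    by (subst prod.lessThan_Suc_shift) (simp add: add_ac)
  have bound: "norm (- s * powr_diff N (s + 1) z) \<le> B"
    if z: "z \<in> closed_segment (of_real x) (of_real (x + 1))" for z
  proof -
    obtain y where y: "z = of_real y" "x \<le> y"
      using z unfolding closed_segment_of_real by (auto simp: closed_segment_eq_real_ivl)
    have "norm (powr_diff N (s + 1) (of_real y)) \<le> (\<Prod>i<N. norm (s + 1 + of_nat i)) * y powr (- (Re (s + 1) + N))"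
      using Suc.prems y by (intro Suc.IH) auto
    also have "\<dots> \<le> (\<Prod>i<N. norm (s + 1 + of_nat i)) * x powr (- (Re (s + 1) + N))"
      using Suc.prems y by (intro mult_left_mono powr_mono2' prod_nonneg) auto
    finally have "norm s * norm (powr_diff N (s + 1) (of_real y))
        \<le> norm s * ((\<Prod>i<N. norm (s + 1 + of_nat i)) * x powr (- (Re (s + 1) + N)))"
      by (intro mult_left_mono) auto
    also have "\<dots> = B"
      unfolding B_def Beq[symmetric] by (simp add: algebra_simps)
    finally show ?thesis by (simp add: norm_mult y)
  qed
  have "norm (powr_diff N s (of_real x) - powr_diff N s (of_real (x + 1))) \<le> B * norm (of_real x - of_real (x + 1) :: complex)"
  proof (rule field_differentiable_bound[where f' = "\<lambda>z. - s * powr_diff N (s + 1) z"])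
    fix z assume z: "z \<in> closed_segment (of_real x) (of_real (x + 1) :: complex)"
    then obtain y where y: "z = of_real y" "x \<le> y"
      unfolding closed_segment_of_real by (auto simp: closed_segment_eq_real_ivl)
    have "Re z > 0" using y Suc.prems by simp
    from has_field_derivative_at_within[OF powr_diff_has_field_derivative[OF this]]
    show "(powr_diff N s has_field_derivative - s * powr_diff N (s + 1) z)
        (at z within closed_segment (of_real x) (of_real (x + 1)))" .
    show "norm (- s * powr_diff N (s + 1) z) \<le> B" by (rule bound[OF z])
  qed auto
  then show ?case by (simp add: B_def)
qed

section \<open>Periodic sequences of mean zero and their Dirichlet series\<close>

definition mean_zero_periodic :: "nat \<Rightarrow> (nat \<Rightarrow> complex) \<Rightarrow> bool" where
  "mean_zero_periodic q a \<longleftrightarrow> q > 0 \<and> (\<forall>n. a (n + q) = a n) \<and> (\<Sum>n<q. a n) = 0"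

lemma periodic_mod:
  fixes a :: "nat \<Rightarrow> 'a"
  assumes "\<And>n. a (n + q) = a n"
  shows "a (n mod q) = a n"
proof -
  have "a (m + j * q) = a m" for m j
    by (induction j) (use assms[of "m + _ * q"] in \<open>auto simp: add_ac\<close>)
  from this[of "n mod q" "n div q"] show ?thesis by simp
qed

lemma periodic_bounded:
  fixes a :: "nat \<Rightarrow> complex"
  assumes "q > 0" "\<And>n. a (n + q) = a n"
  obtains C where "C > 0" "\<And>n. norm (a n) \<le> C"
proof
  show "norm (a n) \<le> 1 + (\<Sum>m<q. norm (a m))" for n
  proof -
    have "norm (a (n mod q)) \<le> (\<Sum>m<q. norm (a m))"
      using assms(1) by (intro member_le_sum) auto
    then show ?thesis using periodic_mod[of a q n, OF assms(2)] by simp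
  qed
  show "0 < 1 + (\<Sum>m<q. norm (a m))" by (simp add: add_pos_nonneg sum_nonneg)
qed

lemma sum_shift_periodic:
  fixes a :: "nat \<Rightarrow> complex"
  assumes "\<And>n. a (n + q) = a n"
  shows "(\<Sum>i<q. a (n + i)) = (\<Sum>i<q. a i)"
proof (induction n)
  case (Suc n)
  show ?case
  proof (cases q)
    case (Suc r)
    have "(\<Sum>i<q. a (Suc n + i)) = (\<Sum>i<r. a (Suc n + i)) + a (n + q)" by (simp add: Suc)
    also have "\<dots> = (\<Sum>i<q. a (n + i))"
      unfolding Suc sum.lessThan_Suc_shift using assms[of n] by (simp add: Suc)
    finally show ?thesis using Suc.IH by simp
  qed auto
qed auto

text \<open>Whole periods cancel, leaving a sum of at most \<open>q\<close> terms.\<close>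

lemma norm_periodic_partial_sum_le:
  assumes a: "mean_zero_periodic q a" and b: "\<And>n. norm (a n) \<le> 1"
  shows "norm (\<Sum>i<n. a (Suc i)) \<le> q"
proof (induction n rule: less_induct)
  case (less n)
  show ?case
  proof (cases "n \<le> q")
    case True
    have "norm (\<Sum>i<n. a (Suc i)) \<le> (\<Sum>i<n. 1)" by (rule sum_norm_le) (use b in auto)
    then show ?thesis using True by simp
  next
    case False
    then obtain m where m: "n = m + q" by (metis add.commute le_add_diff_inverse nat_le_linear)
    have "(\<Sum>i<n. a (Suc i)) = (\<Sum>i<m. a (Suc i)) + (\<Sum>i<q. a (Suc m + i))"
      unfolding m by (induction q) (auto simp: add_ac)
    also have "(\<Sum>i<q. a (Suc m + i)) = 0"
      using a sum_shift_periodic[of a q "Suc m"] by (simp add: mean_zero_periodic_def)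
    finally show ?thesis using less.IH[of m] m a by (simp add: mean_zero_periodic_def)
  qed
qed

text \<open>The partial sums of a mean-zero sequence are periodic; subtracting their own mean
  \<open>c\<close> gives a sequence of the same kind, so that summation by parts can be repeated
  indefinitely. The bound adds \<open>q\<close> for the partial sums and \<open>q\<close> for
  \<open>c\<close>.\<close>

lemma mean_zero_periodic_antidifference:
  assumes a: "mean_zero_periodic q a"
  obtains A where "mean_zero_periodic q A" "\<And>n. a (Suc n) = A (Suc n) - A n"
    "(\<And>n. norm (a n) \<le> 1) \<Longrightarrow> (\<And>n. norm (A n) \<le> 2 * real q)"
proof -
  define S where "S = (\<lambda>n. \<Sum>i<n. a (Suc i))"
  define c where "c = (\<Sum>n<q. S n) / of_nat q"
  define A where "A = (\<lambda>n. S n - c)"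
  have q: "q > 0" and per: "\<And>n. a (n + q) = a n" and mz: "(\<Sum>n<q. a n) = 0"
    using a by (auto simp: mean_zero_periodic_def)
  have "S (n + q) = S n" for n
  proof -
    have "S (n + q) = S n + (\<Sum>i<q. a (Suc n + i))"
      unfolding S_def by (induction q) (auto simp: add_ac)
    then show ?thesis using sum_shift_periodic[of a q "Suc n", OF per] mz by simp
  qed
  moreover have "(\<Sum>n<q. A n) = 0"
    using q by (simp add: A_def sum_subtractf c_def)
  ultimately have "mean_zero_periodic q A"
    using q by (simp add: mean_zero_periodic_def A_def)
  moreover have "a (Suc n) = A (Suc n) - A n" for n by (simp add: A_def S_def)
  moreover have "norm (A n) \<le> 2 * real q" if "\<And>n. norm (a n) \<le> 1" for n
  proof -
    have Sn: "norm (S n) \<le> q" for n unfolding S_def by (rule norm_periodic_partial_sum_le[OF a that])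
    have "norm (\<Sum>n<q. S n) \<le> (\<Sum>n<q. real q)" by (rule sum_norm_le) (use Sn in auto)
    then have "norm c \<le> q" using q by (simp add: c_def norm_divide field_simps)
    then show ?thesis using norm_triangle_ineq4[of "S n" c] Sn[of n] by (simp add: A_def)
  qed
  ultimately show ?thesis using that by blast
qed

lemma summable_powr_diff:
  assumes "\<And>n. norm (a n) \<le> C" "Re s + N > 1"
  shows "summable (\<lambda>n. norm (a (Suc n) * powr_diff N s (of_nat (Suc n))))"
proof (rule summable_comparison_test')
  define K where "K = (\<Prod>i<N. norm (s + of_nat i))"
  have "summable (\<lambda>n. real n powr (- (Re s + N)))" using assms by (simp add: summable_real_powr_iff)
  then show "summable (\<lambda>n. C * (K * real (Suc n) powr (- (Re s + N))))"
    by (intro summable_mult) (subst summable_Suc_iff)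
  fix n :: nat
  have "norm (powr_diff N s (of_real (real (Suc n)))) \<le> K * real (Suc n) powr (- (Re s + N))"
    unfolding K_def by (rule norm_powr_diff_le) (use assms in auto)
  then show "norm (norm (a (Suc n) * powr_diff N s (of_nat (Suc n)))) \<le> C * (K * real (Suc n) powr (- (Re s + N)))"
    using assms(1)[of "Suc n"] norm_ge_zero[of "a (Suc n)"]
    unfolding real_norm_def norm_mult abs_mult abs_norm_cancel of_real_of_nat_eq by (intro mult_mono) (auto intro: order_trans[OF norm_ge_zero assms(1)])
qed

lemma powr_diff_series_holomorphic:
  assumes C: "\<And>n. norm (a n) \<le> C"
  shows "(\<lambda>s. \<Sum>n. a (Suc n) * powr_diff N s (of_nat (Suc n))) holomorphic_on {s. Re s > 1 - real N}"
proof (rule holomorphic_uniform_sequence[where f = "\<lambda>M s. \<Sum>n<M. a (Suc n) * powr_diff N s (of_nat (Suc n))"])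
  have C0: "C \<ge> 0" using order_trans[OF norm_ge_zero C] .
  show "open {s. Re s > 1 - real N}" by (rule open_halfspace_Re_gt)
  have "(\<lambda>s. powr_diff N s (of_real (real (Suc n)))) holomorphic_on A" for n A
    by (rule powr_diff_holomorphic) auto
  then show "(\<lambda>s. \<Sum>n<M. a (Suc n) * powr_diff N s (of_nat (Suc n))) holomorphic_on {s. Re s > 1 - real N}" for M
    unfolding of_real_of_nat_eq by (intro holomorphic_intros)
  fix s0 assume "s0 \<in> {s. Re s > 1 - real N}"
  then have s0: "Re s0 > 1 - real N" by simp
  \<comment> \<open>Half the distance to the boundary line, which keeps the convergence uniform on
    the closed disc.\<close>
  define d where "d = (Re s0 - (1 - real N)) / 2"
  have d: "d > 0" "Re s0 - d > 1 - real N" using s0 by (auto simp: d_def field_simps)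
  have Re_ge: "Re s \<ge> Re s0 - d" if "s \<in> cball s0 d" for s
    using that abs_Re_le_cmod[of "s0 - s"] by (simp add: dist_norm)
  define K where "K = (\<Prod>i<N. norm s0 + d + real i)"
  have sub: "cball s0 d \<subseteq> {s. Re s > 1 - real N}" using Re_ge d by force
  have "uniform_limit (cball s0 d) (\<lambda>M s. \<Sum>n<M. a (Suc n) * powr_diff N s (of_nat (Suc n)))
      (\<lambda>s. \<Sum>n. a (Suc n) * powr_diff N s (of_nat (Suc n))) sequentially"
  proof (rule Weierstrass_m_test)
    have "summable (\<lambda>n. real n powr (- (Re s0 - d + N)))"
      using d by (simp add: summable_real_powr_iff)
    then show "summable (\<lambda>n. C * (K * real (Suc n) powr (- (Re s0 - d + N))))"
      by (intro summable_mult) (subst summable_Suc_iff)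
    fix n :: nat and s assume s: "s \<in> cball s0 d"
    have "norm (powr_diff N s (of_real (real (Suc n)))) \<le> (\<Prod>i<N. norm (s + of_nat i)) * real (Suc n) powr (- (Re s + N))"
      by (rule norm_powr_diff_le) (use Re_ge[OF s] d in auto)
    also have "\<dots> \<le> K * real (Suc n) powr (- (Re s0 - d + N))"
    proof (intro mult_mono powr_mono)
      show "(\<Prod>i<N. norm (s + of_nat i)) \<le> K"
        unfolding K_def
      proof (intro prod_mono conjI)
        fix i
        have "norm s \<le> norm s0 + d" using s norm_triangle_ineq2[of s s0] by (simp add: dist_norm norm_minus_commute)
        then show "norm (s + of_nat i) \<le> norm s0 + d + real i"
          using norm_triangle_ineq[of s "of_nat i"] by simp
      qed auto
      show "0 \<le> K" unfolding K_def using d by (intro prod_nonneg) auto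
    qed (use Re_ge[OF s] in auto)
    finally show "norm (a (Suc n) * powr_diff N s (of_nat (Suc n))) \<le> C * (K * real (Suc n) powr (- (Re s0 - d + N)))"
      using C[of "Suc n"] C0 unfolding norm_mult of_real_of_nat_eq by (intro mult_mono) auto
  qed
  with d sub show "\<exists>d. 0 < d \<and> cball s0 d \<subseteq> {s. Re s > 1 - real N} \<and> uniform_limit (cball s0 d)
      (\<lambda>M s. \<Sum>n<M. a (Suc n) * powr_diff N s (of_nat (Suc n)))
      (\<lambda>s. \<Sum>n. a (Suc n) * powr_diff N s (of_nat (Suc n))) sequentially"
    by blast
qed

lemma summation_by_parts:
  fixes A g :: "nat \<Rightarrow> complex"
  shows "(\<Sum>n<M. (A (Suc n) - A n) * g (Suc n))
    = (\<Sum>n<M. A (Suc n) * (g (Suc n) - g (Suc (Suc n)))) + A M * g (Suc M) - A 0 * g 1"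
  by (induction M) (auto simp: algebra_simps)

text \<open>At infinity the boundary term tends to 0; at the lower end the constant
  \<open>A 0\<close> contributes the isolated term. The new series converges absolutely in a
  half-plane reaching one unit further left than the region of absolute convergence guaranteed for
  the old one.\<close>

lemma powr_diff_series_by_parts:
  assumes C: "\<And>n. norm (A n) \<le> C" and aA: "\<And>n. a (Suc n) = A (Suc n) - A n" and s: "Re s + N > 0"
  shows "(\<lambda>n. a (Suc n) * powr_diff N s (of_nat (Suc n))) sums
    ((\<Sum>n. A (Suc n) * powr_diff (Suc N) s (of_nat (Suc n))) - A 0 * powr_diff N s 1)"
proof -
  define g where "g = (\<lambda>n. powr_diff N s (of_nat n))"
  define K where "K = (\<Prod>i<N. norm (s + of_nat i))"
  have "(\<lambda>M. A M * g (Suc M)) \<longlonglongrightarrow> 0"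
  proof (rule Lim_null_comparison)
    show "\<forall>\<^sub>F M in sequentially. norm (A M * g (Suc M)) \<le> C * (K * real (Suc M) powr (- (Re s + N)))"
    proof (intro always_eventually allI)
      fix M
      have "norm (powr_diff N s (of_real (real (Suc M)))) \<le> K * real (Suc M) powr (- (Re s + N))"
        unfolding K_def by (rule norm_powr_diff_le) (use s in auto)
      then show "norm (A M * g (Suc M)) \<le> C * (K * real (Suc M) powr (- (Re s + N)))"
        using C[of M] order_trans[OF norm_ge_zero C[of M]] unfolding norm_mult g_def of_real_of_nat_eq
        by (intro mult_mono) auto
    qed
    have "(\<lambda>M. real (Suc M) powr (- (Re s + N))) \<longlonglongrightarrow> 0"
      by (rule tendsto_neg_powr[OF _ filterlim_compose[OF filterlim_real_sequentially filterlim_Suc]]) (use s in auto)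
    then show "(\<lambda>M. C * (K * real (Suc M) powr (- (Re s + N)))) \<longlonglongrightarrow> 0"
      by (intro tendsto_mult_right_zero)
  qed
  moreover have "summable (\<lambda>n. A (Suc n) * powr_diff (Suc N) s (of_nat (Suc n)))"
    by (rule summable_norm_cancel, rule summable_powr_diff[OF C]) (use s in auto)
  then have "(\<lambda>M. \<Sum>n<M. A (Suc n) * powr_diff (Suc N) s (of_nat (Suc n))) \<longlonglongrightarrow>
      (\<Sum>n. A (Suc n) * powr_diff (Suc N) s (of_nat (Suc n)))"
    by (rule summable_LIMSEQ)
  ultimately have "(\<lambda>M. (\<Sum>n<M. A (Suc n) * powr_diff (Suc N) s (of_nat (Suc n))) + A M * g (Suc M) - A 0 * g 1)
      \<longlonglongrightarrow> (\<Sum>n. A (Suc n) * powr_diff (Suc N) s (of_nat (Suc n))) + 0 - A 0 * g 1"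
    by (intro tendsto_intros)
  moreover have "(\<Sum>n<M. A (Suc n) * powr_diff (Suc N) s (of_nat (Suc n))) + A M * g (Suc M) - A 0 * g 1
      = (\<Sum>n<M. a (Suc n) * powr_diff N s (of_nat (Suc n)))" for M
    unfolding aA using summation_by_parts[of A g M] by (simp add: g_def add_ac)
  ultimately show ?thesis by (simp add: sums_def g_def)
qed

text \<open>The induction varies \<open>a\<close> and \<open>k\<close> because one summation by
  parts replaces \<open>a\<close> by its antidifference and \<open>k\<close> by
  \<open>Suc k\<close>, moving the boundary one unit to the left.\<close>

lemma periodic_series_continuation_halfplane:
  assumes "mean_zero_periodic q a"
  shows "\<exists>F. F holomorphic_on {s. Re s > 1 - real k - real N} \<and>
    (\<forall>s. Re s > 1 - real k \<longrightarrow> F s = (\<Sum>n. a (Suc n) * powr_diff k s (of_nat (Suc n))))"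
  using assms
proof (induction N arbitrary: a k)
  case 0
  obtain C where C: "C > 0" "\<And>n. norm (a n) \<le> C"
    using 0 periodic_bounded[of q a] unfolding mean_zero_periodic_def by blast
  show ?case
    by (rule exI[of _ "\<lambda>s. \<Sum>n. a (Suc n) * powr_diff k s (of_nat (Suc n))"])
      (use powr_diff_series_holomorphic[OF C(2)] in simp)
next
  case (Suc N)
  obtain A where A: "mean_zero_periodic q A" "\<And>n. a (Suc n) = A (Suc n) - A n"
    using mean_zero_periodic_antidifference[OF Suc.prems] by metis
  obtain C where C: "C > 0" "\<And>n. norm (A n) \<le> C"
    using A(1) periodic_bounded[of q A] unfolding mean_zero_periodic_def by blast
  obtain F where F: "F holomorphic_on {s. Re s > 1 - real (Suc k) - real N}"
    "\<And>s. Re s > 1 - real (Suc k) \<Longrightarrow> F s = (\<Sum>n. A (Suc n) * powr_diff (Suc k) s (of_nat (Suc n)))"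
    using Suc.IH[OF A(1)] by blast
  show ?case
  proof (intro exI[of _ "\<lambda>s. F s - A 0 * powr_diff k s (of_real 1)"] conjI allI impI)
    show "(\<lambda>s. F s - A 0 * powr_diff k s (of_real 1)) holomorphic_on {s. Re s > 1 - real k - real (Suc N)}"
      using F(1) by (intro holomorphic_intros powr_diff_holomorphic) (auto simp: algebra_simps)
    fix s assume s: "Re s > 1 - real k"
    have "(\<lambda>n. a (Suc n) * powr_diff k s (of_nat (Suc n))) sums
        ((\<Sum>n. A (Suc n) * powr_diff (Suc k) s (of_nat (Suc n))) - A 0 * powr_diff k s 1)"
      by (rule powr_diff_series_by_parts[where a = a and A = A, OF C(2) A(2)]) (use s in auto)
    then show "F s - A 0 * powr_diff k s (of_real 1) = (\<Sum>n. a (Suc n) * powr_diff k s (of_nat (Suc n)))"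
      using F(2)[of s] s by (simp add: sums_iff)
  qed
qed

lemma holomorphic_eq_on_halfplane:
  assumes "F holomorphic_on {s. Re s > c}" "G holomorphic_on {s. Re s > c}"
    and "\<And>s. Re s > c' \<Longrightarrow> F s = G s" and s: "Re s > c"
  shows "F s = (G s :: complex)"
proof (rule analytic_continuation_open[of "{s. Re s > max c c'}" "{s. Re s > c}" F G])
  show "{s. Re s > max c c'} \<noteq> {}"
    by (auto intro!: exI[of _ "of_real (max c c' + 1)"])
  show "open {s. Re s > max c c'}" "open {s. Re s > c}" by (rule open_halfspace_Re_gt)+
  show "connected {s. Re s > c}" by (intro convex_connected convex_halfspace_Re_gt)
qed (use assms in auto)

lemma periodic_series_entire:
  assumes a: "mean_zero_periodic q a"
  obtains F where "F holomorphic_on UNIV" "\<And>s. Re s > 1 \<Longrightarrow> F s = (\<Sum>n. a (Suc n) * of_nat (Suc n) powr (-s))"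
proof -
  define U where "U = (\<lambda>N::nat. {s. Re s > 1 - real N})"
  define P where "P = (\<lambda>s. \<Sum>n. a (Suc n) * of_nat (Suc n) powr (-s))"
  have "\<forall>N. \<exists>F. F holomorphic_on U N \<and> (\<forall>s. Re s > 1 \<longrightarrow> F s = P s)"
    using periodic_series_continuation_halfplane[OF a, of 0] by (simp add: U_def P_def)
  then obtain F where F: "\<And>N. F N holomorphic_on U N" "\<And>N s. Re s > 1 \<Longrightarrow> F N s = P s" by metis
  have agree: "F M s = F N s" if "s \<in> U N" "N \<le> M" for M N s
  proof (rule holomorphic_eq_on_halfplane[of "F M" "1 - real N" "F N" 1])
    show "F M holomorphic_on {s. Re s > 1 - real N}"
      by (rule holomorphic_on_subset[OF F(1)]) (use that in \<open>auto simp: U_def\<close>)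
    show "F N holomorphic_on {s. Re s > 1 - real N}" using F(1)[of N] by (simp add: U_def)
  qed (use that F(2) in \<open>auto simp: U_def\<close>)
  \<comment> \<open>Large enough that \<open>1 - N\<close> lies strictly left of
    \<open>Re s\<close>; by the identity theorem any other admissible index gives the same value, so
    the pieces glue.\<close>
  define N where "N = (\<lambda>s::complex. nat \<lceil>2 - Re s\<rceil>)"
  have sN: "s \<in> U (N s)" for s unfolding U_def N_def by (simp add: le_less_trans) linarith
  define G where "G = (\<lambda>s. F (N s) s)"
  have GF: "G s = F M s" if "s \<in> U M" for s M
    using agree[OF that, of "N s"] agree[OF sN, of s M] by (cases "M \<le> N s") (auto simp: G_def)
  have "G field_differentiable at s" for s
  proof -
    have "open (U (N s))" unfolding U_def by (rule open_halfspace_Re_gt)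
    have "G holomorphic_on U (N s)"
      using F(1)[of "N s"] GF by (metis holomorphic_transform)
    then show ?thesis using sN \<open>open (U (N s))\<close> by (metis holomorphic_on_imp_differentiable_at)
  qed
  then have "G holomorphic_on UNIV" by (simp add: holomorphic_on_def field_differentiable_at_within)
  moreover have "G s = P s" if "Re s > 1" for s using F(2)[OF that] by (simp add: G_def)
  ultimately show ?thesis using that unfolding P_def by blast
qed

text \<open>A single summation by parts gives convergence in \<open>Re s > 0\<close> to a
  holomorphic sum, which must be \<open>F\<close> by the identity theorem.\<close>

lemma periodic_series_sums:
  assumes a: "mean_zero_periodic q a" and F: "F holomorphic_on UNIV"
    "\<And>s. Re s > 1 \<Longrightarrow> F s = (\<Sum>n. a (Suc n) * of_nat (Suc n) powr (-s))"
    and s: "Re s > 0"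
  shows "(\<lambda>n. a (Suc n) * of_nat (Suc n) powr (-s)) sums F s"
proof -
  obtain A where A: "mean_zero_periodic q A" "\<And>n. a (Suc n) = A (Suc n) - A n"
    using mean_zero_periodic_antidifference[OF a] by metis
  obtain C where C: "C > 0" "\<And>n. norm (A n) \<le> C"
    using A(1) periodic_bounded[of q A] unfolding mean_zero_periodic_def by blast
  define G where "G = (\<lambda>s. (\<Sum>n. A (Suc n) * powr_diff 1 s (of_nat (Suc n))) - A 0 * powr_diff 0 s (of_real 1))"
  have G: "(\<lambda>n. a (Suc n) * of_nat (Suc n) powr (-s)) sums G s" if "Re s > 0" for s
    using powr_diff_series_by_parts[where a = a and A = A, OF C(2) A(2), of s 0] that by (simp add: G_def)
  have "G holomorphic_on {s. Re s > 1 - real 1}"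
    unfolding G_def by (intro holomorphic_intros powr_diff_series_holomorphic[OF C(2)] powr_diff_holomorphic) auto
  then have "G holomorphic_on {s. Re s > 0}" by simp
  moreover have "F holomorphic_on {s. Re s > 0}" using F(1) holomorphic_on_subset by blast
  ultimately have "F s = G s"
    using holomorphic_eq_on_halfplane[of F 0 G 1 s] F(2) G s by (simp add: sums_iff)
  then show ?thesis using G[OF s] by simp
qed

text \<open>One summation by parts against an antidifference bounded by \<open>2 * q\<close>. What
  matters is that the bound is polynomial in \<open>q\<close> and otherwise independent of the
  sequence: it becomes the upper bound for L on a disc.\<close>

lemma periodic_series_bound:
  assumes a: "mean_zero_periodic q a" "\<And>n. norm (a n) \<le> 1" and sm: "(\<lambda>n. a (Suc n) * of_nat (Suc n) powr (-s)) sums S"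
    and s: "Re s \<ge> \<sigma>" "\<sigma> > 0"
  shows "norm S \<le> 2 * real q * (1 + norm s * (\<Sum>n. real (Suc n) powr (- (\<sigma> + 1))))"
proof -
  obtain A where A: "mean_zero_periodic q A" "\<And>n. a (Suc n) = A (Suc n) - A n" "\<And>n. norm (A n) \<le> 2 * real q"
    using mean_zero_periodic_antidifference[OF a(1)] a(2) by metis
  define x where "x = (\<lambda>n. A (Suc n) * powr_diff (Suc 0) s (of_nat (Suc n)))"
  have "(\<lambda>n. a (Suc n) * powr_diff 0 s (of_nat (Suc n))) sums ((\<Sum>n. x n) - A 0 * powr_diff 0 s 1)"
    unfolding x_def by (rule powr_diff_series_by_parts[where a = a and A = A, OF A(3) A(2)]) (use s in auto)
  then have S: "S = (\<Sum>n. x n) - A 0" using sums_unique2[OF sm] by simp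
  have sm0: "summable (\<lambda>n. real (Suc n) powr (- (\<sigma> + 1)))"
    using s by (subst summable_Suc_iff) (simp add: summable_real_powr_iff)
  have xb: "norm (x n) \<le> 2 * real q * (norm s * real (Suc n) powr (- (\<sigma> + 1)))" for n
  proof -
    have "norm (powr_diff 1 s (of_real (real (Suc n)))) \<le> (\<Prod>i<1. norm (s + of_nat i)) * real (Suc n) powr (- (Re s + real 1))"
      by (rule norm_powr_diff_le) (use s in auto)
    also have "\<dots> = norm s * real (Suc n) powr (- (Re s + 1))" by simp
    also have "\<dots> \<le> norm s * real (Suc n) powr (- (\<sigma> + 1))"
      using s by (intro mult_left_mono powr_mono) auto
    finally show ?thesis
      unfolding x_def norm_mult of_real_of_nat_eq One_nat_def
      using A(3)[of "Suc n"] by (intro mult_mono) auto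
  qed
  have "norm (\<Sum>n. x n) \<le> (\<Sum>n. 2 * real q * (norm s * real (Suc n) powr (- (\<sigma> + 1))))"
    using sm0 by (intro norm_suminf_le[OF xb] summable_mult)
  also have "\<dots> = 2 * real q * (norm s * (\<Sum>n. real (Suc n) powr (- (\<sigma> + 1))))"
    using sm0 by (simp only: suminf_mult summable_mult)
  finally show ?thesis
    unfolding S using norm_triangle_ineq4[of "\<Sum>n. x n" "A 0"] A(3)[of 0] by (simp add: algebra_simps)
qed

section \<open>Non-vanishing on the line Re s = 1\<close>

lemma norm_powr_diff_unit_le:
  assumes x: "x > 0" "x \<le> y" "y \<le> x + 1" and s: "Re s \<ge> -1"
  shows "norm (of_real y powr (-s) - of_real x powr (-s)) \<le> norm s * x powr (- (Re s + 1))"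
proof -
  let ?S = "closed_segment (of_real x) (of_real y :: complex)"
  have "norm (of_real y powr (-s) - of_real x powr (-s)) \<le> (norm s * x powr (- (Re s + 1))) * norm (of_real y - of_real x :: complex)"
  proof (rule field_differentiable_bound[where S = ?S and f' = "\<lambda>z. - s * z powr (- s - 1)"])
    fix z assume "z \<in> ?S"
    then obtain u where u: "z = of_real u" "x \<le> u"
      unfolding closed_segment_of_real using x by (auto simp: closed_segment_eq_real_ivl)
    have nz: "z \<notin> \<real>\<^sub>\<le>\<^sub>0" using u x by auto
    show "((\<lambda>z. z powr (-s)) has_field_derivative - s * z powr (- s - 1)) (at z within ?S)"
      by (rule has_field_derivative_at_within) (use nz in \<open>auto intro!: derivative_eq_intros\<close>)
    have "norm (z powr (- s - 1)) = u powr (- (Re s + 1))"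
      using u x by (simp add: norm_powr_real_powr)
    also have "\<dots> \<le> x powr (- (Re s + 1))" using u x s by (intro powr_mono2') auto
    finally show "norm (- s * z powr (- s - 1)) \<le> norm s * x powr (- (Re s + 1))"
      by (simp add: norm_mult mult_left_mono)
  qed auto
  also have "norm (of_real y - of_real x :: complex) \<le> 1"
    using x by (simp flip: of_real_diff)
  then have "(norm s * x powr (- (Re s + 1))) * norm (of_real y - of_real x :: complex) \<le> norm s * x powr (- (Re s + 1))"
    by (intro mult_left_le) auto
  finally show ?thesis .
qed

lemma summable_Suc_powr_neg2: "summable (\<lambda>n. real (Suc n) powr -2)"
  by (subst summable_Suc_iff) (simp add: summable_real_powr_iff)

text \<open>Each term is compared with the integral of \<open>x powr -s\<close> over a unit
  interval. The integrals telescope to \<open>- h 1\<close>, which is the pole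
  \<open>1 / (s - 1)\<close>, and the differences are at most \<open>norm s * n powr -2\<close>
  throughout \<open>Re s > 1\<close>.\<close>

lemma zeta_series_bound:
  assumes s: "Re s > 1"
  shows "norm (\<Sum>n. of_nat (Suc n) powr (-s) :: complex) \<le> 1 / norm (s - 1) + norm s * (\<Sum>n. real (Suc n) powr -2)"
proof -
  define h where "h = (\<lambda>x::real. of_real x powr (1 - s) / (1 - s))"
  have s1: "s \<noteq> 1" using s by auto
  define e where "e = (\<lambda>n. of_nat (Suc n) powr (-s) - (h (real (Suc (Suc n))) - h (real (Suc n))))"
  have smz: "summable (\<lambda>n. of_nat (Suc n) powr (-s) :: complex)"
    using summable_powr_diff[of "\<lambda>_. 1" 1 s 0] s by (auto intro: summable_norm_cancel)
  have eb: "norm (e n) \<le> norm s * real (Suc n) powr -2" for n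
  proof -
    define x where "x = real (Suc n)"
    have x: "x \<ge> 1" by (simp add: x_def)
    let ?S = "closed_segment (of_real x) (of_real (x + 1) :: complex)"
    \<comment> \<open>The mean value estimate is applied to a function with derivative
      \<open>x powr -s - z powr -s\<close>; its increment over the interval is
      \<open>e n\<close>.\<close>
    have "norm ((of_real x powr (-s) * of_real x - of_real x powr (1 - s) / (1 - s)) -
        (of_real x powr (-s) * of_real (x + 1) - of_real (x + 1) powr (1 - s) / (1 - s)))
      \<le> (norm s * x powr (- (Re s + 1))) * norm (of_real x - of_real (x + 1) :: complex)"
    proof (rule field_differentiable_bound[where S = ?S and f = "\<lambda>z. of_real x powr (-s) * z - z powr (1 - s) / (1 - s)"
          and f' = "\<lambda>z. of_real x powr (-s) - z powr (-s)"])
      fix z assume "z \<in> ?S"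
      then obtain u where u: "z = of_real u" "x \<le> u" "u \<le> x + 1"
        unfolding closed_segment_of_real by (auto simp: closed_segment_eq_real_ivl)
      have nz: "z \<notin> \<real>\<^sub>\<le>\<^sub>0" using u x by auto
      show "((\<lambda>z. of_real x powr (-s) * z - z powr (1 - s) / (1 - s)) has_field_derivative
          of_real x powr (-s) - z powr (-s)) (at z within ?S)"
        by (rule has_field_derivative_at_within) (use nz s1 in \<open>auto intro!: derivative_eq_intros\<close>)
      show "norm (of_real x powr (-s) - z powr (-s)) \<le> norm s * x powr (- (Re s + 1))"
        using norm_powr_diff_unit_le[of x u s] u x s by (simp add: norm_minus_commute)
    qed auto
    also have "\<dots> = norm s * x powr (- (Re s + 1))" by simp
    also have "\<dots> \<le> norm s * x powr -2"
      using x s by (intro mult_left_mono powr_mono) auto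
    also have "(of_real x powr (-s) * of_real x - of_real x powr (1 - s) / (1 - s)) -
        (of_real x powr (-s) * of_real (x + 1) - of_real (x + 1) powr (1 - s) / (1 - s)) = - e n"
      unfolding e_def h_def x_def by (simp add: algebra_simps)
    finally show ?thesis by (simp add: x_def)
  qed
  note sm2 = summable_Suc_powr_neg2
  have sme: "summable e"
    by (rule summable_comparison_test'[OF summable_mult[OF sm2, of "norm s"]]) (rule eb)
  have "(\<lambda>n. norm (h (real (Suc n)))) \<longlonglongrightarrow> 0"
  proof -
    have "(\<lambda>n. real (Suc n) powr (1 - Re s)) \<longlonglongrightarrow> 0"
      by (rule tendsto_neg_powr[OF _ filterlim_compose[OF filterlim_real_sequentially filterlim_Suc]]) (use s in auto)
    then have "(\<lambda>n. real (Suc n) powr (1 - Re s) / norm (1 - s)) \<longlonglongrightarrow> 0"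
      by (rule tendsto_divide_zero)
    moreover have "norm (h (real (Suc n))) = real (Suc n) powr (1 - Re s) / norm (1 - s)" for n
      unfolding h_def norm_divide by (subst norm_powr_real_powr) auto
    ultimately show ?thesis by (simp only:)
  qed
  then have "(\<lambda>n. h (real (Suc n))) \<longlonglongrightarrow> 0" by (rule tendsto_norm_zero_cancel)
  from telescope_sums[OF this] have "(\<lambda>n. h (real (Suc (Suc n))) - h (real (Suc n))) sums (0 - h 1)"
    by simp
  then have "(\<lambda>n. e n + (h (real (Suc (Suc n))) - h (real (Suc n)))) sums (suminf e + (0 - h 1))"
    by (intro sums_add summable_sums sme)
  then have "(\<Sum>n. of_nat (Suc n) powr (-s) :: complex) = suminf e + (0 - h 1)"
    unfolding e_def by (simp add: sums_iff)
  moreover have "norm (h 1) = 1 / norm (s - 1)" by (simp add: h_def norm_divide norm_minus_commute)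
  moreover have "norm (suminf e) \<le> norm s * (\<Sum>n. real (Suc n) powr -2)"
    using norm_suminf_le[OF eb summable_mult[OF sm2]] suminf_mult[OF sm2, of "norm s"] by simp
  ultimately show ?thesis
    using norm_triangle_ineq4[of "suminf e" "h 1"] by simp
qed

text \<open>Write \<open>a = m + 2 c\<close> with \<open>m\<close> the mean. The constant part is a
  multiple of the zeta series, whose pole is avoided if \<open>t \<noteq> 0\<close> and absent if
  \<open>m = 0\<close>; the part \<open>c\<close> is periodic of mean zero, scaled so that its
  values stay in the unit disc.\<close>

lemma periodic_series_bounded_near_line:
  assumes q: "q > 0" and per: "\<And>n. a (n + q) = a n" and b: "\<And>n. norm (a n) \<le> 1"
    and nonpole: "t \<noteq> 0 \<or> (\<Sum>n<q. a n) = 0"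
  obtains B where "\<And>\<sigma>. 1 < \<sigma> \<Longrightarrow> \<sigma> \<le> 2 \<Longrightarrow> norm (\<Sum>n. a (Suc n) * of_nat (Suc n) powr (- Complex \<sigma> t)) \<le> B"
proof -
  define m where "m = (\<Sum>n<q. a n) / of_nat q"
  define c where "c = (\<lambda>n. (a n - m) / 2)"
  define Z where "Z = (\<Sum>n. real (Suc n) powr -2)"
  have nm: "norm m \<le> 1"
  proof -
    have "norm (\<Sum>n<q. a n) \<le> (\<Sum>n<q. 1)" by (rule sum_norm_le) (rule b)
    then show ?thesis using q by (simp add: m_def norm_divide)
  qed
  have nc: "norm (c n) \<le> 1" for n
    using norm_triangle_ineq4[of "a n" m] b[of n] nm by (simp add: c_def norm_divide)
  have mz: "mean_zero_periodic q c"
    using q per by (simp add: mean_zero_periodic_def c_def sum_subtractf m_def sum_divide_distrib[symmetric])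
  have Z0: "Z \<ge> 0" unfolding Z_def
    by (intro suminf_nonneg summable_Suc_powr_neg2) auto
  define R where "R = 2 + \<bar>t\<bar>"
  \<comment> \<open>For \<open>t = 0\<close> the quotient \<open>1 / \<bar>t\<bar>\<close> is 0,
    which is sound because then \<open>m = 0\<close>.\<close>
  define B where "B = norm m * (1 / \<bar>t\<bar> + R * Z) + 2 * (2 * real q * (1 + R * Z))"
  have "norm (\<Sum>n. a (Suc n) * of_nat (Suc n) powr (- Complex \<sigma> t)) \<le> B" if \<sigma>: "1 < \<sigma>" "\<sigma> \<le> 2" for \<sigma>
  proof -
    define s where "s = Complex \<sigma> t"
    have Re: "Re s > 1" using \<sigma> by (simp add: s_def)
    have ns: "norm s \<le> R" using cmod_le[of s] \<sigma> by (simp add: s_def R_def)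
    have sm: "summable (\<lambda>n. of_nat (Suc n) powr (-s) :: complex)"
      using summable_powr_diff[of "\<lambda>_. 1" 1 s 0] Re by (auto intro: summable_norm_cancel)
    have smc: "summable (\<lambda>n. c (Suc n) * of_nat (Suc n) powr (-s))"
      using summable_powr_diff[of c 1 s 0, OF nc] Re by (auto intro: summable_norm_cancel)
    have "(\<lambda>n. m * of_nat (Suc n) powr (-s) + 2 * (c (Suc n) * of_nat (Suc n) powr (-s))) sums
        (m * (\<Sum>n. of_nat (Suc n) powr (-s)) + 2 * (\<Sum>n. c (Suc n) * of_nat (Suc n) powr (-s)))"
      by (intro sums_add sums_mult summable_sums sm smc)
    moreover have "m * of_nat (Suc n) powr (-s) + 2 * (c (Suc n) * of_nat (Suc n) powr (-s)) = a (Suc n) * of_nat (Suc n) powr (-s)" for n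
      by (simp add: c_def field_simps)
    ultimately have eq: "(\<Sum>n. a (Suc n) * of_nat (Suc n) powr (-s)) =
        m * (\<Sum>n. of_nat (Suc n) powr (-s)) + 2 * (\<Sum>n. c (Suc n) * of_nat (Suc n) powr (-s))"
      by (simp add: sums_iff)
    have 1: "norm (m * (\<Sum>n. of_nat (Suc n) powr (-s))) \<le> norm m * (1 / \<bar>t\<bar> + R * Z)"
    proof (cases "t = 0")
      case True
      then have "m = 0" using nonpole by (simp add: m_def)
      then show ?thesis by simp
    next
      case False
      have "\<bar>t\<bar> \<le> norm (s - 1)" using abs_Im_le_cmod[of "s - 1"] by (simp add: s_def)
      then have "1 / norm (s - 1) \<le> 1 / \<bar>t\<bar>" using False by (intro divide_left_mono) (auto intro!: mult_pos_pos)
      moreover have "norm s * Z \<le> R * Z" using ns Z0 by (intro mult_right_mono)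
      ultimately have "norm (\<Sum>n. of_nat (Suc n) powr (-s) :: complex) \<le> 1 / \<bar>t\<bar> + R * Z"
        using zeta_series_bound[OF Re] unfolding Z_def by linarith
      then show ?thesis unfolding norm_mult by (intro mult_left_mono) auto
    qed
    have "norm (\<Sum>n. c (Suc n) * of_nat (Suc n) powr (-s)) \<le> 2 * real q * (1 + norm s * (\<Sum>n. real (Suc n) powr (- (1 + 1))))"
      by (rule periodic_series_bound[OF mz nc summable_sums[OF smc]]) (use Re in auto)
    also have "\<dots> = 2 * real q * (1 + norm s * Z)" by (simp add: Z_def)
    also have "\<dots> \<le> 2 * real q * (1 + R * Z)" using ns Z0 by (intro mult_left_mono add_left_mono mult_right_mono) auto
    finally have 2: "norm (2 * (\<Sum>n. c (Suc n) * of_nat (Suc n) powr (-s))) \<le> 2 * (2 * real q * (1 + R * Z))"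
      by (simp add: norm_mult)
    show ?thesis
      using norm_triangle_ineq[of "m * (\<Sum>n. of_nat (Suc n) powr (-s))" "2 * (\<Sum>n. c (Suc n) * of_nat (Suc n) powr (-s))"] 1 2
      unfolding s_def[symmetric] eq B_def by linarith
  qed
  then show ?thesis using that by blast
qed

text \<open>After taking logarithms this is
  \<open>3 + 4 cos u + cos 2u = 2 (1 + cos u)^2 \<ge> 0\<close>, applied term by term in the series
  of \<open>ln (norm (1 - x w))\<close> at \<open>w = 1\<close>, \<open>z\<close> and
  \<open>z\<^sup>2\<close>. The case \<open>z = 0\<close> is that of a prime dividing
  \<open>q\<close>.\<close>

lemma three_four_one_local:
  fixes z :: complex
  assumes x: "0 < x" "x < 1" and z: "norm z = 1 \<or> z = 0"
  shows "(1 - x) ^ 3 * norm (1 - of_real x * z) ^ 4 * norm (1 - of_real x * z\<^sup>2) \<le> 1"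
proof (cases "z = 0")
  case True
  then show ?thesis using x by (simp add: power_le_one)
next
  case False
  then have z: "norm z = 1" using z by blast
  have series: "(\<lambda>n. - (x ^ n * Re (w ^ n)) / n) sums ln (norm (1 - of_real x * w))" if w: "norm w = 1" for w
  proof -
    have lt: "norm (- (of_real x * w)) < 1" using x w by (simp add: norm_mult)
    have ne: "1 - of_real x * w \<noteq> 0" using lt by (auto simp: norm_mult) (metis norm_minus_cancel norm_one lt less_irrefl)
    have "(\<lambda>n. (-1) ^ Suc n / of_nat n * (- (of_real x * w)) ^ n) sums Ln (1 + - (of_real x * w))"
      by (rule Ln_series[OF lt])
    from sums_Re[OF this] have "(\<lambda>n. Re ((-1) ^ Suc n / of_nat n * (- (of_real x * w)) ^ n)) sums ln (norm (1 - of_real x * w))"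
      using ne by (simp add: Re_Ln)
    moreover have "Re ((-1) ^ Suc n / of_nat n * (- (of_real x * w)) ^ n) = - (x ^ n * Re (w ^ n)) / n" for n
    proof -
      have Re: "Re (- (of_real y * v) / of_nat n) = - (y * Re v) / n" for y v
        by (simp add: Re_divide_of_nat)
      have neg: "(-1) ^ Suc n / of_nat n * (- u) ^ n = - (u ^ n) / of_nat n" for u :: complex
        by (cases "even n") (auto simp: uminus_power_if)
      have "(-1) ^ Suc n / of_nat n * (- (of_real x * w)) ^ n = - (of_real (x ^ n) * w ^ n) / (of_nat n :: complex)"
        unfolding neg by (simp add: power_mult_distrib)
      also have "Re \<dots> = - (x ^ n * Re (w ^ n)) / n" by (rule Re)
      finally show ?thesis .
    qed
    ultimately show ?thesis by (simp only:)
  qed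
  have sm: "(\<lambda>n. 3 * (- (x ^ n * Re (1 ^ n)) / n) + 4 * (- (x ^ n * Re (z ^ n)) / n) + - (x ^ n * Re ((z\<^sup>2) ^ n)) / n) sums
      (3 * ln (norm (1 - of_real x * (1::complex))) + 4 * ln (norm (1 - of_real x * z)) + ln (norm (1 - of_real x * z\<^sup>2)))"
    by (intro sums_add sums_mult series) (use z in \<open>auto simp: norm_power\<close>)
  have nonpos: "3 * (- (x ^ n * Re (1 ^ n)) / n) + 4 * (- (x ^ n * Re (z ^ n)) / n) + - (x ^ n * Re ((z\<^sup>2) ^ n)) / n \<le> 0" for n
  proof -
    define u where "u = z ^ n"
    have "norm u = 1" using z by (simp add: u_def norm_power)
    then have "(Re u)\<^sup>2 + (Im u)\<^sup>2 = 1" using cmod_power2[of u] by simp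
    then have id: "3 + 4 * Re u + Re (u\<^sup>2) = 2 * (1 + Re u)\<^sup>2"
      by (simp add: power2_eq_square algebra_simps)
    have u2: "(z\<^sup>2) ^ n = u\<^sup>2" by (simp add: u_def power_mult[symmetric] mult.commute)
    have "3 * (- (y * Re (1 ^ n)) / n) + 4 * (- (y * a) / n) + - (y * b) / n = - (y / n * (3 + 4 * a + b))" for y a b
      by (cases "n = 0") (simp_all add: field_simps)
    then have "3 * (- (x ^ n * Re (1 ^ n)) / n) + 4 * (- (x ^ n * Re (z ^ n)) / n) + - (x ^ n * Re ((z\<^sup>2) ^ n)) / n
        = - (x ^ n / n * (2 * (1 + Re u)\<^sup>2))"
      unfolding u_def[symmetric] u2 id[symmetric] .
    moreover have "x ^ n / n * (2 * (1 + Re u)\<^sup>2) \<ge> 0" using x by simp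
    ultimately show ?thesis by linarith
  qed
  have le: "3 * ln (norm (1 - of_real x * (1::complex))) + 4 * ln (norm (1 - of_real x * z)) + ln (norm (1 - of_real x * z\<^sup>2)) \<le> 0"
    by (rule sums_le[OF nonpos sm sums_zero])
  have pos: "norm (1 - of_real x * w) > 0" if "norm w = 1" for w :: complex
  proof -
    have "norm (of_real x * w) < 1" using x that by (simp add: norm_mult)
    then show ?thesis by (metis eq_iff_diff_eq_0 less_irrefl norm_one zero_less_norm_iff)
  qed
  have "1 - of_real x * (1::complex) = of_real (1 - x)" by simp
  then have n1: "norm (1 - of_real x * (1::complex)) = 1 - x" using x by (simp only: norm_of_real)
  define a b c where "a = 1 - x" and "b = norm (1 - of_real x * z)" and "c = norm (1 - of_real x * z\<^sup>2)"
  have abc: "a > 0" "b > 0" "c > 0"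
    using x pos[OF z] pos[of "z\<^sup>2"] z by (auto simp: a_def b_def c_def norm_power)
  have "ln (a ^ 3 * b ^ 4 * c) = 3 * ln a + 4 * ln b + ln c"
    using abc by (simp add: ln_mult ln_realpow)
  also have "\<dots> \<le> 0" using le unfolding n1 a_def b_def c_def .
  finally have "ln (a ^ 3 * b ^ 4 * c) \<le> 0" .
  moreover have "a ^ 3 * b ^ 4 * c > 0" using abc by simp
  ultimately have "a ^ 3 * b ^ 4 * c \<le> 1" by (metis ln_le_zero_iff)
  then show ?thesis by (simp only: a_def b_def c_def)
qed

text \<open>The local inequality at \<open>x = p powr -\<sigma>\<close> and
  \<open>z = chi p * p powr (-i t)\<close>, read for the reciprocals, says that every Euler factor
  of the product on the right is at least 1.\<close>

lemma three_four_one: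
  assumes d: "dirichlet_char q chi" and \<sigma>: "\<sigma> > 1"
  shows "1 \<le> norm (\<Sum>n. of_nat n powr (- of_real \<sigma>) :: complex) ^ 3
      * norm (\<Sum>n. chi n * of_nat n powr (- Complex \<sigma> t)) ^ 4
      * norm (\<Sum>n. (chi n)\<^sup>2 * of_nat n powr (- Complex \<sigma> (2 * t)))"
proof -
  define f1 where "f1 = (\<lambda>n::nat. of_nat n powr (- of_real \<sigma>) :: complex)"
  define f2 where "f2 = (\<lambda>n::nat. chi n * of_nat n powr (- Complex \<sigma> t))"
  define f3 where "f3 = (\<lambda>n::nat. (chi n)\<^sup>2 * of_nat n powr (- Complex \<sigma> (2 * t)))"
  have npow: "norm (of_nat n powr s :: complex) = real n powr Re s" for n s
    by (simp add: norm_of_nat_powr)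
  have chi1: "norm (chi n) \<le> 1" for n by (rule norm_dirichlet_char_le[OF d])
  have sm: "summable (\<lambda>n. real n powr - \<sigma>)" using \<sigma> by (simp add: summable_real_powr_iff)
  have le: "norm (f1 n) \<le> real n powr -\<sigma>" "norm (f2 n) \<le> real n powr -\<sigma>" "norm (f3 n) \<le> real n powr -\<sigma>" for n
    using chi1[of n] by (auto simp: f1_def f2_def f3_def npow norm_mult norm_power power_le_one intro!: mult_left_le_one_le)
  have prime_lt: "real p powr -\<sigma> < 1" if "prime p" for p
    using prime_gt_1_nat[OF that] \<sigma> by (simp add: powr_less_one)
  have summ: "summable (\<lambda>n. norm (f1 n))" "summable (\<lambda>n. norm (f2 n))" "summable (\<lambda>n. norm (f3 n))"
    using le by (auto intro!: summable_comparison_test'[OF sm])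
  have lim1: "(\<lambda>N. \<Prod>p | prime p \<and> p \<le> N. 1 / (1 - f1 p)) \<longlonglongrightarrow> (\<Sum>n. f1 n)"
    by (rule euler_product_completely_multiplicative[OF _ _ _ summ(1)])
      (use le(1) prime_lt in \<open>auto simp: f1_def of_nat_mult_powr simp del: of_nat_mult intro: le_less_trans\<close>)
  have lim2: "(\<lambda>N. \<Prod>p | prime p \<and> p \<le> N. 1 / (1 - f2 p)) \<longlonglongrightarrow> (\<Sum>n. f2 n)"
    by (rule euler_product_completely_multiplicative[OF _ _ _ summ(2)])
      (use le(2) prime_lt dirichlet_char_1[OF d] in \<open>auto simp: f2_def of_nat_mult_powr dirichlet_char_mult[OF d] simp del: of_nat_mult intro: le_less_trans\<close>)
  have lim3: "(\<lambda>N. \<Prod>p | prime p \<and> p \<le> N. 1 / (1 - f3 p)) \<longlonglongrightarrow> (\<Sum>n. f3 n)"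
    by (rule euler_product_completely_multiplicative[OF _ _ _ summ(3)])
      (use le(3) prime_lt dirichlet_char_1[OF d] in \<open>auto simp: f3_def of_nat_mult_powr dirichlet_char_mult[OF d] power_mult_distrib simp del: of_nat_mult intro: le_less_trans\<close>)
  define P where "P = (\<lambda>N. norm (\<Prod>p | prime p \<and> p \<le> N. 1 / (1 - f1 p)) ^ 3 * norm (\<Prod>p | prime p \<and> p \<le> N. 1 / (1 - f2 p)) ^ 4
      * norm (\<Prod>p | prime p \<and> p \<le> N. 1 / (1 - f3 p)))"
  have "P \<longlonglongrightarrow> norm (\<Sum>n. f1 n) ^ 3 * norm (\<Sum>n. f2 n) ^ 4 * norm (\<Sum>n. f3 n)"
    unfolding P_def by (intro tendsto_intros lim1 lim2 lim3)
  moreover have "1 \<le> P N" for N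
  proof -
    have "1 \<le> norm (1 / (1 - f1 p)) ^ 3 * norm (1 / (1 - f2 p)) ^ 4 * norm (1 / (1 - f3 p))" if p: "prime p" for p
    proof -
      define x where "x = real p powr -\<sigma>"
      define z where "z = chi p * of_nat p powr (- Complex 0 t)"
      have p0: "p > 0" using prime_gt_0_nat[OF p] .
      have x: "0 < x" "x < 1" using p0 prime_lt[OF p] by (auto simp: x_def)
      have xe: "of_real x = (of_nat p powr (- of_real \<sigma>) :: complex)"
        using p0 powr_of_real[of "real p" "- \<sigma>"] by (simp add: x_def)
      have z: "norm z = 1 \<or> z = 0"
        using norm_dirichlet_char[OF d, of p] dirichlet_char_eq_0_iff[OF d, of p] p0
        by (cases "coprime p q") (auto simp: z_def norm_mult npow)
      have C1: "- Complex \<sigma> t = - of_real \<sigma> + - Complex 0 t" by (simp add: complex_eq_iff)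
      have C2: "- Complex \<sigma> (2 * t) = - of_real \<sigma> + (- Complex 0 t + - Complex 0 t)" by (simp add: complex_eq_iff)
      have e1: "f1 p = of_real x" by (simp add: f1_def xe)
      have e2: "f2 p = of_real x * z" unfolding f2_def z_def xe C1 powr_add by (simp add: mult_ac)
      have e3: "f3 p = of_real x * z\<^sup>2" unfolding f3_def z_def xe C2 powr_add by (simp add: power2_eq_square mult_ac)
      have "(1 - x) ^ 3 * norm (1 - of_real x * z) ^ 4 * norm (1 - of_real x * z\<^sup>2) \<le> 1"
        by (rule three_four_one_local[OF x z])
      moreover have "1 - f1 p = of_real (1 - x)" by (simp add: e1)
      then have "1 - x = norm (1 - f1 p)" using x by (simp only: norm_of_real)
      ultimately have le1: "norm (1 - f1 p) ^ 3 * norm (1 - f2 p) ^ 4 * norm (1 - f3 p) \<le> 1"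
        unfolding e2 e3 by simp
      have "norm (f1 p) < 1" "norm (f2 p) < 1" "norm (f3 p) < 1"
        using le[of p] prime_lt[OF p] by linarith+
      then have "1 - f1 p \<noteq> 0" "1 - f2 p \<noteq> 0" "1 - f3 p \<noteq> 0" by auto
      then have pos: "norm (1 - f1 p) ^ 3 * norm (1 - f2 p) ^ 4 * norm (1 - f3 p) > 0" by auto
      have "1 \<le> 1 / (norm (1 - f1 p) ^ 3 * norm (1 - f2 p) ^ 4 * norm (1 - f3 p))"
        using le1 pos by (subst le_divide_eq_1_pos) auto
      then show ?thesis by (simp add: norm_divide power_divide)
    qed
    then have "1 \<le> (\<Prod>p | prime p \<and> p \<le> N. norm (1 / (1 - f1 p)) ^ 3 * norm (1 / (1 - f2 p)) ^ 4 * norm (1 / (1 - f3 p)))"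
      by (intro prod_ge_1) auto
    then show ?thesis
      unfolding P_def prod_norm[symmetric] prod_power_distrib prod.distrib[symmetric] .
  qed
  ultimately show ?thesis
    unfolding f1_def f2_def f3_def by (intro LIMSEQ_le_const) auto
qed

text \<open>Summability is not assumed: if \<open>f\<close> diverges, both sides are
  \<open>THE\<close> of the same unsatisfiable predicate and hence equal.\<close>

lemma suminf_zero_term:
  fixes f :: "nat \<Rightarrow> complex"
  assumes "f 0 = 0"
  shows "(\<Sum>n. f (Suc n)) = (\<Sum>n. f n)"
proof (cases "summable f")
  case True
  then show ?thesis using suminf_split_head[OF True] assms by simp
next
  case False
  then have "\<not> summable (\<lambda>n. f (Suc n))" by (simp add: summable_Suc_iff)
  then show ?thesis using False by (simp add: suminf_def summable_def)
qed

text \<open>A zero at \<open>1 + i t\<close> would make the three factors at abscissa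
  \<open>1 + h\<close> of size \<open>h^-3\<close>, \<open>h^4\<close> and bounded, so their product
  would be \<open>O (h)\<close> and could not stay at least 1. The excluded case is
  \<open>t = 0\<close> with \<open>chi^2\<close> principal, where the third factor has a
  pole.\<close>

lemma L_nonzero_on_line:
  assumes d: "dirichlet_char q chi" and F: "F holomorphic_on UNIV"
    and FS: "\<And>s. Re s > 1 \<Longrightarrow> F s = (\<Sum>n. chi (Suc n) * of_nat (Suc n) powr (-s))"
    and nonpole: "t \<noteq> 0 \<or> (\<Sum>n<q. (chi n)\<^sup>2) = 0"
  shows "F (Complex 1 t) \<noteq> 0"
proof
  assume zero: "F (Complex 1 t) = 0"
  have q: "q > 0" using d by (simp add: dirichlet_char_def)
  define Z where "Z = (\<Sum>n. real (Suc n) powr -2)"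
  have Z0: "Z \<ge> 0" unfolding Z_def by (intro suminf_nonneg summable_Suc_powr_neg2) auto
  obtain B where B: "\<And>\<sigma>. 1 < \<sigma> \<Longrightarrow> \<sigma> \<le> 2 \<Longrightarrow>
      norm (\<Sum>n. (chi (Suc n))\<^sup>2 * of_nat (Suc n) powr (- Complex \<sigma> (2 * t))) \<le> B"
  proof (rule periodic_series_bounded_near_line[of q "\<lambda>n. (chi n)\<^sup>2" "2 * t"])
    show "(chi (n + q))\<^sup>2 = (chi n)\<^sup>2" for n using d by (simp add: dirichlet_char_def)
    show "norm ((chi n)\<^sup>2) \<le> 1" for n using norm_dirichlet_char_le[OF d, of n] by (simp add: norm_power power_le_one)
  qed (use q nonpole in auto)
  obtain D where D: "(F has_field_derivative D) (at (Complex 1 t))"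
    using F by (metis UNIV_I holomorphic_on_open open_UNIV)
  define M where "M = norm D + 1"
  \<comment> \<open>As \<open>F\<close> vanishes at the point, the difference quotient is
    \<open>F / h\<close> itself, so \<open>F\<close> is at most \<open>M * norm h\<close>
    nearby.\<close>
  have "((\<lambda>h. (F (Complex 1 t + h) - F (Complex 1 t)) / h) \<longlongrightarrow> D) (at 0)"
    using D by (simp add: DERIV_def)
  then have "\<forall>\<^sub>F h in at 0. norm (F (Complex 1 t + h) / h) < M"
    using zero tendsto_norm[of _ D] by (intro order_tendstoD(2)[of _ "norm D"]) (auto simp: M_def)
  then obtain \<delta> where \<delta>: "\<delta> > 0" "\<And>h. h \<noteq> 0 \<Longrightarrow> norm h < \<delta> \<Longrightarrow> norm (F (Complex 1 t + h) / h) < M"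
    unfolding eventually_at by (auto simp: dist_norm)
  have M0: "M > 0" by (simp add: M_def add_nonneg_pos)
  define K where "K = (1 + 2 * Z) ^ 3 * M ^ 4 * B"
  have key: "1 \<le> K * h" if h: "0 < h" "h < \<delta>" "h \<le> 1" for h
  proof -
    have "1 \<le> norm (\<Sum>n. of_nat n powr (- of_real (1 + h)) :: complex) ^ 3
      * norm (\<Sum>n. chi n * of_nat n powr (- Complex (1 + h) t)) ^ 4
      * norm (\<Sum>n. (chi n)\<^sup>2 * of_nat n powr (- Complex (1 + h) (2 * t)))"
      by (rule three_four_one[OF d]) (use h in auto)
    also have "\<dots> \<le> ((1 + 2 * Z) / h) ^ 3 * (M * h) ^ 4 * B"
    proof (intro mult_mono power_mono)
      have "(\<Sum>n. of_nat n powr (- of_real (1 + h)) :: complex) = (\<Sum>n. of_nat (Suc n) powr (- of_real (1 + h)))"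
        using suminf_zero_term[of "\<lambda>n. of_nat n powr (- of_real (1 + h)) :: complex"] by simp
      moreover have "norm (\<Sum>n. of_nat (Suc n) powr (- of_real (1 + h)) :: complex)
          \<le> 1 / norm (complex_of_real (1 + h) - 1) + norm (complex_of_real (1 + h)) * Z"
        unfolding Z_def by (rule zeta_series_bound) (use h in auto)
      moreover have "norm (complex_of_real (1 + h) - 1) = h" using h by simp
      moreover have "norm (complex_of_real (1 + h)) = 1 + h" using h by (simp only: norm_of_real)
      ultimately have "norm (\<Sum>n. of_nat n powr (- of_real (1 + h)) :: complex) \<le> 1 / h + (1 + h) * Z" by simp
      also have "(1 + h) * Z \<le> (2 * Z) / h"
      proof -
        have "(1 + h) * h \<le> 2 * 1" using h by (intro mult_mono) auto
        then have "(1 + h) * h * Z \<le> 2 * Z" using Z0 by (intro mult_right_mono) auto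
        then show ?thesis using h by (simp add: field_simps)
      qed
      finally show "norm (\<Sum>n. of_nat n powr (- of_real (1 + h)) :: complex) \<le> (1 + 2 * Z) / h"
        by (simp add: add_divide_distrib)
      have "(\<Sum>n. chi n * of_nat n powr (- Complex (1 + h) t)) = F (Complex (1 + h) t)"
        using FS[of "Complex (1 + h) t"] suminf_zero_term[of "\<lambda>n. chi n * of_nat n powr (- Complex (1 + h) t)"] h by simp
      moreover have "Complex (1 + h) t = Complex 1 t + of_real h" by (simp add: complex_eq_iff)
      moreover have "norm (F (Complex 1 t + of_real h) / of_real h) < M" using \<delta>(2)[of "of_real h"] h by simp
      ultimately show "norm (\<Sum>n. chi n * of_nat n powr (- Complex (1 + h) t)) \<le> M * h"
        using h by (simp add: norm_divide field_simps)
      show "norm (\<Sum>n. (chi n)\<^sup>2 * of_nat n powr (- Complex (1 + h) (2 * t))) \<le> B"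
        using B[of "1 + h"] suminf_zero_term[of "\<lambda>n. (chi n)\<^sup>2 * of_nat n powr (- Complex (1 + h) (2 * t))"] h by simp
    qed (use M0 Z0 h in auto)
    also have "\<dots> = K * h" using h by (simp add: K_def field_simps power_divide power_mult_distrib eval_nat_numeral)
    finally show ?thesis .
  qed
  \<comment> \<open>The last bound gives \<open>\<bar>K\<bar> * h < 1\<close>, contradicting
    \<open>key\<close>.\<close>
  define h where "h = min (min (\<delta> / 2) 1) (1 / (2 * (\<bar>K\<bar> + 1)))"
  have h: "0 < h" "h < \<delta>" "h \<le> 1" "h \<le> 1 / (2 * (\<bar>K\<bar> + 1))" using \<delta>(1) by (auto simp: h_def)
  have "K * h \<le> \<bar>K\<bar> * (1 / (2 * (\<bar>K\<bar> + 1)))" using h by (intro mult_mono) auto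
  also have "\<dots> < 1" by (simp add: field_simps)
  finally show False using key[OF h(1-3)] by simp
qed

section \<open>Real characters at s = 1: divisor sums and Lambert series\<close>

lemma divisor_sum_nonneg:
  fixes c :: "nat \<Rightarrow> real"
  assumes c1: "c 1 = 1" and cm: "\<And>m n. c (m * n) = c m * c n" and cv: "\<And>n. c n \<in> {-1, 0, 1}"
  shows "n > 0 \<Longrightarrow> (\<Sum>d | d dvd n. c d) \<ge> 0 \<and> ((\<forall>p. prime p \<longrightarrow> even (multiplicity p n)) \<longrightarrow> (\<Sum>d | d dvd n. c d) \<ge> 1)"
proof (induction n rule: less_induct)
  case (less n)
  have cp: "c (m ^ i) = c m ^ i" for m i using c1 by (induction i) (auto simp: cm)
  show ?case
  proof (cases "n = 1")
    case True
    then show ?thesis using c1 by simp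
  next
    case False
    then obtain p where p: "prime p" "p dvd n" using prime_factor_nat by blast
    define j where "j = multiplicity p n"
    define m where "m = n div p ^ j"
    have nm: "n = p ^ j * m" by (simp add: j_def m_def multiplicity_dvd)
    have m0: "m > 0" using nm less.prems by (metis gr0I mult_0_right)
    have pm: "\<not> p dvd m"
      using multiplicity_decompose[of n p] less.prems p(1) not_prime_unit[of p] unfolding m_def j_def by blast
    have "j > 0" using p less.prems unfolding j_def by (simp add: prime_multiplicity_gt_zero_iff)
    then have "p ^ j > 1" using one_less_power[OF prime_gt_1_nat[OF p(1)]] by simp
    then have "m < n" using nm m0 by simp
    note IH = less.IH[OF this m0]
    have sub: "prime_factors d \<subseteq> prime_factors m \<and> d > 0" if "d dvd m" for d
      using dvd_prime_factors[of m d] that m0 by (auto intro: dvd_pos_nat)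
    have "p \<notin> prime_factors m" using pm by (auto simp: in_prime_factors_iff)
    then have inj0: "inj_on (\<lambda>(i, d). p ^ i * d) (UNIV \<times> {d. d > 0 \<and> prime_factors d \<subseteq> prime_factors m})"
      using bij_betw_imp_inj_on[OF bij_betw_prime_power_times[OF p(1)]] by blast
    have inj: "inj_on (\<lambda>(i, d). p ^ i * d) ({..j} \<times> {d. d dvd m})"
      by (rule inj_on_subset[OF inj0]) (use sub in auto)
    have img: "{d. d dvd n} = (\<lambda>(i, d). p ^ i * d) ` ({..j} \<times> {d. d dvd m})"
    proof (intro equalityI subsetI)
      fix d assume "d \<in> {d. d dvd n}"
      then have "d dvd p ^ j * m" using nm by simp
      then obtain a b where ab: "d = a * b" "a dvd p ^ j" "b dvd m" using division_decomp by blast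
      then obtain i where "i \<le> j" "a = p ^ i" using p(1) divides_primepow_nat by blast
      then show "d \<in> (\<lambda>(i, d). p ^ i * d) ` ({..j} \<times> {d. d dvd m})" using ab by force
    qed (use nm in \<open>auto intro: mult_dvd_mono le_imp_power_dvd\<close>)
    have "(\<Sum>d | d dvd n. c d) = (\<Sum>(i, d)\<in>{..j} \<times> {d. d dvd m}. c (p ^ i * d))"
      unfolding img by (subst sum.reindex[OF inj]) (auto simp: case_prod_unfold o_def)
    also have "\<dots> = (\<Sum>i\<le>j. c p ^ i) * (\<Sum>d | d dvd m. c d)"
      by (simp add: sum.cartesian_product[symmetric] cm cp sum_product)
    finally have eq: "(\<Sum>d | d dvd n. c d) = (\<Sum>i\<le>j. c p ^ i) * (\<Sum>d | d dvd m. c d)" .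
    \<comment> \<open>The geometric sum is \<open>j + 1\<close>, 1, or alternates between 1 and 0
      according as \<open>c p\<close> is 1, 0 or -1; it can vanish only for odd
      \<open>j\<close>.\<close>
    have loc: "(\<Sum>i\<le>j. c p ^ i) \<ge> 0 \<and> (even j \<longrightarrow> (\<Sum>i\<le>j. c p ^ i) \<ge> 1)"
    proof -
      consider "c p = -1" | "c p = 0" | "c p = 1" using cv[of p] by blast
      then show ?thesis
      proof cases
        case 1
        have "(\<Sum>i\<le>j. (-1::real) ^ i) = (if even j then 1 else 0)" by (induction j) auto
        then show ?thesis using 1 by simp
      next
        case 2
        have "(\<Sum>i\<le>j. (0::real) ^ i) = 1" by (induction j) auto
        then show ?thesis using 2 by simp
      qed auto
    qed
    show ?thesis
    proof (intro conjI impI)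
      show "(\<Sum>d | d dvd n. c d) \<ge> 0" unfolding eq using IH loc by simp
      assume ev: "\<forall>r. prime r \<longrightarrow> even (multiplicity r n)"
      have "even (multiplicity r m)" if r: "prime r" for r
      proof (cases "r = p")
        case True
        then show ?thesis using pm by (simp add: not_dvd_imp_multiplicity_0)
      next
        case False
        then have "\<not> r dvd p ^ j" using r p(1) by (metis prime_dvd_power primes_dvd_imp_eq)
        then have "multiplicity r n = multiplicity r m"
          unfolding nm using r m0 p(1)
          by (subst prime_elem_multiplicity_mult_distrib) (auto simp: not_dvd_imp_multiplicity_0)
        then show ?thesis using ev r by metis
      qed
      then have "(\<Sum>d | d dvd m. c d) \<ge> 1" using IH by blast
      moreover have "(\<Sum>i\<le>j. c p ^ i) \<ge> 1" using loc ev p(1) by (simp add: j_def)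
      ultimately show "(\<Sum>d | d dvd n. c d) \<ge> 1" unfolding eq using mult_mono[of 1 "(\<Sum>i\<le>j. c p ^ i)" 1 "\<Sum>d | d dvd m. c d"] by simp
    qed
  qed
qed

lemma abel_bound:
  fixes a b :: "nat \<Rightarrow> real"
  assumes K: "\<And>n. \<bar>\<Sum>i<n. a i\<bar> \<le> K" and dec: "\<And>n. b (Suc n) \<le> b n" and b: "\<And>n. b n \<ge> 0"
  shows "\<bar>\<Sum>i<n. a i * b i\<bar> \<le> K * b 0"
proof -
  define S where "S = (\<lambda>n. \<Sum>i<n. a i)"
  have eq: "(\<Sum>i<n. a i * b i) = (\<Sum>i<n. S (Suc i) * (b i - b (Suc i))) + S n * b n" for n
    by (induction n) (auto simp: S_def algebra_simps)
  have SK: "\<bar>S n\<bar> \<le> K" for n using K[of n] by (simp add: S_def)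
  have "\<bar>S (Suc i) * (b i - b (Suc i))\<bar> \<le> K * (b i - b (Suc i))" for i
    using mult_right_mono[OF SK[of "Suc i"], of "b i - b (Suc i)"] dec[of i] by (simp add: abs_mult)
  then have "\<bar>\<Sum>i<n. S (Suc i) * (b i - b (Suc i))\<bar> \<le> (\<Sum>i<n. K * (b i - b (Suc i)))"
    by (intro order_trans[OF sum_abs] sum_mono)
  also have "\<dots> = K * (b 0 - b n)"
    by (induction n) (auto simp: algebra_simps)
  finally have "\<bar>\<Sum>i<n. S (Suc i) * (b i - b (Suc i))\<bar> \<le> K * (b 0 - b n)" .
  moreover have "\<bar>S n * b n\<bar> \<le> K * b n" using mult_right_mono[OF SK[of n] b[of n]] b[of n] by (simp add: abs_mult)
  ultimately show ?thesis unfolding eq by (simp add: algebra_simps)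
qed

text \<open>The inequality between arithmetic and geometric mean for
  \<open>y, y^3, ..., y^(2n-1)\<close>, whose exponents average to \<open>n\<close>. The induction
  goes in steps of two, each adding the outermost pair
  \<open>y + y^(2n+3) \<ge> 2 y^(n+2)\<close>.\<close>

lemma geometric_partial_sum_ge:
  fixes y :: real
  assumes "0 \<le> y" "y \<le> 1"
  shows "real n * y ^ n \<le> y * (\<Sum>i<n. (y\<^sup>2) ^ i)"
proof (induction n rule: induct_nat_012)
  case (ge2 n)
  have "(\<Sum>i<Suc (Suc n). (y\<^sup>2) ^ i) = 1 + y\<^sup>2 * (\<Sum>i<n. (y\<^sup>2) ^ i) + (y\<^sup>2) ^ Suc n"
    by (subst sum.lessThan_Suc_shift) (simp add: sum_distrib_left)
  then have "y * (\<Sum>i<Suc (Suc n). (y\<^sup>2) ^ i) = y\<^sup>2 * (y * (\<Sum>i<n. (y\<^sup>2) ^ i)) + y * (1 + (y ^ Suc n)\<^sup>2)"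
    by (simp add: algebra_simps power_mult[symmetric] mult.commute)
  moreover have "y\<^sup>2 * (real n * y ^ n) \<le> y\<^sup>2 * (y * (\<Sum>i<n. (y\<^sup>2) ^ i))"
    by (intro mult_left_mono ge2(1)) auto
  moreover have "y * (2 * y ^ Suc n) \<le> y * (1 + (y ^ Suc n)\<^sup>2)"
    using sum_squares_bound[of 1 "y ^ Suc n"] assms by (intro mult_left_mono) auto
  ultimately show ?case by (simp add: algebra_simps power2_eq_square)
qed (use assms in auto)

text \<open>With \<open>S n = 1 + ... + x^(n-1)\<close> one has
  \<open>1 - x^n = (1 - x) S n\<close>, and the difference
  \<open>x^n / S n - x^(n+1) / S (n+1)\<close> collapses to \<open>x^n / (S n S (n+1))\<close>. So
  monotonicity amounts to \<open>n (n+1) x^n \<le> S n S (n+1)\<close>, which follows from the mean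
  inequality at \<open>y = sqrt x\<close> applied to both factors.\<close>

lemma lambert_coeff_antimono:
  fixes x :: real
  assumes x: "0 < x" "x < 1" and n: "n > 0"
  shows "1 / (real (Suc n) * (1 - x)) - x ^ Suc n / (1 - x ^ Suc n) \<le> 1 / (real n * (1 - x)) - x ^ n / (1 - x ^ n)"
    and "0 \<le> 1 / (real n * (1 - x)) - x ^ n / (1 - x ^ n)"
proof -
  define S where "S = (\<lambda>n. \<Sum>i<n. x ^ i)"
  have geo: "1 - x ^ n = (1 - x) * S n" for n by (simp add: S_def one_diff_power_eq)
  have Spos: "S n > 0" if "n > 0" for n
    using geo[of n] x that by (metis diff_gt_0_iff_gt power_Suc_less_one gr0_conv_Suc zero_less_mult_pos)
  have S1: "S (Suc n) = 1 + x * S n" for n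
    by (simp add: S_def sum.lessThan_Suc_shift sum_distrib_left del: sum.lessThan_Suc)
  have Sn: "real n * x ^ n \<le> S n" for n
  proof -
    have "(\<Sum>i<n. x ^ n) \<le> S n" unfolding S_def
      by (intro sum_mono power_decreasing) (use x in auto)
    then show ?thesis by simp
  qed
  define y where "y = sqrt x"
  have y: "0 < y" "y \<le> 1" "y\<^sup>2 = x" using x by (auto simp: y_def real_le_lsqrt)
  have g: "real n * y ^ n \<le> y * S n" for n
    using geometric_partial_sum_ge[of y n] y(1,2) unfolding S_def y(3) by simp
  \<comment> \<open>The left side carries \<open>y^(2n+1) = y x^n\<close>; inserting another factor
    \<open>y \<le> 1\<close> gives \<open>y\<^sup>2\<close> on both sides, which cancels.\<close>
  have "real n * y ^ n * (real (Suc n) * y ^ Suc n) \<le> (y * S n) * (y * S (Suc n))"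
    by (rule mult_mono[OF g g]) (use y Spos[OF n] in auto)
  then have a: "real n * real (Suc n) * (y ^ n * y ^ Suc n) \<le> (S n * S (Suc n)) * y\<^sup>2"
    by (simp only: mult_ac power2_eq_square)
  have b: "y ^ n * y ^ Suc n = y * x ^ n"
    unfolding y(3)[symmetric] by (simp add: power_mult[symmetric] power_add[symmetric] mult.commute mult_2_right)
  have "y * (y * x ^ n) \<le> y * x ^ n" using y x by (intro mult_left_mono) (auto intro: mult_left_le_one_le)
  then have c: "real n * real (Suc n) * (y * (y * x ^ n)) \<le> real n * real (Suc n) * (y * x ^ n)"
    by (rule mult_left_mono) simp
  have "(real n * real (Suc n) * x ^ n) * y\<^sup>2 = real n * real (Suc n) * (y * (y * x ^ n))"
    by (simp only: mult_ac power2_eq_square)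
  also note c
  also note b[symmetric]
  also note a
  finally have "(real n * real (Suc n) * x ^ n) * y\<^sup>2 \<le> (S n * S (Suc n)) * y\<^sup>2" .
  then have key: "real n * real (Suc n) * x ^ n \<le> S n * S (Suc n)" using y x by simp
  have pos: "S n > 0" "S (Suc n) > 0" "real n > 0" using Spos n by auto
  have "x ^ n / S n - x ^ Suc n / S (Suc n) = x ^ n / (S n * S (Suc n))"
    using pos S1[of n] by (simp add: field_simps)
  also have "\<dots> \<le> 1 / (real n * real (Suc n))"
  proof -
    have "a / b \<le> 1 / c" if "c * a \<le> b" "b > 0" "c > 0" for a b c :: real
      using that by (simp add: field_simps)
    from this[OF key] show ?thesis using pos by simp
  qed
  also have "\<dots> = 1 / real n - 1 / real (Suc n)" using pos by (simp add: field_simps)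
  finally have "1 / real (Suc n) - x ^ Suc n / S (Suc n) \<le> 1 / real n - x ^ n / S n" by simp
  then have "(1 / real (Suc n) - x ^ Suc n / S (Suc n)) / (1 - x) \<le> (1 / real n - x ^ n / S n) / (1 - x)"
    using x by (intro divide_right_mono) auto
  then show "1 / (real (Suc n) * (1 - x)) - x ^ Suc n / (1 - x ^ Suc n) \<le> 1 / (real n * (1 - x)) - x ^ n / (1 - x ^ n)"
    unfolding geo by (simp add: diff_divide_distrib mult.commute)
  have "x ^ n / S n \<le> 1 / real n" using Sn[of n] pos by (simp add: field_simps)
  then have "0 \<le> (1 / real n - x ^ n / S n) / (1 - x)" using x by simp
  then show "0 \<le> 1 / (real n * (1 - x)) - x ^ n / (1 - x ^ n)"
    unfolding geo by (simp add: diff_divide_distrib mult.commute)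
qed

lemma range_Suc_eq: "range Suc = {1..}"
  unfolding atLeast_Suc_greaterThan One_nat_def greaterThan_0 ..

text \<open>Expanding each \<open>x^n / (1 - x^n)\<close> as a geometric series gives an absolutely
  convergent double series in \<open>x^(n j)\<close>; collecting by \<open>m = n j\<close> produces
  the divisor sums.\<close>

lemma lambert_series:
  fixes c :: "nat \<Rightarrow> real"
  assumes x: "0 < x" "x < 1" and cb: "\<And>n. \<bar>c n\<bar> \<le> 1"
  shows "((\<lambda>n. c n * x ^ n / (1 - x ^ n)) has_sum (\<Sum>\<^sub>\<infinity>m\<in>{1..}. (\<Sum>d | d dvd m. c d) * x ^ m)) {1..}"
    and "(\<lambda>m. (\<Sum>d | d dvd m. c d) * x ^ m) summable_on {1..}"
proof -
  define g where "g = (\<lambda>(n::nat, j::nat). c n * x ^ (n * j))"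
  have geo: "((\<lambda>j. x ^ (n * j)) has_sum x ^ n / (1 - x ^ n)) {1..}" if "n \<ge> 1" for n
  proof -
    have lt: "norm (x ^ n) < 1" using x that by (simp add: power_less_one_iff)
    have "(\<lambda>j. (x ^ n) ^ j) sums (1 / (1 - x ^ n))" by (rule geometric_sums[OF lt])
    then have "(\<lambda>j. (x ^ n) ^ Suc j) sums (1 / (1 - x ^ n) - 1)"
      by (subst sums_Suc_iff) simp
    also have "1 / (1 - x ^ n) - 1 = x ^ n / (1 - x ^ n)" using lt by (simp add: field_simps)
    finally have "((\<lambda>j. (x ^ n) ^ Suc j) has_sum x ^ n / (1 - x ^ n)) UNIV"
      using x by (intro norm_summable_imp_has_sum) (auto simp: sums_iff)
    then have "(((\<lambda>j. x ^ (n * j)) \<circ> Suc) has_sum x ^ n / (1 - x ^ n)) UNIV"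
      by (simp add: o_def power_mult)
    then have "((\<lambda>j. x ^ (n * j)) has_sum x ^ n / (1 - x ^ n)) (range Suc)"
      by (subst has_sum_reindex) auto
    then show ?thesis unfolding range_Suc_eq .
  qed
  have "(\<lambda>p. norm (g p)) summable_on ({1..} \<times> {1..})"
    unfolding Infinite_Sum.abs_summable_on_Sigma_iff
  proof (intro conjI ballI)
    fix n :: nat assume n: "n \<in> {1..}"
    have "(\<lambda>j. \<bar>c n\<bar> * x ^ (n * j)) summable_on {1..}"
      using geo[of n] n by (intro summable_on_cmult_right has_sum_imp_summable) auto
    then show "(\<lambda>j. norm (g (n, j))) summable_on {1..}" using x by (simp add: g_def abs_mult)
  next
    have "summable (\<lambda>n. x ^ n)" using x by (intro summable_geometric) auto
    then have "summable (\<lambda>n. norm (x ^ n / (1 - x)))" using x by (simp add: summable_divide)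
    from norm_summable_imp_summable_on[OF this] have sx: "(\<lambda>n. x ^ n / (1 - x)) summable_on {1..}"
      by (rule summable_on_subset_banach) simp
    have "(\<lambda>n. \<Sum>\<^sub>\<infinity>j\<in>{1..}. norm (g (n, j))) summable_on {1..}"
    proof (rule summable_on_comparison_test[OF sx])
      fix n :: nat assume n: "n \<in> {1..}"
      have "(\<Sum>\<^sub>\<infinity>j\<in>{1..}. norm (g (n, j))) = (\<Sum>\<^sub>\<infinity>j\<in>{1..}. \<bar>c n\<bar> * x ^ (n * j))"
        using x by (simp add: g_def abs_mult)
      also have "\<dots> = \<bar>c n\<bar> * (x ^ n / (1 - x ^ n))"
        using geo[of n] n by (subst infsum_cmult_right') (auto simp: infsumI)
      also have "\<dots> \<le> 1 * (x ^ n / (1 - x))"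
      proof (intro mult_mono divide_left_mono cb)
        have "x ^ n \<le> x ^ 1" using x n by (intro power_decreasing) auto
        then show "1 - x \<le> 1 - x ^ n" by simp
        then show "0 < (1 - x ^ n) * (1 - x)" using x by (intro mult_pos_pos) linarith+
        show "0 \<le> x ^ n / (1 - x ^ n)" using \<open>1 - x \<le> 1 - x ^ n\<close> x by simp
      qed (use x in auto)
      finally show "(\<Sum>\<^sub>\<infinity>j\<in>{1..}. norm (g (n, j))) \<le> x ^ n / (1 - x)" by simp
    qed (auto intro: infsum_nonneg)
    then show "(\<lambda>n. norm (\<Sum>\<^sub>\<infinity>j\<in>{1..}. norm (g (n, j)))) summable_on {1..}"
      by (simp add: infsum_nonneg)
  qed
  then have sg: "g summable_on ({1..} \<times> {1..})" by (rule abs_summable_summable)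
  have inner: "(\<Sum>\<^sub>\<infinity>j\<in>{1..}. g (n, j)) = c n * x ^ n / (1 - x ^ n)" if "n \<in> {1..}" for n
    using geo[of n] that by (simp add: g_def infsum_cmult_right' infsumI)
  have bij: "bij_betw (\<lambda>(m, d). (d, m div d)) (Sigma {1::nat..} (\<lambda>m. {d. d dvd m})) ({1..} \<times> {1..})"
    by (rule bij_betw_byWitness[where f' = "\<lambda>(n, j). (n * j, n)"]) (auto elim!: dvdE)
  have geq: "(g \<circ> (\<lambda>(m, d). (d, m div d))) (m, d) = c d * x ^ m" if "d dvd m" for m d
    unfolding g_def o_def prod.case dvd_mult_div_cancel[OF that] ..
  have sh: "(\<lambda>(m, d). c d * x ^ m) summable_on (Sigma {1..} (\<lambda>m. {d. d dvd m}))"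
  proof -
    have "(g \<circ> (\<lambda>(m, d). (d, m div d))) summable_on (Sigma {1..} (\<lambda>m. {d. d dvd m}))"
      unfolding o_def using summable_on_reindex_bij_betw[OF bij, of g] sg by blast
    then show ?thesis by (rule summable_on_cong[THEN iffD1, rotated]) (use geq in auto)
  qed
  have fin: "(\<Sum>\<^sub>\<infinity>d | d dvd m. c d * x ^ m) = (\<Sum>d | d dvd m. c d) * x ^ m" if "m \<in> {1..}" for m
    using that by (subst infsum_finite) (auto simp: sum_distrib_right)
  have "infsum g ({1..} \<times> {1..}) = infsum (\<lambda>(m, d). c d * x ^ m) (Sigma {1..} (\<lambda>m. {d. d dvd m}))"
    by (subst infsum_reindex_bij_betw[OF bij, symmetric], rule infsum_cong) (use geq in auto)
  also have "\<dots> = (\<Sum>\<^sub>\<infinity>m\<in>{1..}. \<Sum>\<^sub>\<infinity>d | d dvd m. c d * x ^ m)"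
    by (rule infsum_Sigma'_banach[OF sh, symmetric])
  also have "\<dots> = (\<Sum>\<^sub>\<infinity>m\<in>{1..}. (\<Sum>d | d dvd m. c d) * x ^ m)"
    by (rule infsum_cong) (rule fin)
  finally have tot: "infsum g ({1..} \<times> {1..}) = (\<Sum>\<^sub>\<infinity>m\<in>{1..}. (\<Sum>d | d dvd m. c d) * x ^ m)" .
  have sg': "(\<lambda>(n, j). g (n, j)) summable_on ({1..} \<times> {1..})" using sg by simp
  have "(\<lambda>n. \<Sum>\<^sub>\<infinity>j\<in>{1..}. g (n, j)) summable_on {1..}"
    by (rule summable_on_Sigma_banach[OF sg'])
  then have "(\<lambda>n. c n * x ^ n / (1 - x ^ n)) summable_on {1..}"
    by (rule summable_on_cong[THEN iffD1, rotated]) (rule inner)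
  moreover have "infsum (\<lambda>n. c n * x ^ n / (1 - x ^ n)) {1..} = (\<Sum>\<^sub>\<infinity>m\<in>{1..}. (\<Sum>d | d dvd m. c d) * x ^ m)"
    unfolding tot[symmetric] infsum_Sigma_banach[OF sg, symmetric] by (rule infsum_cong) (rule inner[symmetric])
  ultimately show "((\<lambda>n. c n * x ^ n / (1 - x ^ n)) has_sum (\<Sum>\<^sub>\<infinity>m\<in>{1..}. (\<Sum>d | d dvd m. c d) * x ^ m)) {1..}"
    unfolding has_sum_iff by (rule conjI)
  show "(\<lambda>m. (\<Sum>d | d dvd m. c d) * x ^ m) summable_on {1..}"
    by (rule summable_on_cong[THEN iffD1, OF _ summable_on_Sigma_banach[OF sh]]) (rule fin)
qed

text \<open>Monsky's argument: if \<open>L(1,\<chi>)\<close> were 0, the Lambert series of \<open>\<chi>\<close> would stay bounded as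
  \<open>x \<rightarrow> 1\<close>, although its power series coefficients are nonnegative and at least 1 at squares.\<close>

lemma real_char_sum_nonzero:
  fixes c :: "nat \<Rightarrow> real"
  assumes c1: "c 1 = 1" and cm: "\<And>m n. c (m * n) = c m * c n" and cv: "\<And>n. c n \<in> {-1, 0, 1}"
    and K: "\<And>n. \<bar>\<Sum>i<n. c (Suc i)\<bar> \<le> K"
  shows "\<not> (\<lambda>n. c (Suc n) / real (Suc n)) sums 0"
proof
  assume zero: "(\<lambda>n. c (Suc n) / real (Suc n)) sums 0"
  have cb: "\<bar>c n\<bar> \<le> 1" for n using cv[of n] by auto
  define r where "r = (\<lambda>m. \<Sum>d | d dvd m. c d)"
  have r: "r m \<ge> 0" "(\<forall>p. prime p \<longrightarrow> even (multiplicity p m)) \<Longrightarrow> r m \<ge> 1" if "m > 0" for m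
    using divisor_sum_nonneg[OF c1 cm cv that] unfolding r_def by auto
  have rsq: "r (m\<^sup>2) \<ge> 1" if "m > 0" for m
    by (rule r(2)) (use that in \<open>auto simp: prime_elem_multiplicity_power_distrib\<close>)
  obtain M :: nat where M: "real M > K" using reals_Archimedean2 by blast
  have bound: "(\<Sum>m=1..M. x ^ (m\<^sup>2)) \<le> K" if x: "0 < x" "x < 1" for x :: real
  proof -
    define f where "f = (\<Sum>\<^sub>\<infinity>m\<in>{1..}. r m * x ^ m)"
    have sm: "(\<lambda>m. r m * x ^ m) summable_on {1..}" unfolding r_def by (rule lambert_series(2)[OF x cb])
    have inj: "inj_on (\<lambda>m::nat. m\<^sup>2) {1..M}" by (auto intro!: inj_onI)
    have "(\<Sum>m=1..M. x ^ (m\<^sup>2)) \<le> (\<Sum>m=1..M. r (m\<^sup>2) * x ^ (m\<^sup>2))"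
      using rsq x by (intro sum_mono) (auto simp: mult_le_cancel_right1)
    also have "\<dots> = (\<Sum>m\<in>(\<lambda>m. m\<^sup>2) ` {1..M}. r m * x ^ m)" by (subst sum.reindex[OF inj]) simp
    also have "\<dots> \<le> f" unfolding f_def
      by (rule finite_sum_le_infsum[OF sm]) (use r(1) x in \<open>auto simp: Suc_le_eq\<close>)
    also have "f \<le> K"
    proof -
      \<comment> \<open>Since the series of \<open>c n / n\<close> is assumed to vanish, the Lambert
        series may be subtracted from any multiple of it. The multiple \<open>1 / (1 - x)\<close>
        makes the coefficients nonincreasing with first coefficient 1, so partial summation bounds
        \<open>f\<close> by \<open>K\<close> independently of \<open>x\<close>.\<close>
      define b where "b = (\<lambda>n. 1 / (real (Suc n) * (1 - x)) - x ^ Suc n / (1 - x ^ Suc n))"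
      have "((\<lambda>n. c n * x ^ n / (1 - x ^ n)) has_sum f) {1..}"
        unfolding f_def r_def by (rule lambert_series(1)[OF x cb])
      then have "(((\<lambda>n. c n * x ^ n / (1 - x ^ n)) \<circ> Suc) has_sum f) UNIV"
        unfolding range_Suc_eq[symmetric] by (subst has_sum_reindex[symmetric]) auto
      then have "(\<lambda>n. c (Suc n) * x ^ Suc n / (1 - x ^ Suc n)) sums f"
        using has_sum_imp_sums by (force simp: o_def)
      from sums_diff[OF sums_divide[OF zero, of "1 - x"] this]
      have "(\<lambda>n. c (Suc n) * b n) sums (0 / (1 - x) - f)"
        by (simp add: b_def algebra_simps)
      then have lim: "(\<lambda>n. \<bar>\<Sum>i<n. c (Suc i) * b i\<bar>) \<longlonglongrightarrow> \<bar>0 / (1 - x) - f\<bar>"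
        unfolding sums_def by (rule tendsto_rabs)
      have "\<bar>\<Sum>i<n. c (Suc i) * b i\<bar> \<le> K * b 0" for n
      proof (rule abel_bound[OF K])
        show "b (Suc i) \<le> b i" for i unfolding b_def by (rule lambert_coeff_antimono(1)[OF x]) simp
        show "0 \<le> b i" for i unfolding b_def by (rule lambert_coeff_antimono(2)[OF x]) simp
      qed
      then have "\<bar>0 / (1 - x) - f\<bar> \<le> K * b 0"
        by (intro LIMSEQ_le_const2[OF lim]) auto
      moreover have "b 0 = 1" using x by (simp add: b_def field_simps)
      ultimately show ?thesis by simp
    qed
    finally show ?thesis .
  qed
  \<comment> \<open>Finite sums may be taken to the limit: at \<open>x = 1\<close> the
    \<open>M\<close> squares alone contribute \<open>M\<close>, which exceeds
    \<open>K\<close>.\<close>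
  have "((\<lambda>x::real. \<Sum>m=1..M. x ^ (m\<^sup>2)) \<longlongrightarrow> (\<Sum>m=1..M. 1 ^ (m\<^sup>2))) (at_left 1)"
    by (intro tendsto_intros)
  moreover have "\<forall>\<^sub>F x in at_left (1::real). (\<Sum>m=1..M. x ^ (m\<^sup>2)) \<le> K"
    using bound by (intro eventually_at_leftI[of 0]) auto
  ultimately have "(\<Sum>m=1..M. 1 ^ (m\<^sup>2)) \<le> K"
    by (rule tendsto_upperbound) auto
  then show False using M by simp
qed

section \<open>Truncated Taylor series of a Dirichlet series\<close>

text \<open>Borel--Caratheodory: with \<open>h = log f - log f(z0)\<close> and \<open>A\<close> a bound for \<open>Re h\<close>, the Schwarz lemma
  applies to \<open>h / (2A - h)\<close>.\<close>

lemma nonvanishing_lower_bound: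
  assumes hol: "f holomorphic_on ball z0 R" and r: "0 < r" "r < R"
    and nz: "\<And>z. z \<in> ball z0 R \<Longrightarrow> f z \<noteq> 0" and M: "\<And>z. z \<in> ball z0 R \<Longrightarrow> norm (f z) < M"
    and z: "z \<in> cball z0 r"
  shows "norm (f z) \<ge> norm (f z0) * exp (- (2 * r / (R - r)) * ln (M / norm (f z0)))"
proof -
  have R: "R > 0" using r by simp
  obtain g where g: "g holomorphic_on ball z0 R" "\<And>z. z \<in> ball z0 R \<Longrightarrow> f z = exp (g z)"
    using contractible_imp_holomorphic_log[OF hol convex_imp_contractible[OF convex_ball] nz] by metis
  have z0: "z0 \<in> ball z0 R" using R by simp
  have f0: "norm (f z0) > 0" using nz[OF z0] by simp
  define A where "A = ln (M / norm (f z0))"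
  have "1 < M / norm (f z0)" using M[OF z0] f0 by (simp only: less_divide_eq_1_pos)
  then have A0: "A > 0" unfolding A_def by (rule ln_gt_zero)
  define h where "h = (\<lambda>w. g (z0 + of_real R * w) - g z0)"
  have inball: "z0 + of_real R * w \<in> ball z0 R" if "norm w < 1" for w
    using that R by (simp add: dist_norm norm_mult)
  have Re_h: "Re (h w) < A" if "norm w < 1" for w
  proof -
    have "exp (Re (g u)) = norm (f u)" if "u \<in> ball z0 R" for u using g(2)[OF that] by simp
    then have "exp (Re (h w)) = norm (f (z0 + of_real R * w)) / norm (f z0)"
      using inball[OF that] z0 by (simp add: h_def exp_diff)
    also have "\<dots> < M / norm (f z0)" using M[OF inball[OF that]] f0 by (intro divide_strict_right_mono)
    also have "\<dots> = exp A"
    proof -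
      have "M > 0" using M[OF z0] f0 by linarith
      then show ?thesis unfolding A_def using f0 by (subst exp_ln) auto
    qed
    finally show ?thesis by simp
  qed
  \<comment> \<open>Points with \<open>Re < A\<close> are closer to 0 than to its mirror image
    \<open>2 * A\<close>; this makes \<open>p\<close> a map of the unit disc into itself fixing
    0.\<close>
  have lt: "norm (h w) < norm (2 * of_real A - h w)" if "norm w < 1" for w
  proof -
    have "(Re (h w))\<^sup>2 + (Im (h w))\<^sup>2 < (2 * A - Re (h w))\<^sup>2 + (Im (h w))\<^sup>2"
      using Re_h[OF that] A0 mult_strict_left_mono[of "Re (h w)" A A] by (simp add: power2_eq_square algebra_simps)
    then have "(norm (h w))\<^sup>2 < (norm (2 * of_real A - h w))\<^sup>2" by (simp add: cmod_power2)
    then show ?thesis by (rule power_less_imp_less_base) simp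
  qed
  define p where "p = (\<lambda>w. h w / (2 * of_real A - h w))"
  have ne: "2 * of_real A - h w \<noteq> 0" if "norm w < 1" for w using lt[OF that] by auto
  have "h holomorphic_on ball 0 1"
  proof -
    have "(\<lambda>w. g (z0 + of_real R * w)) holomorphic_on ball 0 1"
      by (rule holomorphic_on_compose_gen[OF _ g(1), unfolded o_def]) (use inball in \<open>auto intro!: holomorphic_intros\<close>)
    then show ?thesis unfolding h_def by (intro holomorphic_intros)
  qed
  then have holp: "p holomorphic_on ball 0 1" unfolding p_def using ne by (intro holomorphic_intros) auto
  have p0: "p 0 = 0" by (simp add: p_def h_def)
  have p1: "norm (p w) < 1" if "norm w < 1" for w
    using lt[OF that] ne[OF that] by (simp add: p_def norm_divide)
  define w where "w = (z - z0) / of_real R"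
  have nw: "norm w \<le> r / R" using z R by (simp add: w_def norm_divide dist_norm norm_minus_commute divide_right_mono)
  have w1: "norm w < 1" using nw r R by (simp add: le_less_trans[of _ "r / R"])
  have zw: "z0 + of_real R * w = z" using R by (simp add: w_def)
  have "norm (p w) \<le> norm w" by (rule Schwarz_Lemma(1)[OF holp p0 p1 w1])
  then have "norm (h w) \<le> norm w * norm (2 * of_real A - h w)"
    using ne[OF w1] by (simp add: p_def norm_divide field_simps)
  also have "\<dots> \<le> (r / R) * (2 * A + norm (h w))"
  proof (intro mult_mono nw)
    show "norm (2 * of_real A - h w) \<le> 2 * A + norm (h w)"
      using norm_triangle_ineq4[of "2 * of_real A" "h w"] A0 by (simp add: norm_mult)
  qed (use r R in auto)
  finally have "R * norm (h w) \<le> r * (2 * A + norm (h w))" using R by (simp add: field_simps)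
  then have "norm (h w) * (R - r) \<le> 2 * r * A" by (simp add: algebra_simps)
  then have hb: "norm (h w) \<le> 2 * r / (R - r) * A" using r by (simp add: field_simps)
  have "exp (- (2 * r / (R - r)) * A) \<le> exp (Re (h w))"
    using hb abs_Re_le_cmod[of "h w"] by simp
  then have "norm (f z0) * exp (- (2 * r / (R - r)) * A) \<le> norm (f z0) * exp (Re (h w))"
    by (intro mult_left_mono) auto
  also have "\<dots> = norm (f z0 * exp (h w))" by (simp add: norm_mult)
  also have "f z0 * exp (h w) = f z"
  proof -
    have "z \<in> ball z0 R" using z r by simp
    then show ?thesis using g(2)[OF z0] g(2)[of z] by (simp add: h_def zw exp_diff)
  qed
  finally show ?thesis by (simp add: A_def)
qed

lemma taylor_truncation_bound:
  assumes hol: "f holomorphic_on ball z0 r" and cont: "continuous_on (cball z0 r) f"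
    and B: "\<And>z. z \<in> cball z0 r \<Longrightarrow> norm (f z) \<le> B" and r: "r > 1" and w: "norm (w - z0) = 1"
  shows "norm (f w - (\<Sum>j\<le>J. (deriv ^^ j) f z0 / fact j * (w - z0) ^ j)) \<le> B / (r - 1) * (1 / r) ^ J"
proof -
  define c where "c = (\<lambda>j. (deriv ^^ j) f z0 / fact j * (w - z0) ^ j)"
  have wb: "w \<in> ball z0 r" using w r by (simp add: dist_norm norm_minus_commute)
  have sums: "c sums f w" unfolding c_def by (rule holomorphic_power_series[OF hol wb])
  have cb: "norm (c j) \<le> B * (1 / r) ^ j" for j
  proof -
    have "norm ((deriv ^^ j) f z0) \<le> fact j * B / r ^ j"
      by (rule Cauchy_inequality[OF hol cont]) (use r B in \<open>auto simp: dist_norm\<close>)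
    then show ?thesis using w r by (simp add: c_def norm_mult norm_divide norm_power field_simps power_divide)
  qed
  have geo: "(\<lambda>j. B * (1 / r) ^ (j + Suc J)) sums (B * (1 / r) ^ Suc J * (1 / (1 - 1 / r)))"
  proof -
    have "(\<lambda>j. (1 / r) ^ j) sums (1 / (1 - 1 / r))" by (rule geometric_sums) (use r in auto)
    from sums_mult[OF this, of "B * (1 / r) ^ Suc J"] show ?thesis by (simp add: power_add mult_ac)
  qed
  have "f w - (\<Sum>j\<le>J. c j) = (\<Sum>j. c (j + Suc J))"
    using suminf_split_initial_segment[of c "Suc J"] sums by (simp add: sums_iff lessThan_Suc_atMost)
  also have "norm \<dots> \<le> (\<Sum>j. B * (1 / r) ^ (j + Suc J))"
  proof (rule norm_suminf_le)
    show "norm (c (j + Suc J)) \<le> B * (1 / r) ^ (j + Suc J)" for j by (rule cb)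
    show "summable (\<lambda>j. B * (1 / r) ^ (j + Suc J))" using geo by (rule sums_summable)
  qed
  also have "\<dots> = B * (1 / r) ^ Suc J * (1 / (1 - 1 / r))" using geo by (simp only: sums_iff)
  also have "\<dots> = B / (r - 1) * (1 / r) ^ J" using r by (simp add: field_simps)
  finally show ?thesis by (simp add: c_def)
qed

lemma higher_deriv_dirichlet_polynomial:
  "(deriv ^^ j) (\<lambda>s. \<Sum>n<M. a n * of_nat (Suc n) powr (-s)) =
   (\<lambda>s. \<Sum>n<M. a n * (of_real (- ln (real (Suc n)))) ^ j * (of_nat (Suc n) powr (-s) :: complex))"
proof (induction j)
  case (Suc j)
  have ln: "Ln (of_nat (Suc n)) = of_real (ln (real (Suc n)))" for n
    by (metis Ln_of_real of_nat_0_less_iff of_real_of_nat_eq zero_less_Suc)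
  have "((\<lambda>s. \<Sum>n<M. a n * (of_real (- ln (real (Suc n)))) ^ j * (of_nat (Suc n) powr (-s))) has_field_derivative
      (\<Sum>n<M. a n * (of_real (- ln (real (Suc n)))) ^ Suc j * (of_nat (Suc n) powr (-s)))) (at s)" for s :: complex
  proof (intro DERIV_sum)
    fix n
    have "((\<lambda>s. exp (- s * of_real (ln (real (Suc n))))) has_field_derivative
        of_real (- ln (real (Suc n))) * exp (- s * of_real (ln (real (Suc n))))) (at s)"
      by (auto intro!: derivative_eq_intros)
    moreover have "(of_nat (Suc n) powr (-s)) = exp (- s * of_real (ln (real (Suc n))))" for s :: complex
      unfolding powr_def ln by (simp del: of_nat_Suc)
    ultimately have "((\<lambda>s. of_nat (Suc n) powr (-s)) has_field_derivative
        of_real (- ln (real (Suc n))) * (of_nat (Suc n) powr (-s))) (at s)" by (simp only:)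
    from DERIV_cmult[OF this, of "a n * (of_real (- ln (real (Suc n)))) ^ j"]
    show "((\<lambda>s. a n * (of_real (- ln (real (Suc n)))) ^ j * (of_nat (Suc n) powr (-s))) has_field_derivative
        a n * (of_real (- ln (real (Suc n)))) ^ Suc j * (of_nat (Suc n) powr (-s))) (at s)"
      by (simp only: power_Suc mult_ac)
  qed
  then have "deriv (\<lambda>s. \<Sum>n<M. a n * (of_real (- ln (real (Suc n)))) ^ j * (of_nat (Suc n) powr (-s)))
     = (\<lambda>s. \<Sum>n<M. a n * (of_real (- ln (real (Suc n)))) ^ Suc j * (of_nat (Suc n) powr (-s) :: complex))"
    by (intro ext DERIV_imp_deriv)
  then show ?case unfolding funpow.simps o_def Suc.IH .
qed auto

text \<open>The probability that a Poisson variable of mean \<open>ln n\<close> is at most \<open>J\<close>.\<close>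

definition poisson_weight :: "nat \<Rightarrow> nat \<Rightarrow> real" where
  "poisson_weight J n = (\<Sum>j\<le>J. ln (real n) ^ j / fact j) / real n"

text \<open>Near 2 the series converges uniformly, so its derivatives come from termwise
  differentiation, with terms \<open>(- ln n)^j n^-2\<close>. The sign cancels against
  \<open>(1 - 2)^j\<close>, and the sum over \<open>j \<le> J\<close> is \<open>1 / n\<close> times
  the Poisson weight. The error is governed by the values of \<open>f\<close> on the larger disc,
  where the series itself need not converge; the 4 is \<open>1 / (5/4 - 1)\<close>.\<close>

lemma dirichlet_series_taylor:
  assumes hol: "f holomorphic_on S" and S: "cball 2 (5/4) \<subseteq> S"
    and B: "\<And>z. z \<in> cball 2 (5/4) \<Longrightarrow> norm (f z) \<le> B"
    and summ: "summable (\<lambda>n. norm (a n) * real (Suc n) powr (- (3/2)))"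
    and f: "\<And>s. Re s > 3/2 \<Longrightarrow> f s = (\<Sum>n. a n * of_nat (Suc n) powr (-s))"
  shows "\<exists>T. (\<lambda>n. a n * of_real (poisson_weight J (Suc n) / real (Suc n))) sums T \<and> norm (f 1 - T) \<le> 4 * B * (4/5) ^ J"
proof -
  define U where "U = ball (2::complex) (1/2)"
  have ReU: "Re s > 3/2" if "s \<in> U" for s
    using that abs_Re_le_cmod[of "2 - s"] by (simp add: U_def dist_norm)
  have "uniform_limit U (\<lambda>M s. \<Sum>n<M. a n * of_nat (Suc n) powr (-s)) (\<lambda>s. \<Sum>n. a n * of_nat (Suc n) powr (-s)) sequentially"
  proof (rule Weierstrass_m_test[OF _ summ])
    fix n s assume s: "s \<in> U"
    have "real (Suc n) powr (- Re s) \<le> real (Suc n) powr (- (3/2))"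
      using ReU[OF s] by (intro powr_mono) auto
    then show "norm (a n * of_nat (Suc n) powr (-s)) \<le> norm (a n) * real (Suc n) powr (- (3/2))"
      unfolding norm_mult norm_of_nat_powr by (intro mult_left_mono) auto
  qed
  then have ul: "uniform_limit U (\<lambda>M s. \<Sum>n<M. a n * of_nat (Suc n) powr (-s)) f sequentially"
    by (rule uniform_limit_cong'[THEN iffD1, rotated 2]) (use f ReU in auto)
  have coeff: "(\<lambda>n. a n * (of_real (- ln (real (Suc n)))) ^ j * of_nat (Suc n) powr (-2)) sums (deriv ^^ j) f 2" for j
  proof -
    have "(\<lambda>M. (deriv ^^ j) (\<lambda>s. \<Sum>n<M. a n * of_nat (Suc n) powr (-s)) 2) \<longlonglongrightarrow> (deriv ^^ j) f 2"
      by (rule higher_deriv_complex_uniform_limit[OF ul])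
        (auto simp: U_def intro!: holomorphic_intros always_eventually)
    then show ?thesis unfolding higher_deriv_dirichlet_polynomial sums_def .
  qed
  define T where "T = (\<Sum>j\<le>J. (deriv ^^ j) f 2 / fact j * (1 - 2) ^ j)"
  have "(\<lambda>n. \<Sum>j\<le>J. a n * (of_real (- ln (real (Suc n)))) ^ j * of_nat (Suc n) powr (-2) / fact j * (1 - 2) ^ j) sums T"
    unfolding T_def by (intro sums_sum sums_mult2 sums_divide coeff)
  moreover have "(\<Sum>j\<le>J. a n * (of_real (- ln (real (Suc n)))) ^ j * of_nat (Suc n) powr (-2) / fact j * (1 - 2) ^ j)
      = a n * of_real (poisson_weight J (Suc n) / real (Suc n))" for n
  proof -
    have p2: "of_nat (Suc n) powr (-2 :: complex) = of_real (1 / (real (Suc n))\<^sup>2)"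
      by (simp add: powr_minus divide_inverse powr_numeral del: of_nat_Suc)
    have "a n * (of_real (- x)) ^ j * of_real y / fact j * (1 - 2) ^ j = a n * of_real (y * (x ^ j / fact j))" for x y :: real and j
    proof -
      have "(of_real (- x)) ^ j * (1 - 2) ^ j = (of_real (x ^ j) :: complex)"
        by (simp flip: power_mult_distrib)
      then have "a n * of_real y / fact j * ((of_real (- x)) ^ j * (1 - 2) ^ j) = a n * of_real y / fact j * of_real (x ^ j)" by simp
      then show ?thesis by (simp add: mult_ac)
    qed
    then have "(\<Sum>j\<le>J. a n * (of_real (- ln (real (Suc n)))) ^ j * of_nat (Suc n) powr (-2) / fact j * (1 - 2) ^ j)
       = (\<Sum>j\<le>J. a n * of_real (1 / (real (Suc n))\<^sup>2 * (ln (real (Suc n)) ^ j / fact j)))"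
      unfolding p2 by (intro sum.cong refl)
    also have "\<dots> = a n * of_real (1 / (real (Suc n))\<^sup>2 * (\<Sum>j\<le>J. ln (real (Suc n)) ^ j / fact j))"
      by (simp only: sum_distrib_left of_real_sum)
    also have "1 / (real (Suc n))\<^sup>2 * (\<Sum>j\<le>J. ln (real (Suc n)) ^ j / fact j) = poisson_weight J (Suc n) / real (Suc n)"
      by (simp only: poisson_weight_def power2_eq_square divide_divide_eq_left times_divide_eq_left mult_1)
    finally show ?thesis .
  qed
  ultimately have T: "(\<lambda>n. a n * of_real (poisson_weight J (Suc n) / real (Suc n))) sums T" by simp
  have hol': "f holomorphic_on cball 2 (5/4)" using hol S holomorphic_on_subset by blast
  have "norm (f 1 - T) \<le> B / (5/4 - 1) * (1 / (5/4)) ^ J"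
    unfolding T_def
    by (rule taylor_truncation_bound[OF _ _ B])
      (use hol' in \<open>auto intro: holomorphic_on_subset[OF _ ball_subset_cball] holomorphic_on_imp_continuous_on\<close>)
  with T show ?thesis by (intro exI[of _ T]) (simp add: mult.commute)
qed

section \<open>Chernoff bounds for the Poisson weights\<close>

lemma exp_minus_partial_sum_le:
  fixes x :: real
  assumes x: "x \<ge> 0" and R: "R \<ge> 1"
  shows "exp x - (\<Sum>j\<le>J. x ^ j / fact j) \<le> (1 / R) ^ J * exp (R * x)"
    and "(\<Sum>j\<le>J. x ^ j / fact j) \<le> exp x"
proof -
  have sums: "(\<lambda>j. y ^ j / fact j) sums exp y" for y :: real
    using exp_converges[of y] by (simp add: divide_inverse mult.commute)
  have summ: "summable (\<lambda>j. y ^ j / fact j)" and eq: "exp y = (\<Sum>j. y ^ j / fact j)" for y :: real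
    using sums[of y] by (auto simp: sums_iff)
  have split: "exp y = (\<Sum>j. y ^ (j + Suc J) / fact (j + Suc J)) + (\<Sum>j\<le>J. y ^ j / fact j)" for y :: real
    using suminf_split_initial_segment[OF summ, of y "Suc J"] unfolding eq lessThan_Suc_atMost .
  have summ': "summable (\<lambda>j. y ^ (j + Suc J) / fact (j + Suc J))" for y :: real
    using summable_ignore_initial_segment[OF summ] .
  show "(\<Sum>j\<le>J. x ^ j / fact j) \<le> exp x"
    unfolding split[of x] using suminf_nonneg[OF summ'[of x]] x by simp
  \<comment> \<open>For indices \<open>i > J\<close> one has \<open>R^(i - J) \<ge> 1\<close>;
    inserting this factor lets the tail be compared with the whole series of
    \<open>exp (R * x)\<close>.\<close>
  have "(\<Sum>j. x ^ (j + Suc J) / fact (j + Suc J)) \<le> (\<Sum>j. (1 / R) ^ J * ((R * x) ^ (j + Suc J) / fact (j + Suc J)))"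
  proof (rule suminf_le[OF _ summ' summable_mult[OF summ']])
    fix j
    have "(1 / R) ^ (j + Suc J) \<le> (1 / R) ^ J" using R by (intro power_decreasing) auto
    then have "(1 / R) ^ (j + Suc J) * ((R * x) ^ (j + Suc J) / fact (j + Suc J)) \<le> (1 / R) ^ J * ((R * x) ^ (j + Suc J) / fact (j + Suc J))"
      using x R by (intro mult_right_mono) auto
    moreover have "(1 / R) ^ (j + Suc J) * ((R * x) ^ (j + Suc J) / fact (j + Suc J)) = x ^ (j + Suc J) / fact (j + Suc J)"
      using R by (simp only: power_divide power_mult_distrib) simp
    ultimately show "x ^ (j + Suc J) / fact (j + Suc J) \<le> (1 / R) ^ J * ((R * x) ^ (j + Suc J) / fact (j + Suc J))" by simp
  qed
  also have "\<dots> = (1 / R) ^ J * (\<Sum>j. (R * x) ^ (j + Suc J) / fact (j + Suc J))"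
    by (rule suminf_mult[OF summ'])
  also have "\<dots> \<le> (1 / R) ^ J * exp (R * x)"
  proof (rule mult_left_mono)
    have "(\<Sum>j\<le>J. (R * x) ^ j / fact j) \<ge> 0" using x R by (intro sum_nonneg) auto
    then show "(\<Sum>j. (R * x) ^ (j + Suc J) / fact (j + Suc J)) \<le> exp (R * x)" unfolding split[of "R * x"] by linarith
  qed (use R in auto)
  finally show "exp x - (\<Sum>j\<le>J. x ^ j / fact j) \<le> (1 / R) ^ J * exp (R * x)" using split[of x] by linarith
qed

text \<open>The opposite tail: for \<open>j \<le> J\<close> the inserted factor
  \<open>(1 / r)^(J - j)\<close> is at least 1 because \<open>r \<le> 1\<close>.\<close>

lemma exp_partial_sum_le:
  fixes x :: real
  assumes x: "x \<ge> 0" and r: "0 < r" "r \<le> 1"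
  shows "(\<Sum>j\<le>J. x ^ j / fact j) \<le> (1 / r) ^ J * exp (r * x)"
proof -
  have "(\<Sum>j\<le>J. x ^ j / fact j) \<le> (\<Sum>j\<le>J. (1 / r) ^ J * ((r * x) ^ j / fact j))"
  proof (rule sum_mono)
    fix j assume j: "j \<in> {..J}"
    have "(1 / r) ^ j \<le> (1 / r) ^ J" using j r by (intro power_increasing) auto
    then have "(1 / r) ^ j * ((r * x) ^ j / fact j) \<le> (1 / r) ^ J * ((r * x) ^ j / fact j)"
      using x r by (intro mult_right_mono) auto
    moreover have "(1 / r) ^ j * ((r * x) ^ j / fact j) = x ^ j / fact j"
      using r by (simp add: power_divide power_mult_distrib)
    ultimately show "x ^ j / fact j \<le> (1 / r) ^ J * ((r * x) ^ j / fact j)" by simp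
  qed
  also have "\<dots> = (1 / r) ^ J * (\<Sum>j\<le>J. (r * x) ^ j / fact j)" by (simp add: sum_distrib_left)
  also have "(\<Sum>j\<le>J. (r * x) ^ j / fact j) \<le> exp (r * x)"
    using exp_minus_partial_sum_le(2)[of "r * x" 1 J] x r by simp
  finally show ?thesis using r by (simp add: mult_left_mono)
qed

lemma poisson_weight_nonneg: "poisson_weight J n \<ge> 0"
  by (cases "n = 0") (auto simp: poisson_weight_def intro!: sum_nonneg divide_nonneg_nonneg)

text \<open>Any \<open>r < 1\<close> gives decay in \<open>n\<close>, which makes the smoothed
  series converge absolutely, at a cost exponential in \<open>J\<close> whose base is close to 1 for
  \<open>r\<close> close to 1.\<close>

lemma poisson_weight_le_powr:
  assumes n: "n > 0" and r: "0 < r" "r \<le> 1"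
  shows "poisson_weight J n \<le> (1 / r) ^ J * real n powr (r - 1)"
proof -
  have "(\<Sum>j\<le>J. ln (real n) ^ j / fact j) \<le> (1 / r) ^ J * exp (r * ln (real n))"
    by (rule exp_partial_sum_le) (use n r in auto)
  also have "exp (r * ln (real n)) = real n powr r" using n by (simp add: powr_def)
  finally have "poisson_weight J n \<le> (1 / r) ^ J * real n powr r / real n"
    unfolding poisson_weight_def by (intro divide_right_mono) auto
  also have "\<dots> = (1 / r) ^ J * real n powr (r - 1)" using n by (simp add: powr_diff)
  finally show ?thesis .
qed

text \<open>Of interest for \<open>R > 1\<close>: the deviation from 1 is exponentially small in
  \<open>J\<close> at the cost of a fixed power of \<open>n\<close>, which the convergent sum over
  squares can absorb.\<close>

lemma one_minus_poisson_weight: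
  assumes n: "n > 0" and R: "R \<ge> 1"
  shows "1 - poisson_weight J n \<le> (1 / R) ^ J * real n powr (R - 1)" "poisson_weight J n \<le> 1"
proof -
  have ln: "ln (real n) \<ge> 0" "exp (ln (real n)) = real n" using n by auto
  have "1 - poisson_weight J n = (exp (ln (real n)) - (\<Sum>j\<le>J. ln (real n) ^ j / fact j)) / real n"
    using n unfolding ln(2) by (simp add: poisson_weight_def diff_divide_distrib)
  also have "\<dots> \<le> ((1 / R) ^ J * exp (R * ln (real n))) / real n"
    by (intro divide_right_mono exp_minus_partial_sum_le(1) ln R) auto
  also have "exp (R * ln (real n)) = real n powr R" using n by (simp add: powr_def)
  also have "((1 / R) ^ J * real n powr R) / real n = (1 / R) ^ J * real n powr (R - 1)" using n by (simp add: powr_diff)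
  finally show "1 - poisson_weight J n \<le> (1 / R) ^ J * real n powr (R - 1)" .
  have "(\<Sum>j\<le>J. ln (real n) ^ j / fact j) \<le> real n"
    using exp_minus_partial_sum_le(2)[OF ln(1) R, of J] unfolding ln(2) .
  then show "poisson_weight J n \<le> 1" using n by (simp add: poisson_weight_def)
qed

section \<open>L-functions of nonprincipal characters\<close>

lemma nonprincipal_mean_zero:
  assumes "dirichlet_char q chi" "chi \<noteq> principal_char q"
  shows "mean_zero_periodic q chi"
  using assms sum_dirichlet_char_period[OF assms] by (simp add: mean_zero_periodic_def dirichlet_char_def)

text \<open>The property \<open>Q\<close> pins down the chosen function: an entire candidate exists
  by continuation, and the series on \<open>Re s > 1\<close> fixes all values by the identity
  theorem.\<close>

lemma nonprincipal_L:
  assumes d: "dirichlet_char q chi" "chi \<noteq> principal_char q"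
  shows "dirichlet_L q chi holomorphic_on UNIV"
    and "Re s > 0 \<Longrightarrow> (\<lambda>n. chi (Suc n) * of_nat (Suc n) powr (-s)) sums dirichlet_L q chi s"
proof -
  note mz = nonprincipal_mean_zero[OF d]
  have conv: "chi (Suc n) / of_nat (Suc n) powr s = chi (Suc n) * of_nat (Suc n) powr (-s)" for n s
    by (simp add: powr_minus field_simps)
  obtain F where F: "F holomorphic_on UNIV" "\<And>s. Re s > 1 \<Longrightarrow> F s = (\<Sum>n. chi (Suc n) * of_nat (Suc n) powr (-s))"
    using periodic_series_entire[OF mz] by blast
  have sums: "(\<lambda>n. chi (Suc n) * of_nat (Suc n) powr (-s)) sums F s" if "Re s > 0" for s
    by (rule periodic_series_sums[OF mz F that])
  define Q where "Q = (\<lambda>f. f holomorphic_on (if chi = principal_char q then - {1} else UNIV) \<and>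
     (\<forall>s. Re s > 1 \<longrightarrow> (\<lambda>n. chi (Suc n) / of_nat (Suc n) powr s) sums f s))"
  have "Q F" using F(1) sums d(2) unfolding Q_def conv by simp
  moreover have "dirichlet_L q chi = (SOME f. Q f)" by (simp only: dirichlet_L_def Q_def)
  ultimately have "Q (dirichlet_L q chi)" using someI[of Q F] by simp
  then have L: "dirichlet_L q chi holomorphic_on UNIV"
    "\<And>s. Re s > 1 \<Longrightarrow> (\<lambda>n. chi (Suc n) * of_nat (Suc n) powr (-s)) sums dirichlet_L q chi s"
    using d(2) unfolding Q_def conv by auto
  show "dirichlet_L q chi holomorphic_on UNIV" by (rule L(1))
  show "(\<lambda>n. chi (Suc n) * of_nat (Suc n) powr (-s)) sums dirichlet_L q chi s" if "Re s > 0"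
    by (rule periodic_series_sums[OF mz L(1) _ that]) (use L(2) in \<open>simp add: sums_iff\<close>)
qed

lemma dirichlet_L_eq_suminf:
  assumes d: "dirichlet_char q chi" "chi \<noteq> principal_char q" and s: "Re s > 1"
  shows "dirichlet_L q chi s = (\<Sum>n. chi n / of_nat n powr s)"
proof -
  have "dirichlet_L q chi s = (\<Sum>n. chi (Suc n) * of_nat (Suc n) powr (-s))"
    using nonprincipal_L(2)[OF d, of s] s by (simp add: sums_iff)
  also have "\<dots> = (\<Sum>n. chi n * of_nat n powr (-s))"
    by (rule suminf_zero_term) simp
  finally show ?thesis by (simp add: powr_minus divide_inverse)
qed

lemma nonprincipal_L_power_inverse:
  assumes d: "dirichlet_char q chi" "chi \<noteq> principal_char q" and s: "Re s > 1"
  shows "dirichlet_L q chi s \<noteq> 0"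
    and "1 / dirichlet_L q chi s ^ k = (\<Sum>n. of_real (inv_coeff k (Suc n)) * chi (Suc n) * of_nat (Suc n) powr (-s))"
proof -
  show nz: "dirichlet_L q chi s \<noteq> 0"
    using dirichlet_series_power_inverse[OF d(1) s, of 1] dirichlet_L_eq_suminf[OF d s] by auto
  have "dirichlet_L q chi s ^ k * (\<Sum>n. of_real (inv_coeff k n) * chi n / of_nat n powr s) = 1"
    using dirichlet_series_power_inverse[OF d(1) s, of k] dirichlet_L_eq_suminf[OF d s] by simp
  moreover have "(\<Sum>n. of_real (inv_coeff k n) * chi n / of_nat n powr s)
      = (\<Sum>n. of_real (inv_coeff k (Suc n)) * chi (Suc n) * of_nat (Suc n) powr (-s))"
    unfolding powr_minus divide_inverse by (rule suminf_zero_term[symmetric]) simp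
  ultimately show "1 / dirichlet_L q chi s ^ k = (\<Sum>n. of_real (inv_coeff k (Suc n)) * chi (Suc n) * of_nat (Suc n) powr (-s))"
    using nz by (simp add: field_simps)
qed

text \<open>Three regions, three reasons: the Euler product for \<open>Re s > 1\<close>, the
  hypothesis inside the strip, and the 3-4-1 inequality on the line, except at \<open>s = 1\<close>
  for a character with principal square. Such a character takes only the values -1, 0, 1, and the
  Lambert series argument covers it.\<close>

lemma nonprincipal_L_nonzero:
  assumes grh: GRH and d: "dirichlet_char q chi" "chi \<noteq> principal_char q" and s: "Re s > 1/2"
  shows "dirichlet_L q chi s \<noteq> 0"
proof -
  consider "Re s < 1" | "Re s = 1" | "Re s > 1" by linarith
  then show ?thesis
  proof cases
    case 1
    show ?thesis
    proof
      assume "dirichlet_L q chi s = 0"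
      then have "Re s = 1/2" using grh[unfolded GRH_def, rule_format, OF d(1) _ 1] s by simp
      then show False using s by simp
    qed
  next
    case 3
    then show ?thesis by (rule nonprincipal_L_power_inverse(1)[OF d])
  next
    case 2
    define t where "t = Im s"
    have st: "s = Complex 1 t" using 2 by (simp add: complex_eq_iff t_def)
    have ser: "dirichlet_L q chi s = (\<Sum>n. chi (Suc n) * of_nat (Suc n) powr (-s))" if "Re s > 1" for s
      using nonprincipal_L(2)[OF d, of s] that by (simp add: sums_iff)
    show ?thesis
    proof (cases "t \<noteq> 0 \<or> (\<Sum>n<q. (chi n)\<^sup>2) = 0")
      case True
      then show ?thesis unfolding st by (intro L_nonzero_on_line[OF d(1) nonprincipal_L(1)[OF d] ser])
    next
      case False
      \<comment> \<open>A nonzero sum over a period forces \<open>chi^2\<close> to be principal, so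
        \<open>chi\<close> is real.\<close>
      have "dirichlet_char q (\<lambda>n. (chi n)\<^sup>2)" using dirichlet_char_times[OF d(1) d(1)] by (simp add: power2_eq_square)
      then have sq: "(\<lambda>n. (chi n)\<^sup>2) = principal_char q" using False sum_dirichlet_char_period by blast
      define c where "c = (\<lambda>n. Re (chi n))"
      have val: "chi n \<in> {-1, 0, 1}" for n
      proof -
        have "(chi n)\<^sup>2 = 0 \<or> (chi n)\<^sup>2 = 1" using fun_cong[OF sq, of n] by (auto simp: principal_char_def)
        then show ?thesis by (auto simp: power2_eq_1_iff)
      qed
      have chic: "chi n = of_real (c n)" for n using val[of n] by (auto simp: c_def)
      show ?thesis
      proof
        assume zero: "dirichlet_L q chi s = 0"
        have "s = 1" using False st by (simp add: complex_eq_iff)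
        then have "(\<lambda>n. chi (Suc n) * of_nat (Suc n) powr (-1)) sums 0"
          using nonprincipal_L(2)[OF d, of s] zero by simp
        moreover have "chi (Suc n) * of_nat (Suc n) powr (-1) = of_real (c (Suc n) / real (Suc n))" for n
          by (simp add: chic powr_minus divide_inverse)
        ultimately have "(\<lambda>n. complex_of_real (c (Suc n) / real (Suc n))) sums of_real 0" by simp
        then have "(\<lambda>n. c (Suc n) / real (Suc n)) sums 0" by (simp only: sums_of_real_iff)
        moreover have "\<not> (\<lambda>n. c (Suc n) / real (Suc n)) sums 0"
        proof (rule real_char_sum_nonzero)
          show "c 1 = 1" using dirichlet_char_1[OF d(1)] by (simp add: c_def)
          show "c (m * n) = c m * c n" for m n
            using dirichlet_char_mult[OF d(1), of m n] unfolding chic by (metis of_real_eq_iff of_real_mult)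
          show "c n \<in> {-1, 0, 1}" for n using val[of n] by (auto simp: c_def)
          show "\<bar>\<Sum>i<n. c (Suc i)\<bar> \<le> real q" for n
          proof -
            have "norm (\<Sum>i<n. chi (Suc i)) \<le> q"
              by (rule norm_periodic_partial_sum_le[OF nonprincipal_mean_zero[OF d] norm_dirichlet_char_le[OF d(1)]])
            also have "(\<Sum>i<n. chi (Suc i)) = of_real (\<Sum>i<n. c (Suc i))" by (simp add: chic)
            finally show ?thesis by (simp only: norm_of_real)
          qed
        qed
        ultimately show False by blast
      qed
    qed
  qed
qed

section \<open>Approximation at s = 1\<close>

text \<open>Borel--Caratheodory with radii 5/4 and 7/5, the latter keeping
  \<open>Re z \<ge> 3/5\<close>, has exponent \<open>2 r / (R - r) = 50/3\<close>, rounded up to 17.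
  One further factor comes from the value at the centre, whence the 18 powers of
  \<open>1 / L 2\<close>, which is bounded by its absolutely convergent series.\<close>

lemma nonprincipal_L_inverse_bound:
  assumes grh: GRH
  obtains K where "K > 0" "\<And>q chi z. dirichlet_char q chi \<Longrightarrow> chi \<noteq> principal_char q \<Longrightarrow> z \<in> cball 2 (5/4) \<Longrightarrow>
    norm (1 / dirichlet_L q chi z) \<le> K * real q ^ 17"
proof -
  define Z where "Z = (\<Sum>n. real (Suc n) powr (- (3/5 + 1)))"
  have "summable (\<lambda>n. real (Suc n) powr (- (3/5 + 1)))"
    by (subst summable_Suc_iff) (simp add: summable_real_powr_iff)
  then have Z0: "Z \<ge> 0" unfolding Z_def by (intro suminf_nonneg) auto
  obtain C where C: "C > 0" "\<And>n. \<bar>inv_coeff 1 n\<bar> \<le> C * real n powr (1/2)"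
    using inv_coeff_bound[of "1/2" 1] by auto
  define W where "W = (\<Sum>n. real (Suc n) powr (- (3/2)))"
  have smW: "summable (\<lambda>n. real (Suc n) powr (- (3/2)))"
    by (subst summable_Suc_iff) (simp add: summable_real_powr_iff)
  have "W \<ge> real (Suc 0) powr (- (3/2))"
    unfolding W_def using sum_le_suminf[OF smW, of "{0}"] by simp
  then have W1: "W \<ge> 1" by simp
  define K0 where "K0 = C * W"
  have K0: "K0 > 0" using C W1 by (simp add: K0_def)
  \<comment> \<open>The estimate below gives \<open>2 + 8 * Z\<close>; the surplus makes the upper
    bound for \<open>L\<close> strict.\<close>
  define c1 where "c1 = 4 + 8 * Z"
  have c1: "c1 > 0" using Z0 by (simp add: c1_def)
  define K where "K = K0 ^ 18 * c1 ^ 17"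
  have "norm (1 / dirichlet_L q chi z) \<le> K * real q ^ 17"
    if d: "dirichlet_char q chi" "chi \<noteq> principal_char q" and z: "z \<in> cball 2 (5/4)" for q chi z
  proof -
    define L where "L = dirichlet_L q chi"
    have q: "real q \<ge> 1" using d(1) by (simp add: dirichlet_char_def)
    have Re_ball: "Re z \<ge> 3/5" "norm z \<le> 4" if "z \<in> ball 2 (7/5)" for z
    proof -
      have "norm (2 - z) < 7/5" using that by (simp add: dist_norm)
      then show "Re z \<ge> 3/5" using abs_Re_le_cmod[of "2 - z"] by simp
      show "norm z \<le> 4" using \<open>norm (2 - z) < 7/5\<close> norm_triangle_ineq4[of 2 "2 - z"] by simp
    qed
    have nz: "L z \<noteq> 0" if "Re z > 1/2" for z
      unfolding L_def by (rule nonprincipal_L_nonzero[OF grh d that])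
    have upper: "norm (L z) < c1 * real q" if "z \<in> ball 2 (7/5)" for z
    proof -
      have "norm (L z) \<le> 2 * real q * (1 + norm z * (\<Sum>n. real (Suc n) powr (- (3/5 + 1))))"
        unfolding L_def
        by (rule periodic_series_bound[OF nonprincipal_mean_zero[OF d] norm_dirichlet_char_le[OF d(1)] nonprincipal_L(2)[OF d]])
          (use Re_ball[OF that] in auto)
      also have "\<dots> \<le> 2 * real q * (1 + 4 * Z)"
        unfolding Z_def[symmetric] using Re_ball[OF that] Z0 by (intro mult_left_mono add_left_mono mult_right_mono) auto
      also have "\<dots> < c1 * real q" using q Z0 by (simp add: c1_def algebra_simps)
      finally show ?thesis .
    qed
    have L2: "norm (1 / L 2) \<le> K0"
    proof -
      have eq: "1 / L 2 = (\<Sum>n. of_real (inv_coeff 1 (Suc n)) * chi (Suc n) * of_nat (Suc n) powr (-2))"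
        using nonprincipal_L_power_inverse(2)[OF d, of 2 1] by (simp add: L_def)
      have "norm (of_real (inv_coeff 1 (Suc n)) * chi (Suc n) * of_nat (Suc n) powr (-2 :: complex)) \<le> C * real (Suc n) powr (- (3/2))" for n
      proof -
        have "norm (of_real (inv_coeff 1 (Suc n)) * chi (Suc n)) \<le> C * real (Suc n) powr (1/2) * 1"
          unfolding norm_mult norm_of_real by (intro mult_mono C norm_dirichlet_char_le[OF d(1)]) (use C(1) in auto)
        then have "norm (of_real (inv_coeff 1 (Suc n)) * chi (Suc n) * of_nat (Suc n) powr (-2 :: complex))
            \<le> (C * real (Suc n) powr (1/2) * 1) * real (Suc n) powr -2"
          unfolding norm_mult[of _ "of_nat (Suc n) powr (-2)"] norm_of_nat_powr by (intro mult_mono) (use C(1) in auto)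
        also have "\<dots> = C * real (Suc n) powr (- (3/2))"
          by (simp add: powr_add[symmetric] del: of_nat_Suc)
        finally show ?thesis .
      qed
      then have "norm (1 / L 2) \<le> (\<Sum>n. C * real (Suc n) powr (- (3/2)))"
        unfolding eq by (intro norm_suminf_le summable_mult smW)
      also have "\<dots> = K0" unfolding K0_def W_def by (rule suminf_mult[OF smW])
      finally show ?thesis .
    qed
    have L2nz: "L 2 \<noteq> 0" by (rule nz) simp
    define u where "u = c1 * real q / norm (L 2)"
    have u1: "u > 1" using upper[of 2] L2nz by (simp add: u_def)
    have "norm (L 2) * exp (- (2 * (5/4) / (7/5 - 5/4)) * ln u) \<le> norm (L z)"
      unfolding u_def
    proof (rule nonvanishing_lower_bound[OF _ _ _ _ upper z])
      show "L holomorphic_on ball 2 (7/5)" unfolding L_def using nonprincipal_L(1)[OF d] holomorphic_on_subset by blast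
      show "L z \<noteq> 0" if "z \<in> ball 2 (7/5)" for z using nz[of z] Re_ball(1)[OF that] by simp
    qed auto
    \<comment> \<open>Rounding 50/3 up to 17 weakens the lower bound because
      \<open>u > 1\<close>.\<close>
    moreover have "exp (- 17 * ln u) \<le> exp (- (2 * (5/4) / (7/5 - 5/4)) * ln u)"
      using u1 by (simp add: mult_right_mono)
    then have "norm (L 2) * exp (- 17 * ln u) \<le> norm (L 2) * exp (- (2 * (5/4) / (7/5 - 5/4)) * ln u)"
      by (intro mult_left_mono) auto
    moreover have "exp (- 17 * ln u) = 1 / u ^ 17"
    proof -
      have "exp (17 * ln u) = u ^ 17" using u1 exp_of_nat_mult[of 17 "ln u"] by simp
      then show ?thesis by (simp add: exp_minus divide_inverse)
    qed
    ultimately have low: "norm (L 2) / u ^ 17 \<le> norm (L z)" by simp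
    have pos: "norm (L 2) / u ^ 17 > 0" using u1 L2nz by simp
    have "norm (1 / L z) \<le> 1 / (norm (L 2) / u ^ 17)"
      unfolding norm_divide norm_one
      by (rule divide_left_mono[OF low _ mult_pos_pos[OF less_le_trans[OF pos low] pos]]) simp
    also have "\<dots> = norm (1 / L 2) ^ 18 * (c1 * real q) ^ 17"
      using L2nz by (simp add: u_def norm_divide power_divide divide_simps flip: power_Suc)
    also have "\<dots> \<le> K0 ^ 18 * (c1 * real q) ^ 17"
      using L2 c1 q by (intro mult_right_mono power_mono) auto
    also have "\<dots> = K * real q ^ 17" by (simp add: K_def power_mult_distrib)
    finally show ?thesis by (simp add: L_def)
  qed
  moreover have "K > 0" using K0 c1 by (simp add: K_def)
  ultimately show ?thesis using that by blast
qed

definition smoothed_coeff :: "nat \<Rightarrow> nat \<Rightarrow> nat \<Rightarrow> real" where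
  "smoothed_coeff k J n = inv_coeff k n * (poisson_weight J n / real n)"

lemma smoothed_coeff_0 [simp]: "smoothed_coeff k J 0 = 0"
  by (simp add: smoothed_coeff_def)

text \<open>The constant does not depend on \<open>q\<close>, \<open>chi\<close> or
  \<open>J\<close>, so \<open>J\<close> may be chosen in terms of \<open>q\<close>: the power
  \<open>q ^ (17 * k)\<close> from the bound on the disc is beaten by \<open>(4/5) ^ J\<close> with
  \<open>J\<close> of order \<open>ln q\<close>.\<close>

lemma L_power_inverse_approx:
  assumes grh: GRH
  shows "\<exists>K>0. \<forall>q chi J. dirichlet_char q chi \<and> chi \<noteq> principal_char q \<longrightarrow>
    (\<exists>T. (\<lambda>n. chi n * of_real (smoothed_coeff k J n)) sums T \<and>
      norm (1 / dirichlet_L q chi 1 ^ k - T) \<le> K * real q ^ (17 * k) * (4/5) ^ J)"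
proof -
  obtain K where K: "K > 0" "\<And>q chi z. dirichlet_char q chi \<Longrightarrow> chi \<noteq> principal_char q \<Longrightarrow> z \<in> cball 2 (5/4) \<Longrightarrow>
    norm (1 / dirichlet_L q chi z) \<le> K * real q ^ 17"
    using nonprincipal_L_inverse_bound[OF grh] by blast
  \<comment> \<open>Growth 1/4 keeps the series absolutely convergent down to
    \<open>Re s = 3/2\<close>, with exponent \<open>1/4 - 3/2 = -5/4\<close>.\<close>
  obtain C where C: "C > 0" "\<And>n. \<bar>inv_coeff k n\<bar> \<le> C * real n powr (1/4)"
    using inv_coeff_bound[of "1/4" k] by auto
  have smW: "summable (\<lambda>n. real (Suc n) powr (- (5/4)))"
    by (subst summable_Suc_iff) (simp add: summable_real_powr_iff)
  have "\<exists>T. (\<lambda>n. chi n * of_real (smoothed_coeff k J n)) sums T \<and>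
      norm (1 / dirichlet_L q chi 1 ^ k - T) \<le> (4 * K ^ k) * real q ^ (17 * k) * (4/5) ^ J"
    if d: "dirichlet_char q chi" "chi \<noteq> principal_char q" for q chi J
  proof -
    define a where "a = (\<lambda>n. of_real (inv_coeff k (Suc n)) * chi (Suc n))"
    define f where "f = (\<lambda>s. 1 / dirichlet_L q chi s ^ k)"
    have Re_ge: "Re z > 1/2" if "z \<in> cball 2 (5/4)" for z
      using that abs_Re_le_cmod[of "2 - z"] by (simp add: dist_norm)
    have "dirichlet_L q chi holomorphic_on cball 2 (5/4)"
      using nonprincipal_L(1)[OF d] holomorphic_on_subset by blast
    then have hol: "f holomorphic_on cball 2 (5/4)"
      unfolding f_def using nonprincipal_L_nonzero[OF grh d Re_ge] by (intro holomorphic_intros) auto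
    have B: "norm (f z) \<le> K ^ k * real q ^ (17 * k)" if "z \<in> cball 2 (5/4)" for z
    proof -
      have "norm (f z) = norm (1 / dirichlet_L q chi z) ^ k" by (simp add: f_def norm_divide norm_power power_divide)
      also have "\<dots> \<le> (K * real q ^ 17) ^ k" using K(2)[OF d that] by (intro power_mono) auto
      finally show ?thesis by (simp add: power_mult_distrib power_mult)
    qed
    have summ: "summable (\<lambda>n. norm (a n) * real (Suc n) powr (- (3/2)))"
    proof (rule summable_comparison_test'[OF summable_mult[OF smW, of C]])
      fix n :: nat
      have "norm (a n) \<le> C * real (Suc n) powr (1/4) * 1"
        unfolding a_def norm_mult norm_of_real by (intro mult_mono C norm_dirichlet_char_le[OF d(1)]) (use C(1) in auto)
      then have "norm (a n) * real (Suc n) powr (- (3/2)) \<le> (C * real (Suc n) powr (1/4) * 1) * real (Suc n) powr (- (3/2))"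
        by (intro mult_right_mono) auto
      also have "\<dots> = C * real (Suc n) powr (- (5/4))" by (simp add: powr_add[symmetric] del: of_nat_Suc)
      finally show "norm (norm (a n) * real (Suc n) powr (- (3/2))) \<le> C * real (Suc n) powr (- (5/4))" by simp
    qed
    have ser: "f s = (\<Sum>n. a n * of_nat (Suc n) powr (-s))" if "Re s > 3/2" for s
      unfolding f_def a_def by (rule nonprincipal_L_power_inverse(2)[OF d]) (use that in simp)
    obtain T where T: "(\<lambda>n. a n * of_real (poisson_weight J (Suc n) / real (Suc n))) sums T"
      "norm (f 1 - T) \<le> 4 * (K ^ k * real q ^ (17 * k)) * (4/5) ^ J"
      using dirichlet_series_taylor[OF hol subset_refl B summ ser] by blast
    have "(\<lambda>n. chi (Suc n) * of_real (smoothed_coeff k J (Suc n))) sums T"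
      using T(1) by (simp add: a_def smoothed_coeff_def mult_ac del: of_nat_Suc)
    then have "(\<lambda>n. chi n * of_real (smoothed_coeff k J n)) sums T"
      using sums_Suc[of "\<lambda>n. chi n * of_real (smoothed_coeff k J n)"] by simp
    then show ?thesis using T(2) by (intro exI[of _ T]) (simp add: f_def mult_ac)
  qed
  moreover have "4 * K ^ k > 0" using K(1) by simp
  ultimately show ?thesis by blast
qed

text \<open>With \<open>r = exp (- \<theta>)\<close> the Chernoff cost \<open>(1 / r) ^ J\<close> is
  exactly \<open>exp (\<theta> * J)\<close> and the gain is \<open>n powr (r - 1)\<close>. Half of
  the gain absorbs the coefficients and the other half is the \<open>\<eta>\<close> that remains for
  convergence.\<close>

lemma smoothed_coeff_bound:
  assumes \<theta>: "\<theta> > 0"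
  shows "\<exists>C>0. \<exists>\<eta>>0. \<forall>J. \<forall>n>0. \<bar>smoothed_coeff k J n\<bar> \<le> C * exp (\<theta> * real J) * real n powr (- 1 - \<eta>)"
proof -
  define r where "r = exp (- \<theta>)"
  have r: "0 < r" "r < 1" using \<theta> by (auto simp: r_def)
  define \<eta> where "\<eta> = (1 - r) / 2"
  have \<eta>: "\<eta> > 0" using r by (simp add: \<eta>_def)
  obtain C where C: "C > 0" "\<And>n. \<bar>inv_coeff k n\<bar> \<le> C * real n powr \<eta>"
    using inv_coeff_bound[OF \<eta>] by blast
  have "\<bar>smoothed_coeff k J n\<bar> \<le> C * exp (\<theta> * real J) * real n powr (- 1 - \<eta>)" if n: "n > 0" for J n
  proof -
    have "\<bar>smoothed_coeff k J n\<bar> = \<bar>inv_coeff k n\<bar> * (poisson_weight J n / real n)"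
      using poisson_weight_nonneg[of J n] by (simp add: smoothed_coeff_def abs_mult)
    also have "\<dots> \<le> (C * real n powr \<eta>) * (((1 / r) ^ J * real n powr (r - 1)) / real n)"
      using n r C poisson_weight_nonneg[of J n]
      by (intro mult_mono divide_right_mono poisson_weight_le_powr) auto
    also have "(1 / r) ^ J = exp (\<theta> * real J)"
    proof -
      have "1 / r = exp \<theta>" by (simp add: r_def exp_minus divide_inverse)
      then show ?thesis by (simp add: exp_of_nat_mult[symmetric] mult.commute)
    qed
    also have "(C * real n powr \<eta>) * ((exp (\<theta> * real J) * real n powr (r - 1)) / real n)
        = C * exp (\<theta> * real J) * (real n powr \<eta> * real n powr (r - 1) * real n powr (-1))"
      using n by (simp add: powr_minus divide_inverse)
    also have "real n powr \<eta> * real n powr (r - 1) * real n powr (-1) = real n powr (- 1 - \<eta>)"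
      unfolding powr_add[symmetric] by (simp add: \<eta>_def field_simps)
    finally show ?thesis .
  qed
  then show ?thesis using C(1) \<eta> by blast
qed

section \<open>Sums over residue classes\<close>

lemma character_sum_by_residues:
  assumes q: "q \<ge> 2" and d: "dirichlet_char q chi" and b: "\<And>i. summable (\<lambda>l. b (i + l * q))"
    and T: "(\<lambda>n. chi n * of_real (b n)) sums T"
  shows "T = (\<Sum>a\<in>totatives q. chi a * of_real (\<Sum>l. b (a + l * q)))"
proof -
  have "(\<lambda>l. sum (\<lambda>n. chi n * of_real (b n)) {l * q..<l * q + q}) sums T"
    by (rule sums_group[OF T]) (use q in simp)
  moreover have "sum (\<lambda>n. chi n * of_real (b n)) {l * q..<l * q + q} = (\<Sum>i<q. chi i * of_real (b (i + l * q)))" for l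
  proof -
    have "sum (\<lambda>n. chi n * of_real (b n)) {0 + l * q..<q + l * q} = (\<Sum>i\<in>{0..<q}. chi (i + l * q) * of_real (b (i + l * q)))"
      by (rule sum.shift_bounds_nat_ivl)
    then show ?thesis using dirichlet_char_period[OF d] by (simp add: add.commute lessThan_atLeast0)
  qed
  ultimately have 1: "(\<lambda>l. \<Sum>i<q. chi i * of_real (b (i + l * q))) sums T" by simp
  have "(\<lambda>l. \<Sum>i<q. chi i * of_real (b (i + l * q))) sums (\<Sum>i<q. chi i * of_real (\<Sum>l. b (i + l * q)))"
    by (intro sums_sum sums_mult sums_of_real summable_sums b)
  with 1 have "T = (\<Sum>i<q. chi i * of_real (\<Sum>l. b (i + l * q)))" by (rule sums_unique2)
  then show ?thesis using sum_dirichlet_char_totatives[OF q d] by simp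
qed

text \<open>In each class \<open>B a = b a + \<rho> a\<close>, where \<open>\<rho> a\<close>
  collects the terms beyond the first and is at most \<open>H * Z / q\<close>; since the
  \<open>b a\<close> have total mass at most \<open>H * Z\<close>, the products involving some
  \<open>\<rho>\<close> cost \<open>O (1 / q)\<close> after summation. In
  \<open>b a * b (q - a)\<close> one of the two indices is at least \<open>q / 2\<close>, so that
  factor is at most \<open>2 * H / q\<close>.\<close>

lemma residue_sums_estimate:
  fixes b :: "nat \<Rightarrow> real"
  assumes q: "q \<ge> 2" and H: "H \<ge> 0" and \<eta>: "\<eta> > 0"
    and bound: "\<forall>n>0. \<bar>b n\<bar> \<le> H * real n powr (- 1 - \<eta>)"
  defines "Z \<equiv> (\<Sum>n. real (Suc n) powr (- 1 - \<eta>))" and "B \<equiv> (\<lambda>a. \<Sum>l. b (a + l * q))"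
  shows "summable (\<lambda>l. b (i + l * q))"
    and "(\<Sum>a\<in>totatives q. \<bar>B a\<bar>) \<le> 2 * H * Z"
    and "\<bar>(\<Sum>a\<in>totatives q. (B a)\<^sup>2) - (\<Sum>a\<in>totatives q. (b a)\<^sup>2)\<bar> \<le> 3 * (H * Z)\<^sup>2 / q"
    and "\<bar>\<Sum>a\<in>totatives q. B a * B (q - a)\<bar> \<le> (4 * H\<^sup>2 * Z + 3 * (H * Z)\<^sup>2) / q"
proof -
  have b: "\<bar>b n\<bar> \<le> H * real n powr (- 1 - \<eta>)" if "n > 0" for n using bound that by blast
  have q0: "real q > 0" "real q \<ge> 1" using q by auto
  have smZ: "summable (\<lambda>n. real (Suc n) powr (- 1 - \<eta>))"
    using \<eta> by (subst summable_Suc_iff) (simp add: summable_real_powr_iff)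
  have Z0: "Z \<ge> 0" unfolding Z_def by (intro suminf_nonneg smZ) auto
  have sum_le_Z: "(\<Sum>a\<in>A. real a powr (- 1 - \<eta>)) \<le> Z" if "finite A" "0 \<notin> A" for A
  proof -
    have inj: "inj_on (\<lambda>a. a - 1) A" using that(2) by (intro inj_onI) (metis Suc_diff_1 gr0I)
    have "(\<Sum>a\<in>A. real a powr (- 1 - \<eta>)) = (\<Sum>n\<in>(\<lambda>a. a - 1) ` A. real (Suc n) powr (- 1 - \<eta>))"
    proof (subst sum.reindex[OF inj], rule sum.cong)
      fix a assume "a \<in> A"
      then have "a > 0" using that(2) by (metis gr0I)
      then show "real a powr (- 1 - \<eta>) = ((\<lambda>n. real (Suc n) powr (- 1 - \<eta>)) \<circ> (\<lambda>a. a - 1)) a" by simp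
    qed simp
    also have "\<dots> \<le> Z" unfolding Z_def by (rule sum_le_suminf[OF smZ]) (use that(1) in auto)
    finally show ?thesis .
  qed
  have tail: "\<bar>b (i + Suc l * q)\<bar> \<le> H / q * real (Suc l) powr (- 1 - \<eta>)" for i l
  proof -
    have "\<bar>b (i + Suc l * q)\<bar> \<le> H * real (i + Suc l * q) powr (- 1 - \<eta>)" by (rule b) (use q in simp)
    also have "\<dots> \<le> H * real (Suc l * q) powr (- 1 - \<eta>)"
    proof -
      have "0 < real (Suc l * q)" unfolding of_nat_0_less_iff using q by simp
      from mult_left_mono[OF powr_mono2'[OF _ this] H] show ?thesis using \<eta> by simp
    qed
    also have "real (Suc l * q) powr (- 1 - \<eta>) = real (Suc l) powr (- 1 - \<eta>) * real q powr (- 1 - \<eta>)"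
      unfolding of_nat_mult by (rule powr_mult)
    also have "H * (real (Suc l) powr (- 1 - \<eta>) * real q powr (- 1 - \<eta>)) \<le> H * (real (Suc l) powr (- 1 - \<eta>) * real q powr (- 1))"
      using H \<eta> q0 by (intro mult_left_mono powr_mono) auto
    also have "\<dots> = H / q * real (Suc l) powr (- 1 - \<eta>)" using q0 by (simp add: powr_minus divide_inverse)
    finally show ?thesis .
  qed
  have smt: "summable (\<lambda>l. b (i + Suc l * q))" for i
    by (rule summable_comparison_test'[OF summable_mult[OF smZ, of "H / q"]]) (use tail in simp)
  then have smb: "summable (\<lambda>l. b (i + l * q))" for i
    using summable_Suc_iff[of "\<lambda>l. b (i + l * q)"] by blast
  then show "summable (\<lambda>l. b (i + l * q))" .
  define \<rho> where "\<rho> = (\<lambda>a. \<Sum>l. b (a + Suc l * q))"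
  have B: "B a = b a + \<rho> a" for a
    using suminf_split_head[OF smb[of a]] by (simp add: B_def \<rho>_def)
  define R where "R = H * Z / q"
  have R0: "R \<ge> 0" using H Z0 by (simp add: R_def)
  have \<rho>: "\<bar>\<rho> a\<bar> \<le> R" for a
  proof -
    have "norm (\<rho> a) \<le> (\<Sum>l. H / q * real (Suc l) powr (- 1 - \<eta>))"
      unfolding \<rho>_def by (rule norm_suminf_le) (use tail smZ in \<open>auto intro!: summable_mult\<close>)
    also have "\<dots> = R" unfolding R_def Z_def by (subst suminf_mult[OF smZ]) simp
    finally show ?thesis by simp
  qed
  define S where "S = (\<Sum>a\<in>totatives q. \<bar>b a\<bar>)"
  have tot: "a > 0" "a < q" if "a \<in> totatives q" for a
    using that q totatives_less by (auto simp: in_totatives_iff)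
  have S: "S \<le> H * Z"
  proof -
    have "S \<le> (\<Sum>a\<in>totatives q. H * real a powr (- 1 - \<eta>))"
      unfolding S_def using b tot by (intro sum_mono) auto
    also have "\<dots> = H * (\<Sum>a\<in>totatives q. real a powr (- 1 - \<eta>))" by (simp add: sum_distrib_left)
    also have "\<dots> \<le> H * Z" using H by (intro mult_left_mono sum_le_Z) (auto simp: in_totatives_iff)
    finally show ?thesis .
  qed
  have S0: "S \<ge> 0" by (simp add: S_def sum_nonneg)
  have card: "real (card (totatives q)) \<le> q" using q totient_le[of q] unfolding totient_def by simp
  have cR: "real (card (totatives q)) * R \<le> H * Z"
    using mult_right_mono[OF card R0] q0 by (simp add: R_def)
  have BR: "\<bar>B a\<bar> \<le> \<bar>b a\<bar> + R" for a using B[of a] \<rho>[of a] by linarith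
  then have "(\<Sum>a\<in>totatives q. \<bar>B a\<bar>) \<le> (\<Sum>a\<in>totatives q. \<bar>b a\<bar> + R)"
    by (rule sum_mono)
  also have "\<dots> = S + real (card (totatives q)) * R" by (simp add: sum.distrib S_def)
  finally show "(\<Sum>a\<in>totatives q. \<bar>B a\<bar>) \<le> 2 * H * Z" using S cR by linarith
  have "(\<Sum>a\<in>totatives q. (B a)\<^sup>2) - (\<Sum>a\<in>totatives q. (b a)\<^sup>2) = (\<Sum>a\<in>totatives q. 2 * b a * \<rho> a + (\<rho> a)\<^sup>2)"
    unfolding sum_subtractf[symmetric] B by (rule sum.cong) (auto simp: power2_eq_square algebra_simps)
  also have "\<bar>\<dots>\<bar> \<le> (\<Sum>a\<in>totatives q. 2 * \<bar>b a\<bar> * R + R * R)"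
  proof (rule order_trans[OF sum_abs], rule sum_mono)
    fix a
    have "\<bar>2 * b a * \<rho> a\<bar> \<le> 2 * \<bar>b a\<bar> * R" using \<rho>[of a] by (simp add: abs_mult mult_left_mono)
    moreover have "\<bar>(\<rho> a)\<^sup>2\<bar> \<le> R * R" using mult_mono[OF \<rho>[of a] \<rho>[of a]] R0 by (simp add: power2_eq_square)
    ultimately show "\<bar>2 * b a * \<rho> a + (\<rho> a)\<^sup>2\<bar> \<le> 2 * \<bar>b a\<bar> * R + R * R" by linarith
  qed
  also have "\<dots> = 2 * S * R + real (card (totatives q)) * R * R"
    by (simp add: sum.distrib S_def sum_distrib_left sum_distrib_right)
  also have "\<dots> \<le> 2 * (H * Z) * R + (H * Z) * R"
    using S cR R0 by (intro add_mono mult_right_mono mult_left_mono) auto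
  also have "\<dots> = 3 * (H * Z)\<^sup>2 / q" by (simp add: R_def power2_eq_square)
  finally show "\<bar>(\<Sum>a\<in>totatives q. (B a)\<^sup>2) - (\<Sum>a\<in>totatives q. (b a)\<^sup>2)\<bar> \<le> 3 * (H * Z)\<^sup>2 / q" .
  note qa = totatives_diff[OF q]
  have qq: "q - (q - a) = a" if "a \<in> totatives q" for a using tot[OF that] by simp
  have refl: "(\<Sum>a\<in>totatives q. \<bar>b (q - a)\<bar>) = S"
    unfolding S_def
    by (rule sum.reindex_bij_witness[of _ "\<lambda>a. q - a" "\<lambda>a. q - a"]) (use qa qq in auto)
  have big: "\<bar>b n\<bar> \<le> 2 * H / q" if "n > 0" "2 * n \<ge> q" for n
  proof -
    have "\<bar>b n\<bar> \<le> H * real n powr (- 1 - \<eta>)" by (rule b[OF that(1)])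
    also have "\<dots> \<le> H * real n powr (-1)" using H \<eta> that(1) by (intro mult_left_mono powr_mono) auto
    also have "\<dots> = H * (1 / real n)" by (simp add: powr_minus divide_inverse)
    also have "\<dots> \<le> H * (2 / q)"
    proof (rule mult_left_mono[OF _ H])
      have "real q \<le> 2 * real n" using that(2) by linarith
      then show "1 / real n \<le> 2 / real q" using that(1) q0 by (simp add: field_simps)
    qed
    finally show ?thesis by (simp add: mult.commute)
  qed
  have "\<bar>\<Sum>a\<in>totatives q. B a * B (q - a)\<bar>
      \<le> (\<Sum>a\<in>totatives q. 2 * H / q * (\<bar>b a\<bar> + \<bar>b (q - a)\<bar>) + R * (\<bar>b a\<bar> + \<bar>b (q - a)\<bar>) + R * R)"
  proof (rule order_trans[OF sum_abs], rule sum_mono)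
    fix a assume a: "a \<in> totatives q"
    have bb: "\<bar>b a\<bar> * \<bar>b (q - a)\<bar> \<le> 2 * H / q * (\<bar>b a\<bar> + \<bar>b (q - a)\<bar>)"
    proof (cases "2 * a \<ge> q")
      case True
      then have "\<bar>b a\<bar> * \<bar>b (q - a)\<bar> \<le> 2 * H / q * \<bar>b (q - a)\<bar>" using big[of a] tot[OF a] by (intro mult_right_mono) auto
      also have "\<dots> \<le> 2 * H / q * (\<bar>b a\<bar> + \<bar>b (q - a)\<bar>)" using H by (intro mult_left_mono) auto
      finally show ?thesis .
    next
      case False
      then have "\<bar>b (q - a)\<bar> * \<bar>b a\<bar> \<le> 2 * H / q * \<bar>b a\<bar>" using big[of "q - a"] tot[OF a] by (intro mult_right_mono) auto
      also have "\<dots> \<le> 2 * H / q * (\<bar>b a\<bar> + \<bar>b (q - a)\<bar>)" using H by (intro mult_left_mono) auto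
      finally show ?thesis by (simp add: mult.commute)
    qed
    have "\<bar>B a * B (q - a)\<bar> \<le> (\<bar>b a\<bar> + R) * (\<bar>b (q - a)\<bar> + R)"
      unfolding abs_mult using R0 by (intro mult_mono BR) auto
    also have "\<dots> = \<bar>b a\<bar> * \<bar>b (q - a)\<bar> + R * (\<bar>b a\<bar> + \<bar>b (q - a)\<bar>) + R * R" by (simp add: algebra_simps)
    finally show "\<bar>B a * B (q - a)\<bar> \<le> 2 * H / q * (\<bar>b a\<bar> + \<bar>b (q - a)\<bar>) + R * (\<bar>b a\<bar> + \<bar>b (q - a)\<bar>) + R * R"
      using bb by linarith
  qed
  also have "\<dots> = 2 * H / q * (S + S) + R * (S + S) + real (card (totatives q)) * R * R"
  proof -
    have "(\<Sum>a\<in>totatives q. \<bar>b a\<bar> + \<bar>b (q - a)\<bar>) = S + S" by (simp add: sum.distrib refl S_def[symmetric])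
    then have s1: "(\<Sum>a\<in>totatives q. c * (\<bar>b a\<bar> + \<bar>b (q - a)\<bar>)) = c * (S + S)" for c
      by (simp only: sum_distrib_left[symmetric])
    show ?thesis unfolding sum.distrib s1 by (simp add: mult.assoc)
  qed
  also have "\<dots> \<le> 2 * H / q * (H * Z + H * Z) + R * (H * Z + H * Z) + (H * Z) * R"
    using S cR R0 H by (intro add_mono mult_right_mono mult_left_mono) auto
  also have "\<dots> = (4 * H\<^sup>2 * Z + 3 * (H * Z)\<^sup>2) / q" using q0 by (simp add: R_def power2_eq_square field_simps)
  finally show "\<bar>\<Sum>a\<in>totatives q. B a * B (q - a)\<bar> \<le> (4 * H\<^sup>2 * Z + 3 * (H * Z)\<^sup>2) / q" .
qed

section \<open>The diagonal\<close>

text \<open>The diagonal main term: \<open>C_const k\<close> divided by the local factors at the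
  primes dividing \<open>q\<close>, as \<open>C_const_factor\<close> shows.\<close>

definition coprime_square_sum :: "nat \<Rightarrow> nat \<Rightarrow> real" where
  "coprime_square_sum k q = (\<Sum>n. if coprime n q then (inv_coeff k n)\<^sup>2 / (real n)\<^sup>2 else 0)"

lemma summable_inv_coeff_square:
  assumes "s > 1"
  shows "summable (\<lambda>n. (inv_coeff k n)\<^sup>2 * real n powr (-s))"
proof -
  define \<eta> where "\<eta> = (s - 1) / 4"
  have \<eta>: "\<eta> > 0" "2 * \<eta> - s < -1" using assms by (auto simp: \<eta>_def field_simps)
  obtain C where C: "C > 0" "\<And>n. \<bar>inv_coeff k n\<bar> \<le> C * real n powr \<eta>"
    using inv_coeff_bound[OF \<eta>(1)] by blast
  show ?thesis
  proof (rule summable_comparison_test')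
    show "summable (\<lambda>n. C\<^sup>2 * real n powr (2 * \<eta> - s))"
      using \<eta>(2) by (intro summable_mult) (simp add: summable_real_powr_iff)
    fix n :: nat
    have "(inv_coeff k n)\<^sup>2 \<le> (C * real n powr \<eta>)\<^sup>2"
      using C(2)[of n] by (metis abs_ge_zero power2_abs power_mono)
    then have "(inv_coeff k n)\<^sup>2 * real n powr (-s) \<le> (C * real n powr \<eta>)\<^sup>2 * real n powr (-s)"
      by (intro mult_right_mono) auto
    also have "\<dots> = C\<^sup>2 * (real n powr \<eta> * real n powr \<eta> * real n powr (-s))" by (simp add: power2_eq_square)
    also have "real n powr \<eta> * real n powr \<eta> * real n powr (-s) = real n powr (2 * \<eta> - s)"
      unfolding powr_add[symmetric] by simp
    finally show "norm ((inv_coeff k n)\<^sup>2 * real n powr (-s)) \<le> C\<^sup>2 * real n powr (2 * \<eta> - s)" by simp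
  qed
qed

lemma inv_square_eq_powr: "x / (real n)\<^sup>2 = x * real n powr (-2)"
  by (cases "n = 0") (simp_all add: powr_minus powr_numeral divide_inverse)

lemma summable_coprime_squares:
  "summable (\<lambda>n. if coprime n q then (inv_coeff k n)\<^sup>2 / (real n)\<^sup>2 else 0)"
  by (rule summable_comparison_test'[OF summable_inv_coeff_square[of 2 k]]) (auto simp: inv_square_eq_powr)

lemma local_factor_ge_1: "local_factor k p \<ge> 1"
proof -
  have "(\<Sum>j\<in>{0}. real (k choose j) ^ 2 / real p ^ (2 * j)) \<le> local_factor k p"
    unfolding local_factor_def by (rule sum_mono2) auto
  then show ?thesis by simp
qed

text \<open>Squaring removes the signs of the coefficients at prime powers, so the local sums are
  the finite sums \<open>local_factor\<close>, or 1 where coprimality kills all but the zeroth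
  power.\<close>

lemma coprime_square_sum_euler:
  "(\<lambda>N. \<Prod>p | prime p \<and> p \<le> N. if p dvd q then 1 else local_factor k p) \<longlonglongrightarrow> coprime_square_sum k q"
proof -
  define f where "f = (\<lambda>n. if coprime n q then (inv_coeff k n)\<^sup>2 / (real n)\<^sup>2 else 0)"
  have "(\<lambda>N. \<Prod>p | prime p \<and> p \<le> N. \<Sum>j. f (p ^ j)) \<longlonglongrightarrow> (\<Sum>n. f n)"
  proof (rule euler_product)
    show "f (m * n) = f m * f n" if "coprime m n" for m n
      using inv_coeff_mult[OF that, of k] by (simp add: f_def power_mult_distrib)
    have "summable f" unfolding f_def by (rule summable_coprime_squares)
    moreover have "norm (f n) = f n" for n by (simp add: f_def)
    ultimately show "summable (\<lambda>n. norm (f n))" by simp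
  qed (auto simp: f_def)
  moreover have "(\<Sum>j. f (p ^ j)) = (if p dvd q then 1 else local_factor k p)" if p: "prime p" for p
  proof (cases "p dvd q")
    case True
    have "f (p ^ j) = (if j = 0 then 1 else 0)" for j
    proof (cases "j = 0")
      case False
      then have "p dvd p ^ j" by simp
      then have "\<not> coprime (p ^ j) q" using True p by (metis coprime_common_divisor not_prime_unit)
      then show ?thesis using False by (simp add: f_def)
    qed (simp add: f_def)
    then have "(\<lambda>j. f (p ^ j)) sums 1" using sums_single[of 0 "\<lambda>_. 1::real"] by simp
    then show ?thesis using True by (simp add: sums_iff)
  next
    case False
    have "f (p ^ j) = real (k choose j) ^ 2 / real p ^ (2 * j)" for j
    proof -
      have "coprime (p ^ j) q" using False p by (simp add: prime_imp_coprime)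
      then show ?thesis
        by (simp add: f_def inv_coeff_prime_power[OF p] power_mult_distrib power_mult[symmetric] mult.commute)
    qed
    then have "(\<lambda>j. f (p ^ j)) sums (\<Sum>j\<in>{0..k}. real (k choose j) ^ 2 / real p ^ (2 * j))"
      using sums_finite[of "{0..k}" "\<lambda>j. f (p ^ j)"] by simp
    then show ?thesis using False by (simp add: sums_iff local_factor_def)
  qed
  then have "(\<Prod>p | prime p \<and> p \<le> N. \<Sum>j. f (p ^ j)) = (\<Prod>p | prime p \<and> p \<le> N. if p dvd q then 1 else local_factor k p)" for N
    by (intro prod.cong) auto
  ultimately show ?thesis unfolding coprime_square_sum_def f_def by simp
qed

lemma coprime_square_sum_ge_1: "coprime_square_sum k q \<ge> 1"
proof -
  have "(\<Sum>n\<in>{1}. if coprime n q then (inv_coeff k n)\<^sup>2 / (real n)\<^sup>2 else 0) \<le> coprime_square_sum k q"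
    unfolding coprime_square_sum_def by (rule sum_le_suminf[OF summable_coprime_squares]) auto
  then show ?thesis by simp
qed

text \<open>\<open>C_const\<close> is a \<open>prodinf\<close> with factor 1 at nonprimes. It is
  tied to the limit of its partial products once these are known to converge to a nonzero value,
  which \<open>coprime_square_sum_ge_1\<close> guarantees.\<close>

lemma C_const_eq: "C_const k = coprime_square_sum k 1"
proof -
  define g where "g = (\<lambda>n. if prime n then local_factor k n else 1)"
  have "(\<Prod>i\<le>N. g i) = (\<Prod>p | prime p \<and> p \<le> N. if p dvd 1 then 1 else local_factor k p)" for N
  proof -
    have "(\<Prod>i\<le>N. g i) = (\<Prod>i\<in>{p. prime p \<and> p \<le> N}. g i)"
      by (rule prod.mono_neutral_right) (auto simp: g_def)
    also have "\<dots> = (\<Prod>p | prime p \<and> p \<le> N. if p dvd 1 then 1 else local_factor k p)"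
      by (rule prod.cong) (auto simp: g_def)
    finally show ?thesis .
  qed
  then have lim: "(\<lambda>N. \<Prod>i\<le>N. g i) \<longlonglongrightarrow> coprime_square_sum k 1"
    using coprime_square_sum_euler[of 1 k] by simp
  have "g i \<noteq> 0" for i using local_factor_ge_1[of k i] by (auto simp: g_def)
  moreover have "coprime_square_sum k 1 \<noteq> 0" using coprime_square_sum_ge_1[of k 1] by simp
  ultimately have "convergent_prod g" using lim convergent_prod_iff_nz_lim by blast
  then have "(\<lambda>N. \<Prod>i\<le>N. g i) \<longlonglongrightarrow> prodinf g" by (rule convergent_prod_LIMSEQ)
  with lim have "prodinf g = coprime_square_sum k 1" by (rule LIMSEQ_unique[rotated])
  then show ?thesis by (simp add: C_const_def g_def)
qed

text \<open>From \<open>N = q\<close> on, the partial Euler products differ exactly by the factors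
  at the primes dividing \<open>q\<close>.\<close>

lemma C_const_factor:
  assumes q: "q > 0"
  shows "C_const k = coprime_square_sum k q * (\<Prod>p\<in>prime_factors q. local_factor k p)"
proof -
  define P where "P = (\<Prod>p\<in>prime_factors q. local_factor k p)"
  have "(\<Prod>p | prime p \<and> p \<le> N. if p dvd 1 then 1 else local_factor k p)
      = (\<Prod>p | prime p \<and> p \<le> N. if p dvd q then 1 else local_factor k p) * P" if N: "N \<ge> q" for N
  proof -
    have "P = (\<Prod>p\<in>{p. prime p \<and> p \<le> N} \<inter> prime_factors q. local_factor k p)"
      unfolding P_def using q N by (intro prod.cong) (auto simp: in_prime_factors_iff dest!: dvd_imp_le)
    also have "\<dots> = (\<Prod>p | prime p \<and> p \<le> N. if p \<in> prime_factors q then local_factor k p else 1)"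
      by (rule prod.inter_restrict) auto
    finally show ?thesis
      using q by (simp only:) (auto simp: prod.distrib[symmetric] in_prime_factors_iff intro!: prod.cong)
  qed
  then have "\<forall>\<^sub>F N in sequentially. (\<Prod>p | prime p \<and> p \<le> N. if p dvd 1 then 1 else local_factor k p)
      = (\<Prod>p | prime p \<and> p \<le> N. if p dvd q then 1 else local_factor k p) * P"
    using eventually_ge_at_top[of q] by (rule eventually_mono[rotated])
  moreover have "(\<lambda>N. (\<Prod>p | prime p \<and> p \<le> N. if p dvd q then 1 else local_factor k p) * P) \<longlonglongrightarrow> coprime_square_sum k q * P"
    by (intro tendsto_intros coprime_square_sum_euler)
  ultimately have "(\<lambda>N. \<Prod>p | prime p \<and> p \<le> N. if p dvd 1 then 1 else local_factor k p) \<longlonglongrightarrow> coprime_square_sum k q * P"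
    by (simp only: tendsto_cong)
  then show ?thesis
    using LIMSEQ_unique[OF coprime_square_sum_euler[of 1 k]] by (simp add: C_const_eq P_def)
qed

text \<open>Each factor \<open>1 - 1 / p\<close> is at least 1/2, and a product of twos over the
  prime factors is \<open>O (q powr \<eta>)\<close>. This turns absolute error terms into terms
  relative to the totient.\<close>

lemma totient_lower_bound:
  assumes "\<eta> > 0"
  obtains c where "c > 0" "\<And>q. q > 0 \<Longrightarrow> real (totient q) \<ge> c * real q powr (1 - \<eta>)"
proof -
  obtain C where C: "C > 0" "\<And>n. n > 0 \<Longrightarrow> (\<Prod>p\<in>prime_factors n. 2) \<le> C * real n powr \<eta>"
    using prod_prime_factors_const_le[of 2 \<eta>] assms by auto
  have "real (totient q) \<ge> 1 / C * real q powr (1 - \<eta>)" if q: "q > 0" for q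
  proof -
    have "1 / C * real q powr (1 - \<eta>) = real q * (1 / (C * real q powr \<eta>))"
      using q by (simp add: powr_diff)
    also have "\<dots> \<le> real q * (1 / (\<Prod>p\<in>prime_factors q. 2))"
      using C q by (intro mult_left_mono divide_left_mono) (auto intro!: mult_pos_pos prod_pos)
    also have "1 / (\<Prod>p\<in>prime_factors q. 2) = (\<Prod>p\<in>prime_factors q. 1 / 2 :: real)"
      by (simp add: power_divide)
    also have "real q * \<dots> \<le> real q * (\<Prod>p\<in>prime_factors q. 1 - 1 / real p)"
    proof (intro mult_left_mono prod_mono conjI)
      fix p assume "p \<in> prime_factors q"
      then have "p \<ge> 2" using prime_ge_2_nat by (auto simp: in_prime_factors_iff)
      then show "1 / 2 \<le> 1 - 1 / real p" by (simp add: field_simps)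
    qed auto
    also have "\<dots> = real (totient q)" by (rule totient_formula2[symmetric])
    finally show ?thesis .
  qed
  moreover have "1 / C > 0" using C(1) by simp
  ultimately show ?thesis using that by blast
qed

text \<open>Two errors. Beyond \<open>q\<close> the sum of
  \<open>n powr (\<epsilon> / 2 - 2)\<close> is \<open>O (q powr (-1 + \<epsilon>))\<close>. Below
  \<open>q\<close> the square of the weight differs from 1 by at most
  \<open>2 * (2/3) ^ J * n powr (1/2)\<close>, by the Chernoff bound at \<open>R = 3/2\<close>, and
  the exponent \<open>-2 + 1/2\<close> still leaves a convergent sum.\<close>

lemma diagonal_estimate:
  assumes \<epsilon>: "0 < \<epsilon>" "\<epsilon> \<le> 1"
  shows "\<exists>K>0. \<forall>q J. q \<ge> 2 \<longrightarrow>
    \<bar>(\<Sum>a\<in>totatives q. (smoothed_coeff k J a)\<^sup>2) - coprime_square_sum k q\<bar> \<le> K * (real q powr (-1 + \<epsilon>) + (2/3) ^ J)"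
proof -
  define V where "V = (\<Sum>n. (inv_coeff k n)\<^sup>2 * real n powr (- (3/2)))"
  have smV: "summable (\<lambda>n. (inv_coeff k n)\<^sup>2 * real n powr (- (3/2)))" by (rule summable_inv_coeff_square) simp
  obtain C where C: "C > 0" "\<And>n. \<bar>inv_coeff k n\<bar> \<le> C * real n powr (\<epsilon> / 4)"
    using inv_coeff_bound[of "\<epsilon> / 4"] \<epsilon> by auto
  define W where "W = (\<Sum>n. real (Suc n) powr (- 1 - \<epsilon> / 2))"
  have smW: "summable (\<lambda>n. real (Suc n) powr (- 1 - \<epsilon> / 2))"
    using \<epsilon> by (subst summable_Suc_iff) (simp add: summable_real_powr_iff)
  have V0: "V \<ge> 0" unfolding V_def by (intro suminf_nonneg smV) auto
  have W0: "W \<ge> 0" unfolding W_def by (intro suminf_nonneg smW) auto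
  define K where "K = 2 * V + C\<^sup>2 * W + 1"
  have "\<bar>(\<Sum>a\<in>totatives q. (smoothed_coeff k J a)\<^sup>2) - coprime_square_sum k q\<bar> \<le> K * (real q powr (-1 + \<epsilon>) + (2/3) ^ J)"
    if q: "q \<ge> 2" for q J
  proof -
    define g where "g = (\<lambda>n. if coprime n q then (inv_coeff k n)\<^sup>2 / (real n)\<^sup>2 else 0)"
    define w where "w = poisson_weight J"
    have g0: "g n \<ge> 0" for n by (simp add: g_def)
    have gle: "g n \<le> (inv_coeff k n)\<^sup>2 * real n powr (-2)" for n by (simp add: g_def inv_square_eq_powr)
    have smg: "summable g" unfolding g_def by (rule summable_coprime_squares)
    have "(\<Sum>a\<in>totatives q. (smoothed_coeff k J a)\<^sup>2) = (\<Sum>n<q. g n * (w n)\<^sup>2)"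
    proof (rule sum.mono_neutral_cong_left)
      show "totatives q \<subseteq> {..<q}" using q totatives_less by auto
      show "\<forall>i\<in>{..<q} - totatives q. g i * (w i)\<^sup>2 = 0"
      proof
        fix i assume "i \<in> {..<q} - totatives q"
        then have "\<not> coprime i q" using q by (cases "i = 0") (auto simp: in_totatives_iff)
        then show "g i * (w i)\<^sup>2 = 0" by (simp add: g_def)
      qed
      show "(smoothed_coeff k J a)\<^sup>2 = g a * (w a)\<^sup>2" if "a \<in> totatives q" for a
        using that by (simp add: g_def w_def smoothed_coeff_def in_totatives_iff power_mult_distrib power_divide)
    qed auto
    moreover have "coprime_square_sum k q = (\<Sum>l. g (l + q)) + (\<Sum>n<q. g n)"
      using suminf_split_initial_segment[OF smg, of q] by (simp add: coprime_square_sum_def g_def)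
    ultimately have eq: "coprime_square_sum k q - (\<Sum>a\<in>totatives q. (smoothed_coeff k J a)\<^sup>2)
        = (\<Sum>l. g (l + q)) + (\<Sum>n<q. g n * (1 - (w n)\<^sup>2))"
      by (simp add: sum_subtractf algebra_simps)
    have w: "0 \<le> w n" "w n \<le> 1" if "n > 0" for n
      using poisson_weight_nonneg one_minus_poisson_weight(2)[OF that order.refl] by (auto simp: w_def)
    have head: "0 \<le> g n * (1 - (w n)\<^sup>2) \<and> g n * (1 - (w n)\<^sup>2) \<le> 2 * (2/3) ^ J * ((inv_coeff k n)\<^sup>2 * real n powr (- (3/2)))" for n
    proof (cases "n = 0")
      case False
      then have n: "n > 0" by simp
      have "1 - w n \<le> (1 / (3/2)) ^ J * real n powr (3/2 - 1)"
        unfolding w_def by (rule one_minus_poisson_weight(1)[OF n]) simp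
      then have w1: "1 - w n \<le> (2/3) ^ J * real n powr (1/2)" by simp
      have "1 - (w n)\<^sup>2 = (1 + w n) * (1 - w n)" by (simp add: power2_eq_square algebra_simps)
      moreover have "(1 + w n) * (1 - w n) \<le> 2 * ((2/3) ^ J * real n powr (1/2))"
        using w[OF n] w1 by (intro mult_mono) auto
      moreover have "(1 + w n) * (1 - w n) \<ge> 0" using w[OF n] by simp
      ultimately have w2: "0 \<le> 1 - (w n)\<^sup>2" "1 - (w n)\<^sup>2 \<le> 2 * ((2/3) ^ J * real n powr (1/2))" by auto
      have "g n * (1 - (w n)\<^sup>2) \<le> ((inv_coeff k n)\<^sup>2 * real n powr (-2)) * (2 * ((2/3) ^ J * real n powr (1/2)))"
        using gle[of n] g0[of n] w2 by (intro mult_mono) auto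
      also have "\<dots> = 2 * (2/3) ^ J * ((inv_coeff k n)\<^sup>2 * (real n powr (-2) * real n powr (1/2)))" by simp
      also have "real n powr (-2) * real n powr (1/2) = real n powr (- (3/2))" unfolding powr_add[symmetric] by simp
      finally show ?thesis using g0 w2 by simp
    qed (simp add: g_def)
    have h1: "(\<Sum>n<q. g n * (1 - (w n)\<^sup>2)) \<le> 2 * (2/3) ^ J * V"
    proof -
      have "(\<Sum>n<q. g n * (1 - (w n)\<^sup>2)) \<le> (\<Sum>n<q. 2 * (2/3) ^ J * ((inv_coeff k n)\<^sup>2 * real n powr (- (3/2))))"
        using head by (intro sum_mono) blast
      also have "\<dots> = 2 * (2/3) ^ J * (\<Sum>n<q. (inv_coeff k n)\<^sup>2 * real n powr (- (3/2)))" by (simp add: sum_distrib_left)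
      also have "\<dots> \<le> 2 * (2/3) ^ J * V"
        unfolding V_def by (intro mult_left_mono sum_le_suminf smV) auto
      finally show ?thesis .
    qed
    have h0: "(\<Sum>n<q. g n * (1 - (w n)\<^sup>2)) \<ge> 0" using head by (intro sum_nonneg) blast
    have tl: "g (l + q) \<le> C\<^sup>2 * real q powr (-1 + \<epsilon>) * real (Suc l) powr (- 1 - \<epsilon> / 2)" for l
    proof -
      define n where "n = l + q"
      have n: "real n \<ge> real q" "real n \<ge> real (Suc l)" "real n > 0" using q by (auto simp: n_def)
      have "(inv_coeff k n)\<^sup>2 \<le> (C * real n powr (\<epsilon> / 4))\<^sup>2"
        using C(2)[of n] by (metis abs_ge_zero power2_abs power_mono)
      then have "g n \<le> (C * real n powr (\<epsilon> / 4))\<^sup>2 * real n powr (-2)"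
        by (intro order_trans[OF gle] mult_right_mono) auto
      also have "\<dots> = C\<^sup>2 * (real n powr (\<epsilon> / 4) * real n powr (\<epsilon> / 4) * real n powr (-2))" by (simp add: power2_eq_square)
      \<comment> \<open>The exponent is split so that one part gives the saving in \<open>q\<close>
        and the other a summable series; \<open>\<epsilon> \<le> 1\<close> makes the first part
        nonincreasing.\<close>
      also have "real n powr (\<epsilon> / 4) * real n powr (\<epsilon> / 4) * real n powr (-2) = real n powr (-1 + \<epsilon>) * real n powr (- 1 - \<epsilon> / 2)"
        unfolding powr_add[symmetric] by (simp add: field_simps)
      also have "C\<^sup>2 * \<dots> \<le> C\<^sup>2 * (real q powr (-1 + \<epsilon>) * real (Suc l) powr (- 1 - \<epsilon> / 2))"
      proof (intro mult_left_mono mult_mono)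
        show "real n powr (-1 + \<epsilon>) \<le> real q powr (-1 + \<epsilon>)" using n q \<epsilon> by (intro powr_mono2') auto
        show "real n powr (- 1 - \<epsilon> / 2) \<le> real (Suc l) powr (- 1 - \<epsilon> / 2)" using n \<epsilon> by (intro powr_mono2') auto
      qed auto
      finally show ?thesis by (simp add: n_def mult_ac)
    qed
    have smgq: "summable (\<lambda>l. g (l + q))" using smg by (rule summable_ignore_initial_segment)
    have t1: "(\<Sum>l. g (l + q)) \<le> C\<^sup>2 * real q powr (-1 + \<epsilon>) * W"
    proof -
      have "(\<Sum>l. g (l + q)) \<le> (\<Sum>l. C\<^sup>2 * real q powr (-1 + \<epsilon>) * real (Suc l) powr (- 1 - \<epsilon> / 2))"
        by (intro suminf_le tl smgq summable_mult smW)
      also have "\<dots> = C\<^sup>2 * real q powr (-1 + \<epsilon>) * W" unfolding W_def by (rule suminf_mult[OF smW])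
      finally show ?thesis .
    qed
    have t0: "(\<Sum>l. g (l + q)) \<ge> 0" by (intro suminf_nonneg smgq g0)
    have "\<bar>(\<Sum>a\<in>totatives q. (smoothed_coeff k J a)\<^sup>2) - coprime_square_sum k q\<bar> \<le> C\<^sup>2 * real q powr (-1 + \<epsilon>) * W + 2 * (2/3) ^ J * V"
      using eq h0 h1 t0 t1 by linarith
    also have "\<dots> = (C\<^sup>2 * W) * real q powr (-1 + \<epsilon>) + (2 * V) * (2/3) ^ J" by simp
    also have "\<dots> \<le> K * real q powr (-1 + \<epsilon>) + K * (2/3) ^ J"
      using V0 W0 by (intro add_mono mult_right_mono) (auto simp: K_def)
    finally show ?thesis by (simp add: distrib_left)
  qed
  moreover have "K > 0" using V0 W0 by (simp add: K_def add_nonneg_pos)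
  ultimately show ?thesis by blast
qed

section \<open>The moment over even characters\<close>

lemma abs_square_diff_le:
  fixes x y e :: real
  assumes "\<bar>x - y\<bar> \<le> e" "x \<ge> 0" "y \<ge> 0"
  shows "\<bar>x\<^sup>2 - y\<^sup>2\<bar> \<le> e * (2 * y + e)"
proof -
  have "\<bar>x\<^sup>2 - y\<^sup>2\<bar> = \<bar>x - y\<bar> * (x + y)"
    using assms by (simp add: power2_eq_square square_diff_square_factored abs_mult)
  also have "\<dots> \<le> e * (2 * y + e)"
    using assms by (intro mult_mono) auto
  finally show ?thesis .
qed

text \<open>Rounding up loses the factor \<open>exp \<theta>\<close> in the first bound and only
  helps the second.\<close>

lemma smoothing_length:
  fixes A \<theta> :: real
  assumes q: "q \<ge> 2" and A: "A > 0" and \<theta>: "\<theta> > 0"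
  defines "J \<equiv> nat \<lceil>A * ln (real q)\<rceil>"
  shows "exp (\<theta> * real J) \<le> exp \<theta> * real q powr (\<theta> * A)"
    and "(4/5) ^ J \<le> real q powr (- (A * ln (5/4)))"
proof -
  have ln: "A * ln (real q) \<ge> 0" using q A by simp
  have J: "A * ln (real q) \<le> real J" "real J \<le> A * ln (real q) + 1"
    using ln unfolding J_def by linarith+
  have "exp (\<theta> * real J) \<le> exp (\<theta> * (A * ln (real q) + 1))" using J \<theta> by simp
  also have "\<dots> = exp \<theta> * real q powr (\<theta> * A)" using q by (simp add: powr_def exp_add algebra_simps)
  finally show "exp (\<theta> * real J) \<le> exp \<theta> * real q powr (\<theta> * A)" .
  have l: "ln (4/5 :: real) = - ln (5/4)" using ln_div[of 4 5] ln_div[of 5 4] by simp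
  have "(4/5 :: real) ^ J = (4/5) powr real J" by (simp add: powr_realpow)
  also have "\<dots> = exp (- (real J * ln (5/4)))" by (simp add: powr_def l)
  also have "\<dots> \<le> exp (- (A * ln (real q) * ln (5/4)))" using J(1) by (simp add: mult_right_mono)
  also have "\<dots> = real q powr (- (A * ln (5/4)))" using q by (simp add: powr_def algebra_simps)
  finally show "(4/5) ^ J \<le> real q powr (- (A * ln (5/4)))" .
qed

text \<open>Kept free of asymptotics: the three summands are the cost of replacing
  \<open>1 / L^k\<close> by a character sum, the principal character that Parseval brings in, and
  the distance of the Parseval side from the diagonal \<open>D\<close>.\<close>

lemma even_moment_estimate:
  fixes b :: "nat \<Rightarrow> real" and e H D X1 :: real
  assumes q: "q \<ge> 2" and H: "H \<ge> 0" and \<eta>: "\<eta> > 0" and e: "e \<ge> 0"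
    and b: "\<forall>n>0. \<bar>b n\<bar> \<le> H * real n powr (- 1 - \<eta>)"
    and approx: "\<forall>chi. dirichlet_char q chi \<and> chi \<noteq> principal_char q \<longrightarrow>
      (\<exists>T. (\<lambda>n. chi n * of_real (b n)) sums T \<and> norm (1 / dirichlet_L q chi 1 ^ k - T) \<le> e)"
    and diag: "\<bar>(\<Sum>a\<in>totatives q. (b a)\<^sup>2) - D\<bar> \<le> X1"
  defines "Z \<equiv> (\<Sum>n. real (Suc n) powr (- 1 - \<eta>))"
  shows "\<bar>(\<Sum>chi\<in>{chi. dirichlet_char q chi \<and> chi \<noteq> principal_char q \<and> chi (q - 1) = 1}.
        1 / norm (dirichlet_L q chi 1) ^ (2 * k)) - real (totient q) / 2 * D\<bar>
    \<le> real (totient q) * (e * (4 * H * Z + e)) + (2 * H * Z)\<^sup>2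
      + real (totient q) / 2 * (X1 + (4 * H\<^sup>2 * Z + 6 * (H * Z)\<^sup>2) / q)"
proof -
  define B where "B = (\<lambda>a. \<Sum>l. b (a + l * q))"
  define T where "T = (\<lambda>chi::nat \<Rightarrow> complex. \<Sum>a\<in>totatives q. chi a * of_real (B a))"
  have est: "summable (\<lambda>l. b (i + l * q))"
    "(\<Sum>a\<in>totatives q. \<bar>B a\<bar>) \<le> 2 * H * Z"
    "\<bar>(\<Sum>a\<in>totatives q. (B a)\<^sup>2) - (\<Sum>a\<in>totatives q. (b a)\<^sup>2)\<bar> \<le> 3 * (H * Z)\<^sup>2 / q"
    "\<bar>\<Sum>a\<in>totatives q. B a * B (q - a)\<bar> \<le> (4 * H\<^sup>2 * Z + 3 * (H * Z)\<^sup>2) / q" for i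
    unfolding Z_def B_def by (rule residue_sums_estimate[OF q H \<eta> b])+
  define X where "X = {chi. dirichlet_char q chi \<and> chi (q - 1) = 1}"
  define X' where "X' = {chi. dirichlet_char q chi \<and> chi \<noteq> principal_char q \<and> chi (q - 1) = 1}"
  define \<phi> where "\<phi> = real (totient q)"
  have finX: "finite X" unfolding X_def by (rule finite_subset[OF _ finite_dirichlet_chars[of q]]) auto
  have "coprime (q - 1) q" using q by (intro coprime_diff_one_left_nat) simp
  then have "principal_char q \<in> X"
    using principal_char_is_char[of q] q by (simp add: X_def) (simp add: principal_char_def)
  moreover have "X' = X - {principal_char q}" by (auto simp: X_def X'_def)
  ultimately have split: "(\<Sum>chi\<in>X. f chi) = f (principal_char q) + (\<Sum>chi\<in>X'. f chi)" for f :: "(nat \<Rightarrow> complex) \<Rightarrow> real"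
    using finX by (simp add: sum.remove)
  have cardX': "real (card X') \<le> \<phi>"
  proof -
    have "card X' \<le> card {chi. dirichlet_char q chi}"
      by (rule card_mono[OF finite_dirichlet_chars]) (auto simp: X'_def)
    then show ?thesis by (simp add: card_dirichlet_chars[OF q] \<phi>_def)
  qed
  have HZ: "2 * H * Z \<ge> 0" using est(2) sum_nonneg[of "totatives q" "\<lambda>a. \<bar>B a\<bar>"] by linarith
  have Tb: "norm (T chi) \<le> 2 * H * Z" if d: "dirichlet_char q chi" for chi
  proof -
    have "norm (T chi) \<le> (\<Sum>a\<in>totatives q. \<bar>B a\<bar>)"
      unfolding T_def
    proof (rule sum_norm_le)
      fix a
      show "norm (chi a * of_real (B a)) \<le> \<bar>B a\<bar>"
        using mult_right_mono[OF norm_dirichlet_char_le[OF d, of a], of "\<bar>B a\<bar>"] by (simp add: norm_mult)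
    qed
    then show ?thesis using est(2) by linarith
  qed
  have term_le: "\<bar>1 / norm (dirichlet_L q chi 1) ^ (2 * k) - (norm (T chi))\<^sup>2\<bar> \<le> e * (4 * H * Z + e)" if "chi \<in> X'" for chi
  proof -
    have d: "dirichlet_char q chi" "chi \<noteq> principal_char q" using that by (auto simp: X'_def)
    obtain T' where T': "(\<lambda>n. chi n * of_real (b n)) sums T'" "norm (1 / dirichlet_L q chi 1 ^ k - T') \<le> e"
      using approx d by blast
    have TT: "T' = T chi"
      unfolding T_def B_def by (rule character_sum_by_residues[OF q d(1) est(1) T'(1)])
    have "\<bar>norm (1 / dirichlet_L q chi 1 ^ k) - norm (T chi)\<bar> \<le> e"
      using T'(2)[unfolded TT] norm_triangle_ineq3[of "1 / dirichlet_L q chi 1 ^ k" "T chi"] by linarith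
    from abs_square_diff_le[OF this]
    have "\<bar>(norm (1 / dirichlet_L q chi 1 ^ k))\<^sup>2 - (norm (T chi))\<^sup>2\<bar> \<le> e * (2 * norm (T chi) + e)" by simp
    also have "\<dots> \<le> e * (2 * (2 * H * Z) + e)"
      using Tb[OF d(1)] e by (intro mult_left_mono add_right_mono) auto
    also have "(norm (1 / dirichlet_L q chi 1 ^ k))\<^sup>2 = 1 / norm (dirichlet_L q chi 1) ^ (2 * k)"
      by (simp add: norm_divide norm_power power_divide power_mult[symmetric] mult.commute)
    finally show ?thesis by (simp add: mult.assoc)
  qed
  have "\<bar>(\<Sum>chi\<in>X'. 1 / norm (dirichlet_L q chi 1) ^ (2 * k)) - (\<Sum>chi\<in>X'. (norm (T chi))\<^sup>2)\<bar>
      \<le> (\<Sum>chi\<in>X'. e * (4 * H * Z + e))"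
    unfolding sum_subtractf[symmetric] by (rule order_trans[OF sum_abs], rule sum_mono, rule term_le)
  also have "\<dots> = real (card X') * (e * (4 * H * Z + e))" by simp
  also have "\<dots> \<le> \<phi> * (e * (4 * H * Z + e))"
    using cardX' e HZ by (intro mult_right_mono) auto
  finally have s1: "\<bar>(\<Sum>chi\<in>X'. 1 / norm (dirichlet_L q chi 1) ^ (2 * k)) - (\<Sum>chi\<in>X'. (norm (T chi))\<^sup>2)\<bar>
      \<le> \<phi> * (e * (4 * H * Z + e))" .
  have s2: "0 \<le> (norm (T (principal_char q)))\<^sup>2" "(norm (T (principal_char q)))\<^sup>2 \<le> (2 * H * Z)\<^sup>2"
    using Tb[OF principal_char_is_char[of q]] q by (auto intro!: power_mono)
  define P where "P = (\<Sum>a\<in>totatives q. (B a)\<^sup>2) + (\<Sum>a\<in>totatives q. B a * B (q - a))"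
  have pars: "(\<Sum>chi\<in>X. (norm (T chi))\<^sup>2) = \<phi> / 2 * P"
    unfolding X_def T_def P_def \<phi>_def by (rule even_char_parseval[OF q])
  have "\<bar>P - D\<bar> \<le> X1 + (3 * (H * Z)\<^sup>2 / q + (4 * H\<^sup>2 * Z + 3 * (H * Z)\<^sup>2) / q)"
    using est(3,4) diag unfolding P_def by linarith
  also have "3 * (H * Z)\<^sup>2 / q + (4 * H\<^sup>2 * Z + 3 * (H * Z)\<^sup>2) / q = (4 * H\<^sup>2 * Z + 6 * (H * Z)\<^sup>2) / q"
    by (simp add: add_divide_distrib[symmetric])
  finally have PD: "\<bar>P - D\<bar> \<le> X1 + (4 * H\<^sup>2 * Z + 6 * (H * Z)\<^sup>2) / q" .
  have "\<bar>\<phi> / 2 * P - \<phi> / 2 * D\<bar> = \<phi> / 2 * \<bar>P - D\<bar>"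
    unfolding right_diff_distrib[symmetric] by (simp add: abs_mult \<phi>_def)
  also have "\<dots> \<le> \<phi> / 2 * (X1 + (4 * H\<^sup>2 * Z + 6 * (H * Z)\<^sup>2) / q)"
    by (rule mult_left_mono[OF PD]) (simp add: \<phi>_def)
  finally have s3: "\<bar>\<phi> / 2 * P - \<phi> / 2 * D\<bar> \<le> \<phi> / 2 * (X1 + (4 * H\<^sup>2 * Z + 6 * (H * Z)\<^sup>2) / q)" .
  have "\<bar>(\<Sum>chi\<in>X'. 1 / norm (dirichlet_L q chi 1) ^ (2 * k)) - \<phi> / 2 * D\<bar>
    \<le> \<phi> * (e * (4 * H * Z + e)) + (2 * H * Z)\<^sup>2 + \<phi> / 2 * (X1 + (4 * H\<^sup>2 * Z + 6 * (H * Z)\<^sup>2) / q)"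
    using s1 s2 s3 pars split[of "\<lambda>chi. (norm (T chi))\<^sup>2"] by linarith
  then show ?thesis by (simp only: X'_def \<phi>_def)
qed

text \<open>The value at \<open>q - 1\<close>, the representative of -1, expresses evenness. The
  O-term is an exact relative error \<open>E\<close>, with \<open>M\<close> fixed before
  \<open>q\<close>.\<close>

theorem theorem5p1:
  assumes "GRH"
  shows "\<forall>k::nat. k \<ge> 1 \<longrightarrow> (\<forall>\<epsilon>::real. \<epsilon> > 0 \<longrightarrow> (\<exists>M::real. \<forall>q::nat. q \<ge> 2 \<longrightarrow>
    (\<exists>E::real. \<bar>E\<bar> \<le> M * real q powr (-1 + \<epsilon>) \<and>
      (\<Sum>chi\<in>{chi. dirichlet_char q chi \<and> chi \<noteq> principal_char q \<and> chi (q - 1) = 1}.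
          1 / norm (dirichlet_L q chi 1) ^ (2 * k))
      = C_const k / 2 * real (totient q) *
          (\<Prod>p\<in>prime_factors q. 1 / local_factor k p) * (1 + E))))"
proof (intro allI impI)
  fix k :: nat and \<epsilon>' :: real
  assume k: "k \<ge> 1" and \<epsilon>': "\<epsilon>' > 0"
  \<comment> \<open>Replacing \<open>\<epsilon>'\<close> by a smaller exponent only strengthens the
    claim, since \<open>q \<ge> 1\<close>; the diagonal estimate asks for at most 1.\<close>
  define \<epsilon> where "\<epsilon> = min \<epsilon>' 1"
  have \<epsilon>: "\<epsilon> > 0" "\<epsilon> \<le> 1" "\<epsilon> \<le> \<epsilon>'" using \<epsilon>' by (auto simp: \<epsilon>_def)
  obtain K where K: "K > 0" "\<forall>q chi J. dirichlet_char q chi \<and> chi \<noteq> principal_char q \<longrightarrow>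
    (\<exists>T. (\<lambda>n. chi n * of_real (smoothed_coeff k J n)) sums T \<and>
      norm (1 / dirichlet_L q chi 1 ^ k - T) \<le> K * real q ^ (17 * k) * (4/5) ^ J)"
    using L_power_inverse_approx[OF assms, of k] by (elim exE conjE)
  \<comment> \<open>Makes \<open>(4/5) ^ J\<close> at most \<open>q powr (- (17 * k + 1))\<close>,
    which cancels \<open>q ^ (17 * k)\<close> and leaves an error \<open>K / q\<close>.\<close>
  define A where "A = (17 * real k + 1) / ln (5/4)"
  have A: "A > 0" by (simp add: A_def add_nonneg_pos)
  have Aln: "A * ln (5/4) = 17 * real k + 1" by (simp add: A_def)
  \<comment> \<open>The loss \<open>exp (\<theta> * J)\<close> then amounts to
    \<open>q powr (\<epsilon> / 4)\<close> up to a constant; it enters the main errors squared, as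
    \<open>q powr (\<epsilon> / 2)\<close>.\<close>
  define \<theta> where "\<theta> = \<epsilon> / (4 * A)"
  have \<theta>: "\<theta> > 0" "\<theta> * A = \<epsilon> / 4" using A \<epsilon> by (auto simp: \<theta>_def)
  obtain C \<eta> where C: "C > 0" and \<eta>: "\<eta> > 0"
    and cb: "\<forall>J. \<forall>n>0. \<bar>smoothed_coeff k J n\<bar> \<le> C * exp (\<theta> * real J) * real n powr (- 1 - \<eta>)"
    using smoothed_coeff_bound[OF \<theta>(1), of k] by (elim exE conjE)
  \<comment> \<open>The remaining \<open>\<epsilon> / 2\<close> is spent on the totient.\<close>
  obtain c where c: "c > 0" "\<And>q. q > 0 \<Longrightarrow> real (totient q) \<ge> c * real q powr (1 - \<epsilon> / 2)"
    using totient_lower_bound[of "\<epsilon> / 2"] \<epsilon>(1) by (metis half_gt_zero)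
  obtain Kd where Kd: "Kd > 0" "\<forall>q J. q \<ge> 2 \<longrightarrow>
    \<bar>(\<Sum>a\<in>totatives q. (smoothed_coeff k J a)\<^sup>2) - coprime_square_sum k q\<bar> \<le> Kd * (real q powr (-1 + \<epsilon>) + (2/3) ^ J)"
    using diagonal_estimate[OF \<epsilon>(1,2), of k] by (elim exE conjE)
  define Z where "Z = (\<Sum>n. real (Suc n) powr (- 1 - \<eta>))"
  have Z0: "Z \<ge> 0" unfolding Z_def
    by (intro suminf_nonneg) (use \<eta> in \<open>auto simp: summable_Suc_iff[of "\<lambda>n. real n powr (- 1 - \<eta>)"] summable_real_powr_iff simp del: of_nat_Suc\<close>)
  define h where "h = C * exp \<theta>"
  have h: "h > 0" using C by (simp add: h_def)
  \<comment> \<open>The coefficients collected at the end, after every error has been bounded by a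
    multiple of \<open>Q\<close>.\<close>
  define M where "M = 2 * (K * (4 * h * Z + K)) + 8 * (h * Z)\<^sup>2 / c + (2 * Kd + (4 * h\<^sup>2 * Z + 6 * (h * Z)\<^sup>2))"
  have M0: "M \<ge> 0" using h Z0 K(1) c(1) Kd(1) by (simp add: M_def)
  show "\<exists>M::real. \<forall>q::nat. q \<ge> 2 \<longrightarrow> (\<exists>E::real. \<bar>E\<bar> \<le> M * real q powr (-1 + \<epsilon>') \<and>
      (\<Sum>chi\<in>{chi. dirichlet_char q chi \<and> chi \<noteq> principal_char q \<and> chi (q - 1) = 1}.
          1 / norm (dirichlet_L q chi 1) ^ (2 * k))
      = C_const k / 2 * real (totient q) * (\<Prod>p\<in>prime_factors q. 1 / local_factor k p) * (1 + E))"
  proof (rule exI[of _ M], intro allI impI)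
    fix q :: nat assume q: "q \<ge> 2"
    have q1: "real q \<ge> 1" using q by simp
    define S where "S = (\<Sum>chi\<in>{chi. dirichlet_char q chi \<and> chi \<noteq> principal_char q \<and> chi (q - 1) = 1}.
          1 / norm (dirichlet_L q chi 1) ^ (2 * k))"
    define \<phi> where "\<phi> = real (totient q)"
    define D where "D = coprime_square_sum k q"
    define Q where "Q = real q powr (-1 + \<epsilon>)"
    define J where "J = nat \<lceil>A * ln (real q)\<rceil>"
    define y where "y = real q powr (\<epsilon> / 4)"
    define H where "H = h * y"
    define e where "e = K / real q"
    have D1: "D \<ge> 1" unfolding D_def by (rule coprime_square_sum_ge_1)
    have \<phi>0: "\<phi> > 0" using q by (simp add: \<phi>_def)
    have Q0: "Q > 0" using q by (simp add: Q_def)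
    have y1: "y \<ge> 1" unfolding y_def using q1 \<epsilon> by (intro ge_one_powr_ge_zero) auto
    have H0: "H \<ge> 0" using h y1 by (simp add: H_def)
    have e0: "e \<ge> 0" using K(1) by (simp add: e_def)
    have main: "C_const k / 2 * \<phi> * (\<Prod>p\<in>prime_factors q. 1 / local_factor k p) = \<phi> / 2 * D"
    proof -
      have "(\<Prod>p\<in>prime_factors q. local_factor k p) \<noteq> 0"
        using local_factor_ge_1[of k] by (auto simp: prod_zero_iff) (metis not_one_le_zero)
      then show ?thesis
        using C_const_factor[of q k] q by (simp add: D_def prod_dividef)
    qed
    have J1: "exp (\<theta> * real J) \<le> exp \<theta> * y"
      using smoothing_length(1)[OF q A \<theta>(1)] unfolding J_def y_def \<theta>(2) .
    have J2: "(4/5) ^ J \<le> real q powr (- (17 * real k + 1))"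
      using smoothing_length(2)[OF q A \<theta>(1)] unfolding J_def Aln .
    have bH: "\<forall>n>0. \<bar>smoothed_coeff k J n\<bar> \<le> H * real n powr (- 1 - \<eta>)"
    proof (intro allI impI)
      fix n :: nat assume "n > 0"
      have "C * exp (\<theta> * real J) \<le> C * (exp \<theta> * y)" using J1 C by (intro mult_left_mono) auto
      then have "C * exp (\<theta> * real J) * real n powr (- 1 - \<eta>) \<le> H * real n powr (- 1 - \<eta>)"
        unfolding H_def h_def by (intro mult_right_mono) (auto simp: mult.assoc)
      then show "\<bar>smoothed_coeff k J n\<bar> \<le> H * real n powr (- 1 - \<eta>)"
        using cb[rule_format, OF \<open>n > 0\<close>, of J] by linarith
    qed
    have eb: "K * real q ^ (17 * k) * (4/5) ^ J \<le> e"
    proof -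
      have "K * real q ^ (17 * k) * (4/5) ^ J \<le> K * real q ^ (17 * k) * real q powr (- (17 * real k + 1))"
        using J2 K(1) by (intro mult_left_mono) auto
      also have "\<dots> = K * (real q powr (17 * real k) * real q powr (- (17 * real k + 1)))"
        using q powr_realpow[of "real q" "17 * k"] by simp
      also have "\<dots> = K * real q powr (-1)"
        unfolding powr_add[symmetric] by simp
      also have "\<dots> = e" using q by (simp add: e_def powr_minus divide_inverse)
      finally show ?thesis .
    qed
    have approx: "\<forall>chi. dirichlet_char q chi \<and> chi \<noteq> principal_char q \<longrightarrow>
      (\<exists>T. (\<lambda>n. chi n * of_real (smoothed_coeff k J n)) sums T \<and> norm (1 / dirichlet_L q chi 1 ^ k - T) \<le> e)"
    proof (intro allI impI)
      fix chi assume "dirichlet_char q chi \<and> chi \<noteq> principal_char q"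
      from K(2)[rule_format, OF this, of J] obtain T where
        "(\<lambda>n. chi n * of_real (smoothed_coeff k J n)) sums T"
        "norm (1 / dirichlet_L q chi 1 ^ k - T) \<le> K * real q ^ (17 * k) * (4/5) ^ J" by (elim exE conjE)
      with eb show "\<exists>T. (\<lambda>n. chi n * of_real (smoothed_coeff k J n)) sums T \<and> norm (1 / dirichlet_L q chi 1 ^ k - T) \<le> e"
        by (intro exI[of _ T] conjI) linarith+
    qed
    have est: "\<bar>S - \<phi> / 2 * D\<bar> \<le> \<phi> * (e * (4 * H * Z + e)) + (2 * H * Z)\<^sup>2
        + \<phi> / 2 * (Kd * (Q + (2/3) ^ J) + (4 * H\<^sup>2 * Z + 6 * (H * Z)\<^sup>2) / q)"
      unfolding S_def \<phi>_def Z_def D_def Q_def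
      by (rule even_moment_estimate[OF q H0 \<eta> e0 bH approx Kd(2)[rule_format, OF q]])
    have qQ: "y\<^sup>2 / real q \<le> Q"
    proof -
      have m1: "real q powr (-1) = 1 / real q" using q by (simp add: powr_minus divide_inverse)
      have "y\<^sup>2 / real q = y * y * real q powr (-1)" unfolding m1 by (simp add: power2_eq_square)
      also have "\<dots> = real q powr (\<epsilon> / 4 + \<epsilon> / 4 + (-1))" unfolding y_def powr_add ..
      also have "\<dots> \<le> Q" unfolding Q_def using q1 \<epsilon> by (intro powr_mono) auto
      finally show ?thesis .
    qed
    have b1: "e * (4 * H * Z + e) \<le> K * (4 * h * Z + K) * Q"
    proof -
      have "e \<le> K * y" using K(1) q1 y1 mult_mono[of 1 y 1 "real q"] by (simp add: e_def field_simps)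
      then have "4 * H * Z + e \<le> (4 * h * Z + K) * y" by (simp add: H_def algebra_simps)
      then have "e * (4 * H * Z + e) \<le> (K / real q) * ((4 * h * Z + K) * y)"
        unfolding e_def using K(1) by (intro mult_left_mono) (auto simp: e_def)
      also have "\<dots> = K * (4 * h * Z + K) * (y / real q)" by simp
      also have "y / real q \<le> Q"
      proof -
        have "y \<le> y\<^sup>2" using y1 by (simp add: power2_eq_square)
        then have "y / real q \<le> y\<^sup>2 / real q" by (intro divide_right_mono) auto
        then show ?thesis using qQ by linarith
      qed
      then have "K * (4 * h * Z + K) * (y / real q) \<le> K * (4 * h * Z + K) * Q"
        using K(1) h Z0 by (intro mult_left_mono) auto
      finally show ?thesis .
    qed
    \<comment> \<open>The term of the principal character: \<open>y\<^sup>2\<close> over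
      \<open>q powr (1 - \<epsilon> / 2)\<close> is exactly
      \<open>q powr (-1 + \<epsilon>)\<close>.\<close>
    have b2: "(2 * H * Z)\<^sup>2 / \<phi> \<le> 4 * (h * Z)\<^sup>2 / c * Q"
    proof -
      have ph: "c * real q powr (1 - \<epsilon> / 2) \<le> \<phi>" using c(2)[of q] q by (simp add: \<phi>_def)
      have pos: "c * real q powr (1 - \<epsilon> / 2) > 0" using c(1) q by simp
      have "(2 * H * Z)\<^sup>2 / \<phi> \<le> (2 * H * Z)\<^sup>2 / (c * real q powr (1 - \<epsilon> / 2))"
        by (rule divide_left_mono[OF ph _ mult_pos_pos[OF \<phi>0 pos]]) simp
      also have "\<dots> = 4 * (h * Z)\<^sup>2 / c * (y\<^sup>2 / real q powr (1 - \<epsilon> / 2))"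
        by (simp add: H_def power_mult_distrib)
      also have "y\<^sup>2 / real q powr (1 - \<epsilon> / 2) = real q powr (\<epsilon> / 4 + \<epsilon> / 4 - (1 - \<epsilon> / 2))"
        unfolding powr_diff powr_add y_def by (simp add: power2_eq_square)
      also have "\<epsilon> / 4 + \<epsilon> / 4 - (1 - \<epsilon> / 2) = -1 + \<epsilon>" by (simp add: field_simps)
      finally show ?thesis by (simp add: Q_def)
    qed
    have b3: "(2/3) ^ J \<le> Q"
    proof -
      have "(2/3 :: real) ^ J \<le> (4/5) ^ J" by (intro power_mono) auto
      also have "\<dots> \<le> real q powr (- (17 * real k + 1))" by (rule J2)
      also have "\<dots> \<le> Q" unfolding Q_def using q1 \<epsilon> by (intro powr_mono) auto
      finally show ?thesis .
    qed
    have b4: "(4 * H\<^sup>2 * Z + 6 * (H * Z)\<^sup>2) / q \<le> (4 * h\<^sup>2 * Z + 6 * (h * Z)\<^sup>2) * Q"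
    proof -
      have "(4 * H\<^sup>2 * Z + 6 * (H * Z)\<^sup>2) / q = (4 * h\<^sup>2 * Z + 6 * (h * Z)\<^sup>2) * (y\<^sup>2 / real q)"
        by (simp add: H_def power_mult_distrib algebra_simps add_divide_distrib)
      also have "\<dots> \<le> (4 * h\<^sup>2 * Z + 6 * (h * Z)\<^sup>2) * Q" using qQ Z0 by (intro mult_left_mono) auto
      finally show ?thesis .
    qed
    \<comment> \<open>Being the relative error itself, \<open>E\<close> satisfies the identity
      automatically and only its size has to be shown; \<open>D \<ge> 1\<close> allows division by
      \<open>\<phi> / 2\<close> alone.\<close>
    define E where "E = (S - \<phi> / 2 * D) / (\<phi> / 2 * D)"
    have pd: "\<phi> / 2 * D > 0" using \<phi>0 D1 by simp
    have "\<bar>E\<bar> = \<bar>S - \<phi> / 2 * D\<bar> / (\<phi> / 2 * D)" unfolding E_def abs_divide abs_of_pos[OF pd] ..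
    also have "\<dots> \<le> \<bar>S - \<phi> / 2 * D\<bar> / (\<phi> / 2)"
      using \<phi>0 D1 by (intro divide_left_mono) auto
    also have "\<dots> \<le> (\<phi> * (e * (4 * H * Z + e)) + (2 * H * Z)\<^sup>2
        + \<phi> / 2 * (Kd * (Q + (2/3) ^ J) + (4 * H\<^sup>2 * Z + 6 * (H * Z)\<^sup>2) / q)) / (\<phi> / 2)"
      using est \<phi>0 by (intro divide_right_mono) auto
    also have "\<dots> = 2 * (e * (4 * H * Z + e)) + 2 * ((2 * H * Z)\<^sup>2 / \<phi>)
        + (Kd * (Q + (2/3) ^ J) + (4 * H\<^sup>2 * Z + 6 * (H * Z)\<^sup>2) / q)"
    proof -
      have "(\<phi> * u + v + \<phi> / 2 * x) / (\<phi> / 2) = 2 * u + 2 * (v / \<phi>) + x" for u v x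
        using \<phi>0 by (simp add: field_simps)
      then show ?thesis .
    qed
    also have "\<dots> \<le> 2 * (K * (4 * h * Z + K) * Q) + 2 * (4 * (h * Z)\<^sup>2 / c * Q)
        + (Kd * (Q + Q) + (4 * h\<^sup>2 * Z + 6 * (h * Z)\<^sup>2) * Q)"
      using b1 b2 b3 b4 Kd(1) by (intro add_mono mult_left_mono) auto
    also have "\<dots> = M * Q" by (simp add: M_def algebra_simps)
    also have "\<dots> \<le> M * real q powr (-1 + \<epsilon>')"
      unfolding Q_def using M0 q1 \<epsilon> by (intro mult_left_mono powr_mono) auto
    finally have Eb: "\<bar>E\<bar> \<le> M * real q powr (-1 + \<epsilon>')" .
    have "x = y * (1 + (x - y) / y)" if "y > 0" for x y :: real using that by (simp add: field_simps)
    from this[OF pd] have SE: "S = \<phi> / 2 * D * (1 + E)" unfolding E_def .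
    show "\<exists>E::real. \<bar>E\<bar> \<le> M * real q powr (-1 + \<epsilon>') \<and>
      (\<Sum>chi\<in>{chi. dirichlet_char q chi \<and> chi \<noteq> principal_char q \<and> chi (q - 1) = 1}.
          1 / norm (dirichlet_L q chi 1) ^ (2 * k))
      = C_const k / 2 * real (totient q) * (\<Prod>p\<in>prime_factors q. 1 / local_factor k p) * (1 + E)"
      unfolding S_def[symmetric] \<phi>_def[symmetric] main using Eb SE by blast
  qed
qed

end
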